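(* Let $X$ be the Bessel process of dimension $\alpha\in[1,\infty)$ started at $X_0\ge 0$, and let $\Phi(t)=t^p$ for some $p>0$. Then there exist constants $c,C\in(0,\infty)$ such that $$c\,\mathbb{E}\,\Phi(\sqrt{[X]_\tau})\le \mathbb{E}\,\Phi(X^*_\tau)\le C\,\mathbb{E}\,\Phi(\sqrt{[X]_\tau})\quad\text{for all stopping times }\tau.$$ More generally, the same conclusion holds for every function $\Phi:[0,\infty)\to[0,\infty)$ which is cadlag, increasing, such that $\Phi(x)=0$ if and only if $x=0$, and for which $\sup_{t>0}\Phi(\beta t)/\Phi(t)<\infty$ for some (and thus all) $\beta>1$.
   Context: We work on a filtered probability space $(\Omega,\mathbb{F},(\mathcal{F}_t)_{t\ge0},\mathbb{P})$ whose filtration satisfies the usual conditions. The Bessel process of dimension $\alpha\ge 1$ started at $X_0\ge0$ is the nonnegative continuous process $X=\sqrt{Z}$, where $Z$ (the squared Bessel process) is the unique solution of $dZ_t=\alpha\,dt+2\sqrt{|Z_t|}\,dW_t$, $Z_0=X_0^2$, with $W$ an $(\mathcal{F}_t)_t$-Brownian motion; for integer $\alpha=n$ it has the law of the Euclidean norm of an $n$-dimensional Brownian motion, and for $\alpha>1$ it is a (weak) solution of $dX=\frac{\alpha-1}{2X}dt+dW$. For $\alpha\ge1$ it is a semimartingale. $X^*_t:=\sup_{u\le t}|X_u|$ is the running maximum and $[X]$ is the quadratic variation with the convention $[X]_0=X_0^2$ (so $[X]_t=X_0^2+t$). Stopping times are with respect to $(\mathcal{F}_t)_t$ and may take the value $\infty$;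 values at $\infty$ of increasing processes and of $\Phi$ are understood as limits. *)

theory Defs
  imports "HOL-Probability.Probability"
begin

section \<open>Filtered probability spaces and stopping times\<close>

text \<open>Time is the set of nonnegative reals. Processes and filtrations are indexed by
  \<^typ>\<open>real\<close>, and their values at negative indices are never used.\<close>

locale filtered_prob_space = prob_space M + complete_measure M
  for M :: "'a measure" +
  fixes F :: "real \<Rightarrow> 'a measure"
  assumes subalgebra_F: "0 \<le> t \<Longrightarrow> subalgebra M (F t)"
    and F_mono: "0 \<le> s \<Longrightarrow> s \<le> t \<Longrightarrow> sets (F s) \<subseteq> sets (F t)"
    and F_right_continuous: "0 \<le> t \<Longrightarrow> (\<Inter>s\<in>{t<..}. sets (F s)) = sets (F t)"
    and null_sets_F: "null_sets M \<subseteq> sets (F 0)"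

definition adapted :: "(real \<Rightarrow> 'a measure) \<Rightarrow> (real \<Rightarrow> 'a \<Rightarrow> real) \<Rightarrow> bool" where
  "adapted F Y \<longleftrightarrow> (\<forall>t\<ge>0. Y t \<in> borel_measurable (F t))"

definition continuous_paths :: "'a measure \<Rightarrow> (real \<Rightarrow> 'a \<Rightarrow> real) \<Rightarrow> bool" where
  "continuous_paths M Y \<longleftrightarrow> (AE \<omega> in M. continuous_on {0..} (\<lambda>t. Y t \<omega>))"

text \<open>The library's \<^const>\<open>stopping_time\<close> takes values in the index type of the filtration,
  hence cannot be infinite for a filtration indexed by the reals.\<close>

definition ext_stopping_time :: "(real \<Rightarrow> 'a measure) \<Rightarrow> ('a \<Rightarrow> ennreal) \<Rightarrow> bool" where
  "ext_stopping_time F \<tau> \<longleftrightarrow> (\<forall>t\<ge>0. Measurable.pred (F t) (\<lambda>\<omega>. \<tau> \<omega> \<le> ennreal t))"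

text \<open>Measurability is demanded explicitly because \<^const>\<open>measure\<close> is zero on nonmeasurable
  sets.\<close>

definition tendsto_in_prob :: "'a measure \<Rightarrow> (nat \<Rightarrow> 'a \<Rightarrow> real) \<Rightarrow> ('a \<Rightarrow> real) \<Rightarrow> bool" where
  "tendsto_in_prob M Y L \<longleftrightarrow>
     (\<forall>n. Y n \<in> borel_measurable M) \<and> L \<in> borel_measurable M \<and>
     (\<forall>\<epsilon>>0. (\<lambda>n. measure M {\<omega> \<in> space M. \<bar>Y n \<omega> - L \<omega>\<bar> > \<epsilon>}) \<longlonglongrightarrow> 0)"

section \<open>Brownian motion and the Ito integral\<close>

definition brownian_motion ::
  "'a measure \<Rightarrow> (real \<Rightarrow> 'a measure) \<Rightarrow> (real \<Rightarrow> 'a \<Rightarrow> real) \<Rightarrow> bool" where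
  "brownian_motion M F W \<longleftrightarrow>
     adapted F W \<and> continuous_paths M W \<and> (AE \<omega> in M. W 0 \<omega> = 0) \<and>
     (\<forall>s t. 0 \<le> s \<and> s < t \<longrightarrow>
        distributed M lborel (\<lambda>\<omega>. W t \<omega> - W s \<omega>) (normal_density 0 (sqrt (t - s))) \<and>
        prob_space.indep_set M (sets (F s))
          (sets (vimage_algebra (space M) (\<lambda>\<omega>. W t \<omega> - W s \<omega>) borel)))"

text \<open>\<open>(k, a, \<xi>)\<close> encodes the simple predictable process
  \<open>\<Sum>i<k. \<xi> i * indicator (a i, a (i + 1)]\<close>.\<close>

definition simple_process ::
  "(real \<Rightarrow> 'a measure) \<Rightarrow> nat \<Rightarrow> (nat \<Rightarrow> real) \<Rightarrow> (nat \<Rightarrow> 'a \<Rightarrow> real) \<Rightarrow> bool" where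
  "simple_process F k a \<xi> \<longleftrightarrow>
     0 \<le> a 0 \<and>
     (\<forall>i<k. a i \<le> a (Suc i) \<and> \<xi> i \<in> borel_measurable (F (a i)) \<and>
        (\<exists>B. \<forall>\<omega>\<in>space (F (a i)). \<bar>\<xi> i \<omega>\<bar> \<le> B))"

definition simple_value ::
  "nat \<Rightarrow> (nat \<Rightarrow> real) \<Rightarrow> (nat \<Rightarrow> 'a \<Rightarrow> real) \<Rightarrow> real \<Rightarrow> 'a \<Rightarrow> real" where
  "simple_value k a \<xi> s \<omega> = (\<Sum>i<k. \<xi> i \<omega> * indicator {a i<..a (Suc i)} s)"

definition simple_integral ::
  "nat \<Rightarrow> (nat \<Rightarrow> real) \<Rightarrow> (nat \<Rightarrow> 'a \<Rightarrow> real) \<Rightarrow> (real \<Rightarrow> 'a \<Rightarrow> real) \<Rightarrow> real \<Rightarrow> 'a \<Rightarrow> real" where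
  "simple_integral k a \<xi> W t \<omega> =
     (\<Sum>i<k. \<xi> i \<omega> * (W (min (a (Suc i)) t) \<omega> - W (min (a i) t) \<omega>))"

text \<open>\<open>J\<close> is a continuous version of the Ito integral process of \<open>H\<close> with respect to \<open>W\<close>: \<open>H\<close> is
  locally square integrable, and \<open>J t\<close> is the limit in probability of the integrals of simple
  processes whose pathwise \<open>L\<^sup>2\<close> distance to \<open>H\<close> on \<open>[0, t]\<close> tends to zero in probability.
  This determines \<open>J\<close> up to indistinguishability.\<close>

definition ito_integral ::
  "'a measure \<Rightarrow> (real \<Rightarrow> 'a measure) \<Rightarrow> (real \<Rightarrow> 'a \<Rightarrow> real) \<Rightarrow> (real \<Rightarrow> 'a \<Rightarrow> real) \<Rightarrow>
   (real \<Rightarrow> 'a \<Rightarrow> real) \<Rightarrow> bool" where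
  "ito_integral M F W H J \<longleftrightarrow>
     adapted F H \<and>
     (AE \<omega> in M. \<forall>t\<ge>0. set_borel_measurable lborel {0..t} (\<lambda>s. H s \<omega>) \<and>
        set_integrable lborel {0..t} (\<lambda>s. (H s \<omega>)\<^sup>2)) \<and>
     adapted F J \<and> continuous_paths M J \<and>
     (\<exists>k a \<xi>. (\<forall>n. simple_process F (k n) (a n) (\<xi> n)) \<and>
        (\<forall>t\<ge>0.
           tendsto_in_prob M
             (\<lambda>n \<omega>. LINT s:{0..t}|lborel. (simple_value (k n) (a n) (\<xi> n) s \<omega> - H s \<omega>)\<^sup>2)
             (\<lambda>\<omega>. 0) \<and>
           tendsto_in_prob M (\<lambda>n. simple_integral (k n) (a n) (\<xi> n) W t) (J t)))"

section \<open>Bessel processes\<close>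

text \<open>\<open>Z\<close> solves \<open>dZ = \<alpha> dt + 2 sqrt \<bar>Z\<bar> dW\<close> with \<open>Z 0 = z\<^sub>0\<close>.\<close>

definition squared_bessel ::
  "'a measure \<Rightarrow> (real \<Rightarrow> 'a measure) \<Rightarrow> (real \<Rightarrow> 'a \<Rightarrow> real) \<Rightarrow> real \<Rightarrow> ('a \<Rightarrow> real) \<Rightarrow>
   (real \<Rightarrow> 'a \<Rightarrow> real) \<Rightarrow> bool" where
  "squared_bessel M F W \<alpha> z\<^sub>0 Z \<longleftrightarrow>
     adapted F Z \<and> continuous_paths M Z \<and>
     (\<exists>J. ito_integral M F W (\<lambda>s \<omega>. 2 * sqrt \<bar>Z s \<omega>\<bar>) J \<and>
        (AE \<omega> in M. \<forall>t\<ge>0. Z t \<omega> = z\<^sub>0 \<omega> + \<alpha> * t + J t \<omega>))"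

text \<open>The condition \<open>0 \<le> X t \<omega>\<close> is not redundant as a formula, since \<^const>\<open>sqrt\<close> is an odd
  function on the reals.\<close>

definition bessel_process ::
  "'a measure \<Rightarrow> (real \<Rightarrow> 'a measure) \<Rightarrow> real \<Rightarrow> ('a \<Rightarrow> real) \<Rightarrow> (real \<Rightarrow> 'a \<Rightarrow> real) \<Rightarrow> bool" where
  "bessel_process M F \<alpha> x\<^sub>0 X \<longleftrightarrow>
     (\<exists>W Z. brownian_motion M F W \<and> squared_bessel M F W \<alpha> (\<lambda>\<omega>. (x\<^sub>0 \<omega>)\<^sup>2) Z \<and>
        (AE \<omega> in M. \<forall>t\<ge>0. 0 \<le> X t \<omega> \<and> X t \<omega> = sqrt (Z t \<omega>)))"

section \<open>Quadratic variation and running maximum\<close>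

text \<open>\<open>\<pi> n 0 \<le> \<dots> \<le> \<pi> n (N n)\<close> are partitions of \<open>[0, t]\<close> whose mesh tends to zero.\<close>

definition refining_partitions :: "real \<Rightarrow> (nat \<Rightarrow> nat) \<Rightarrow> (nat \<Rightarrow> nat \<Rightarrow> real) \<Rightarrow> bool" where
  "refining_partitions t N \<pi> \<longleftrightarrow>
     (\<forall>n. \<pi> n 0 = 0 \<and> \<pi> n (N n) = t \<and> (\<forall>i<N n. \<pi> n i \<le> \<pi> n (Suc i))) \<and>
     (\<forall>\<delta>>0. \<forall>\<^sub>F n in sequentially. \<forall>i<N n. \<pi> n (Suc i) - \<pi> n i < \<delta>)"

text \<open>\<open>Q\<close> is a version of the quadratic variation of \<open>X\<close>, with the convention that its value at
  time \<open>0\<close> is \<open>(X 0)\<^sup>2\<close>.\<close>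

definition quadratic_variation ::
  "'a measure \<Rightarrow> (real \<Rightarrow> 'a measure) \<Rightarrow> (real \<Rightarrow> 'a \<Rightarrow> real) \<Rightarrow> (real \<Rightarrow> 'a \<Rightarrow> real) \<Rightarrow> bool" where
  "quadratic_variation M F X Q \<longleftrightarrow>
     adapted F Q \<and>
     (AE \<omega> in M. Q 0 \<omega> = (X 0 \<omega>)\<^sup>2 \<and> mono_on {0..} (\<lambda>t. Q t \<omega>) \<and>
        (\<forall>t\<ge>0. continuous (at_right t) (\<lambda>t. Q t \<omega>))) \<and>
     (\<forall>t\<ge>0. \<forall>N \<pi>. refining_partitions t N \<pi> \<longrightarrow>
        tendsto_in_prob M
          (\<lambda>n \<omega>. (X 0 \<omega>)\<^sup>2 + (\<Sum>i<N n. (X (\<pi> n (Suc i)) \<omega> - X (\<pi> n i) \<omega>)\<^sup>2)) (Q t))"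

definition running_max :: "(real \<Rightarrow> 'a \<Rightarrow> real) \<Rightarrow> real \<Rightarrow> 'a \<Rightarrow> real" where
  "running_max X t \<omega> = (SUP u\<in>{0..t}. \<bar>X u \<omega>\<bar>)"

text \<open>The value of a nonnegative increasing process at a possibly infinite time: its value at
  \<open>\<infinity>\<close> is its limit, that is, its supremum. Likewise for a nonnegative increasing function.\<close>

definition at_time :: "(real \<Rightarrow> 'a \<Rightarrow> real) \<Rightarrow> ('a \<Rightarrow> ennreal) \<Rightarrow> 'a \<Rightarrow> ennreal" where
  "at_time A \<tau> \<omega> = (if \<tau> \<omega> = \<infinity> then (SUP t\<in>{0..}. ennreal (A t \<omega>))
     else ennreal (A (enn2real (\<tau> \<omega>)) \<omega>))"

definition extend_to_infinity :: "(real \<Rightarrow> real) \<Rightarrow> ennreal \<Rightarrow> ennreal" where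
  "extend_to_infinity \<Phi> y = (if y = \<infinity> then (SUP t\<in>{0..}. ennreal (\<Phi> t))
     else ennreal (\<Phi> (enn2real y)))"

section \<open>Moderate functions\<close>

definition cadlag :: "(real \<Rightarrow> real) \<Rightarrow> bool" where
  "cadlag \<Phi> \<longleftrightarrow>
     (\<forall>t\<ge>0. continuous (at_right t) \<Phi>) \<and> (\<forall>t>0. \<exists>l. (\<Phi> \<longlongrightarrow> l) (at_left t))"

definition moderate :: "(real \<Rightarrow> real) \<Rightarrow> bool" where
  "moderate \<Phi> \<longleftrightarrow>
     (\<forall>t\<ge>0. 0 \<le> \<Phi> t) \<and> cadlag \<Phi> \<and> mono_on {0..} \<Phi> \<and> (\<forall>t\<ge>0. \<Phi> t = 0 \<longleftrightarrow> t = 0) \<and>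
     (\<exists>\<beta>>1. bdd_above ((\<lambda>t. \<Phi> (\<beta> * t) / \<Phi> t) ` {0<..}))"

text \<open>The expectations are nonnegative integrals and may be infinite.\<close>

definition bdg_inequalities ::
  "'a measure \<Rightarrow> (real \<Rightarrow> 'a measure) \<Rightarrow> (real \<Rightarrow> 'a \<Rightarrow> real) \<Rightarrow> (real \<Rightarrow> 'a \<Rightarrow> real) \<Rightarrow>
   (real \<Rightarrow> real) \<Rightarrow> bool" where
  "bdg_inequalities M F X Q \<Phi> \<longleftrightarrow>
     (\<exists>c C :: real. 0 < c \<and> 0 < C \<and>
        (\<forall>\<tau>. ext_stopping_time F \<tau> \<longrightarrow>
           ennreal c *
             (\<integral>\<^sup>+\<omega>. extend_to_infinity \<Phi> (at_time (\<lambda>t \<omega>. sqrt (Q t \<omega>)) \<tau> \<omega>) \<partial>M)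
           \<le> (\<integral>\<^sup>+\<omega>. extend_to_infinity \<Phi> (at_time (running_max X) \<tau> \<omega>) \<partial>M) \<and>
           (\<integral>\<^sup>+\<omega>. extend_to_infinity \<Phi> (at_time (running_max X) \<tau> \<omega>) \<partial>M)
           \<le> ennreal C *
             (\<integral>\<^sup>+\<omega>. extend_to_infinity \<Phi> (at_time (\<lambda>t \<omega>. sqrt (Q t \<omega>)) \<tau> \<omega>) \<partial>M)))"

end

theory Submission
  imports Defs
begin

text \<open>
  Since \<open>[X]\<^sub>t = X\<^sub>0\<^sup>2 + t\<close>, the theorem compares \<open>X\<^sup>*\<^sub>\<tau>\<close> with \<open>sqrt (X\<^sub>0\<^sup>2 + \<tau>)\<close>, and this
  follows from two good-lambda inequalities. If \<open>X\<close> climbs from level \<open>\<kappa>\<close> to \<open>2\<kappa>\<close> before the short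
  time \<open>\<delta>\<^sup>2\<kappa>\<^sup>2\<close>, or if it stays below \<open>\<delta>\<kappa>\<close> during the long interval \<open>[\<kappa>\<^sup>2, 3\<kappa>\<^sup>2]\<close>, then the martingale
  part of \<open>X\<^sup>2\<close> is at least of order \<open>\<kappa>\<^sup>2\<close>, while its conditional variance is of order \<open>\<delta>\<^sup>2\<kappa>\<^sup>4\<close>; Chebyshev's
  inequality gives a factor \<open>\<delta>\<^sup>2\<close>.

  The stochastic integral enters only through its approximation by Riemann sums, uniformly over the
  points of a grid, so that all stopping takes place at grid times.

  For the quadratic variation, \<open>\<Sum>(\<Delta>X)\<^sup>2\<close> is compared with \<open>\<Sum>(\<Delta>W)\<^sup>2\<close>. Where \<open>X\<close> is bounded away from zero,
  \<open>\<Delta>X - \<Delta>W\<close> is small by \<open>X\<^sup>2\<close> having martingale part \<open>2 X dW\<close>. Where it is not, the conditional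
  second moments are at most a multiple of the time step, and \<open>X\<close> spends no time at zero: given
  \<open>X\<^sub>s = 0\<close>, the probability of \<open>X\<^sub>t = 0\<close> is at most some \<open>q < 1\<close> independent of \<open>s < t\<close>, yet by continuity of the
  paths the probability of \<open>X\<^sub>s = 0 \<noteq> X\<^sub>t\<close> vanishes as \<open>s\<close> increases to \<open>t\<close>.
\<close>

section \<open>Brownian increments\<close>

text \<open>\<open>ito_integral\<close> describes only limits in probability at fixed times and says
  nothing of martingales or stopping. Stopping is therefore moved into the coefficients of finite
  sums over Brownian increments, where independence yields the isometry, and
  \<open>riemann_approx\<close> carries the conclusion over to \<open>X\<^sup>2\<close>. The
  isometry asks for bounded coefficients while \<open>X\<close> is unbounded: the good-lambda sums
  stop at a multiple of \<open>\<kappa>\<close>, the moment estimates at a level \<open>L\<close>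
  exceeded with small probability. Conditional expectations are replaced by nonnegative bounded
  weights \<open>g\<close> that are \<open>F s\<close>-measurable. The value of \<open>[X]\<close>
  cannot be read off \<open>dX = (\<alpha> - 1) / (2 X) dt + dW\<close>: only the equation for the
  square is given, and for \<open>\<alpha> < 2\<close> the process returns to zero, where the square
  root is not smooth. Increments of \<open>X\<close> are instead recovered from those of
  \<open>X\<^sup>2\<close>, and a neighbourhood of zero is controlled by its expected
  occupation.\<close>

lemma abs_le_imp_square_le: "\<bar>x::real\<bar> \<le> B \<Longrightarrow> x\<^sup>2 \<le> B\<^sup>2"
  by (metis abs_ge_zero power2_abs power_mono)

lemma grid_mono:
  assumes "\<And>l. l < L \<Longrightarrow> p l \<le> p (Suc l)" "i \<le> j" "j \<le> L"
  shows "(p i :: real) \<le> p j"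
  using assms(2,3)
proof (induction j)
  case (Suc j)
  then show ?case using assms(1)[of j] by (cases "i = Suc j") auto
qed auto

text \<open>The partial sums increase, so the terms kept form an initial segment, and the last test
  passed bounds their sum. The test includes the current term, so \<open>\<delta>\<close> is not
  overshot.\<close>

lemma capped_partial_sums:
  fixes a :: "nat \<Rightarrow> real"
  assumes "\<And>l. 0 \<le> a l" "0 \<le> \<delta>"
  shows "(\<Sum>l<L. if (\<Sum>j\<le>l. a j) \<le> \<delta> then a l else 0) \<le> \<delta>"
proof (induction L)
  case (Suc L)
  show ?case
  proof (cases "(\<Sum>j\<le>L. a j) \<le> \<delta>")
    case True
    have "(\<Sum>l<Suc L. if (\<Sum>j\<le>l. a j) \<le> \<delta> then a l else 0) \<le> (\<Sum>l<Suc L. a l)"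
      using assms(1) by (intro sum_mono) auto
    also have "\<dots> \<le> \<delta>" using True by (simp add: lessThan_Suc_atMost)
    finally show ?thesis .
  next
    case False
    then show ?thesis using Suc by simp
  qed
qed (use assms in simp)

context filtered_prob_space
begin

lemma space_F: "0 \<le> t \<Longrightarrow> space (F t) = space M"
  using subalgebra_F[of t] by (simp add: subalgebra_def)

lemma sets_F_subset: "0 \<le> t \<Longrightarrow> sets (F t) \<subseteq> sets M"
  using subalgebra_F[of t] by (simp add: subalgebra_def)

lemma measurable_F_M: "0 \<le> t \<Longrightarrow> f \<in> borel_measurable (F t) \<Longrightarrow> f \<in> borel_measurable M"
  using subalgebra_F measurable_from_subalg by blast

lemma measurable_F_mono:
  assumes "0 \<le> s" "s \<le> t" "f \<in> borel_measurable (F s)"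
  shows "f \<in> borel_measurable (F t)"
  using assms F_mono[OF assms(1,2)] space_F[of s] space_F[of t]
  by (auto simp: measurable_def)

lemma null_set_F: "A \<in> null_sets M \<Longrightarrow> 0 \<le> t \<Longrightarrow> A \<in> sets (F t)"
  using null_sets_F F_mono[of 0 t] by auto

text \<open>Off \<open>G\<close>, the truncation of \<open>f\<close> at \<open>m\<close> contributes
  at most \<open>m * e\<close>, and \<open>e\<close> may be chosen after \<open>m\<close>; monotone
  convergence then removes the truncation. Estimates valid outside small exceptional events thus
  become moment bounds, without prior integrability of \<open>f\<close>.\<close>

lemma nn_integral_le_of_high_prob:
  assumes f[measurable]: "f \<in> borel_measurable M" and f0: "\<And>\<omega>. \<omega> \<in> space M \<Longrightarrow> f \<omega> < \<infinity>" and C: "0 \<le> C"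
    and ev: "\<And>e::real. 0 < e \<Longrightarrow> \<exists>G\<in>events. prob (space M - G) \<le> e \<and> (\<integral>\<^sup>+\<omega>. f \<omega> * indicator G \<omega> \<partial>M) \<le> ennreal (C + e)"
  shows "(\<integral>\<^sup>+\<omega>. f \<omega> \<partial>M) \<le> ennreal C"
proof -
  have bd: "(\<integral>\<^sup>+\<omega>. min (f \<omega>) (of_nat m) \<partial>M) \<le> ennreal C" for m :: nat
  proof (rule ennreal_le_epsilon)
    fix e :: real assume e: "0 < e"
    \<comment> \<open>The bound on \<open>G\<close> loses \<open>d\<close> and the complement loses
      \<open>m * d\<close>, together \<open>e\<close>.\<close>
    define d where "d = e / (1 + real m)"
    have d: "0 < d" using e by (simp add: d_def)
    from ev[OF d] obtain G where G[measurable]: "G \<in> events" and pG: "prob (space M - G) \<le> d"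
      and iG: "(\<integral>\<^sup>+\<omega>. f \<omega> * indicator G \<omega> \<partial>M) \<le> ennreal (C + d)" by auto
    have "(\<integral>\<^sup>+\<omega>. min (f \<omega>) (of_nat m) \<partial>M) \<le> (\<integral>\<^sup>+\<omega>. f \<omega> * indicator G \<omega> + of_nat m * indicator (space M - G) \<omega> \<partial>M)"
      by (intro nn_integral_mono) (auto split: split_indicator)
    also have "\<dots> = (\<integral>\<^sup>+\<omega>. f \<omega> * indicator G \<omega> \<partial>M) + of_nat m * emeasure M (space M - G)"
      by (subst nn_integral_add) (auto simp: nn_integral_cmult_indicator)
    also have "\<dots> \<le> ennreal (C + d) + of_nat m * ennreal d"
      using iG pG by (intro add_mono mult_left_mono) (auto simp: emeasure_eq_measure intro: ennreal_leI)
    also have "\<dots> = ennreal (C + d + real m * d)"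
      using C d by (simp add: ennreal_of_nat_eq_real_of_nat flip: ennreal_mult ennreal_plus)
    also have "C + d + real m * d = C + e"
    proof -
      have "d + real m * d = d * (1 + real m)" by (simp add: algebra_simps)
      also have "\<dots> = e" by (simp add: d_def)
      finally show ?thesis by simp
    qed
    finally show "(\<integral>\<^sup>+\<omega>. min (f \<omega>) (of_nat m) \<partial>M) \<le> ennreal C + ennreal e"
      using C e by (simp add: ennreal_plus)
  qed
  have "(\<integral>\<^sup>+\<omega>. f \<omega> \<partial>M) = (\<integral>\<^sup>+\<omega>. (SUP m::nat. min (f \<omega>) (of_nat m)) \<partial>M)"
  proof (rule nn_integral_cong)
    fix \<omega> assume w: "\<omega> \<in> space M"
    from f0[OF w] obtain r where r: "f \<omega> = ennreal r" "0 \<le> r" by (cases "f \<omega>") auto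
    obtain m :: nat where m: "r \<le> real m" using real_arch_simple by auto
    show "f \<omega> = (SUP m::nat. min (f \<omega>) (of_nat m))"
    proof (rule antisym)
      have "f \<omega> = min (f \<omega>) (of_nat m)"
        using m r by (simp add: min_def ennreal_of_nat_eq_real_of_nat ennreal_leI)
      also have "\<dots> \<le> (SUP m::nat. min (f \<omega>) (of_nat m))" by (rule SUP_upper) auto
      finally show "f \<omega> \<le> (SUP m::nat. min (f \<omega>) (of_nat m))" .
      show "(SUP m::nat. min (f \<omega>) (of_nat m)) \<le> f \<omega>" by (rule SUP_least) auto
    qed
  qed
  also have "\<dots> = (SUP m::nat. (\<integral>\<^sup>+\<omega>. min (f \<omega>) (of_nat m) \<partial>M))"
  proof (rule nn_integral_monotone_convergence_SUP)
    show "incseq (\<lambda>(m::nat) \<omega>. min (f \<omega>) (of_nat m))"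
      by (intro incseq_SucI le_funI min.mono) (auto simp: ennreal_of_nat_eq_real_of_nat)
  qed auto
  also have "\<dots> \<le> ennreal C" by (rule SUP_least) (rule bd)
  finally show ?thesis .
qed

end

locale brownian = filtered_prob_space M F
  for M :: "'a measure" and F +
  fixes W :: "real \<Rightarrow> 'a \<Rightarrow> real"
  assumes bm: "brownian_motion M F W"
begin

lemma W_F: "0 \<le> t \<Longrightarrow> W t \<in> borel_measurable (F t)"
  using bm by (auto simp: brownian_motion_def adapted_def)

lemma W_F_le: "0 \<le> s \<Longrightarrow> s \<le> t \<Longrightarrow> W s \<in> borel_measurable (F t)"
  using W_F measurable_F_mono by blast

lemma W_M: "0 \<le> t \<Longrightarrow> W t \<in> borel_measurable M"
  using W_F measurable_F_M by blast

lemma increment_distributed: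
  "0 \<le> s \<Longrightarrow> s < t \<Longrightarrow> distributed M lborel (\<lambda>\<omega>. W t \<omega> - W s \<omega>) (normal_density 0 (sqrt (t - s)))"
  using bm by (auto simp: brownian_motion_def)

lemma increment_indep_var:
  assumes st: "0 \<le> s" "s < t" and U: "U \<in> borel_measurable (F s)"
  shows "indep_var borel U borel (\<lambda>\<omega>. W t \<omega> - W s \<omega>)"
proof -
  let ?D = "\<lambda>\<omega>. W t \<omega> - W s \<omega>"
  have I: "indep_set (sets (F s)) (sets (vimage_algebra (space M) ?D borel))"
    using bm st by (auto simp: brownian_motion_def)
  have sp: "space (F s) = space M" using st by (simp add: space_F)
  have U': "random_variable borel U" using U st measurable_F_M by blast
  have D': "random_variable borel ?D" using W_M[of s] W_M[of t] st by simp
  have "sigma_sets (space M) {U -` A \<inter> space M |A. A \<in> sets borel} \<subseteq> sets (F s)"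
    using U sp by (intro sets.sigma_sets_subset[of _ "F s", unfolded sp])
      (auto dest: measurable_sets)
  moreover have "sigma_sets (space M) {?D -` A \<inter> space M |A. A \<in> sets borel} = sets (vimage_algebra (space M) ?D borel)"
    by (simp add: sets_vimage_algebra)
  ultimately show ?thesis
    unfolding indep_var_eq using I U' D'
    unfolding indep_sets2_eq by blast
qed

text \<open>The fourth moment is for the variance of the sum of squared increments in
  \<open>brownian_square_sum\<close>.\<close>

lemma
  assumes st: "0 \<le> s" "s < t"
  shows increment_integrable: "integrable M (\<lambda>\<omega>. W t \<omega> - W s \<omega>)"
    and increment_expectation: "expectation (\<lambda>\<omega>. W t \<omega> - W s \<omega>) = 0"
    and increment_square_integrable: "integrable M (\<lambda>\<omega>. (W t \<omega> - W s \<omega>)\<^sup>2)"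
    and increment_square_expectation: "expectation (\<lambda>\<omega>. (W t \<omega> - W s \<omega>)\<^sup>2) = t - s"
    and increment_fourth_integrable: "integrable M (\<lambda>\<omega>. (W t \<omega> - W s \<omega>)^4)"
    and increment_fourth_expectation: "expectation (\<lambda>\<omega>. (W t \<omega> - W s \<omega>)^4) = 3 * (t - s)\<^sup>2"
proof -
  note D = increment_distributed[OF st]
  have pos: "0 < sqrt (t - s)" using st by simp
  have I: "integrable M (\<lambda>\<omega>. (W t \<omega> - W s \<omega>)^k)" for k
    using distributed_integrable[OF D, of "\<lambda>x. x^k"] integrable_normal_moment[OF pos, of 0 k] by simp
  have E: "expectation (\<lambda>\<omega>. (W t \<omega> - W s \<omega>)^k) = (\<integral>x. normal_density 0 (sqrt (t - s)) x * (x - 0)^k \<partial>lborel)" for k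
    using distributed_integral[OF D, of "\<lambda>x. x^k"] by simp
  show "integrable M (\<lambda>\<omega>. W t \<omega> - W s \<omega>)" using I[of 1] by simp
  show "integrable M (\<lambda>\<omega>. (W t \<omega> - W s \<omega>)\<^sup>2)" using I[of 2] by simp
  show "integrable M (\<lambda>\<omega>. (W t \<omega> - W s \<omega>)^4)" using I[of 4] by simp
  show "expectation (\<lambda>\<omega>. W t \<omega> - W s \<omega>) = 0"
    using E[of 1] integral_normal_moment_odd[OF pos, of 0 0] by simp
  show "expectation (\<lambda>\<omega>. (W t \<omega> - W s \<omega>)\<^sup>2) = t - s"
    using E[of 2] integral_normal_moment_even[OF pos, of 0 1] st by simp
  show "expectation (\<lambda>\<omega>. (W t \<omega> - W s \<omega>)^4) = 3 * (t - s)\<^sup>2"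
    using E[of 4] integral_normal_moment_even[OF pos, of 0 2] st
    by (simp add: fact_numeral power2_eq_square field_simps)
qed

text \<open>A factor known at \<open>s\<close> is independent of the increment, so the expectations
  factorise. This takes the place of conditioning on \<open>F s\<close>.\<close>

lemma
  assumes st: "0 \<le> s" "s \<le> t" and U: "U \<in> borel_measurable (F s)" "integrable M U"
  shows increment_mult_integrable: "integrable M (\<lambda>\<omega>. U \<omega> * (W t \<omega> - W s \<omega>))"
    and increment_mult_expectation: "expectation (\<lambda>\<omega>. U \<omega> * (W t \<omega> - W s \<omega>)) = 0"
    and increment_square_mult_integrable: "integrable M (\<lambda>\<omega>. U \<omega> * (W t \<omega> - W s \<omega>)\<^sup>2)"
    and increment_square_mult_expectation:
      "expectation (\<lambda>\<omega>. U \<omega> * (W t \<omega> - W s \<omega>)\<^sup>2) = (t - s) * expectation U"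
proof -
  have "integrable M (\<lambda>\<omega>. U \<omega> * (W t \<omega> - W s \<omega>)) \<and> expectation (\<lambda>\<omega>. U \<omega> * (W t \<omega> - W s \<omega>)) = 0
     \<and> integrable M (\<lambda>\<omega>. U \<omega> * (W t \<omega> - W s \<omega>)\<^sup>2)
     \<and> expectation (\<lambda>\<omega>. U \<omega> * (W t \<omega> - W s \<omega>)\<^sup>2) = (t - s) * expectation U"
  proof (cases "s = t")
    case False
    then have st': "0 \<le> s" "s < t" using st by auto
    note I = increment_indep_var[OF st' U(1)]
    have I2: "indep_var borel U borel (\<lambda>\<omega>. (W t \<omega> - W s \<omega>)\<^sup>2)"
      using indep_var_compose[OF I, of "\<lambda>x. x" borel "\<lambda>x. x\<^sup>2" borel] by (simp add: comp_def)
    show ?thesis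
      using indep_var_integrable[OF I U(2) increment_integrable[OF st']]
        indep_var_lebesgue_integral[OF I U(2) increment_integrable[OF st']]
        indep_var_integrable[OF I2 U(2) increment_square_integrable[OF st']]
        indep_var_lebesgue_integral[OF I2 U(2) increment_square_integrable[OF st']]
      by (simp add: increment_expectation[OF st'] increment_square_expectation[OF st'])
  qed simp
  then show "integrable M (\<lambda>\<omega>. U \<omega> * (W t \<omega> - W s \<omega>))"
    "expectation (\<lambda>\<omega>. U \<omega> * (W t \<omega> - W s \<omega>)) = 0"
    "integrable M (\<lambda>\<omega>. U \<omega> * (W t \<omega> - W s \<omega>)\<^sup>2)"
    "expectation (\<lambda>\<omega>. U \<omega> * (W t \<omega> - W s \<omega>)\<^sup>2) = (t - s) * expectation U" by auto
qed

section \<open>Finite sums over Brownian increments: isometry and maximal inequality\<close>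

definition step_sum :: "(nat \<Rightarrow> real) \<Rightarrow> (nat \<Rightarrow> 'a \<Rightarrow> real) \<Rightarrow> nat \<Rightarrow> 'a \<Rightarrow> real" where
  "step_sum p \<eta> L \<omega> = (\<Sum>l<L. \<eta> l \<omega> * (W (p (Suc l)) \<omega> - W (p l) \<omega>))"

lemma step_sum_0 [simp]: "step_sum p \<eta> 0 \<omega> = 0"
  by (simp add: step_sum_def)

lemma step_sum_Suc: "step_sum p \<eta> (Suc L) \<omega> = step_sum p \<eta> L \<omega> + \<eta> L \<omega> * (W (p (Suc L)) \<omega> - W (p L) \<omega>)"
  by (simp add: step_sum_def)

lemma step_sum_measurable:
  assumes p: "0 \<le> p 0" "\<And>l. l < L \<Longrightarrow> p l \<le> p (Suc l)"
    and \<eta>: "\<And>l. l < L \<Longrightarrow> \<eta> l \<in> borel_measurable (F (p l))" and m: "m \<le> L"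
  shows "step_sum p \<eta> m \<in> borel_measurable (F (p m))"
proof -
  have pos: "0 \<le> p i" if "i \<le> L" for i using grid_mono[of L p 0 i] p that by force
  have "(\<lambda>\<omega>. \<eta> l \<omega> * (W (p (Suc l)) \<omega> - W (p l) \<omega>)) \<in> borel_measurable (F (p m))" if "l < m" for l
  proof -
    have "p l \<le> p m" "p (Suc l) \<le> p m" using grid_mono[of L p l m] grid_mono[of L p "Suc l" m] p that m by auto
    moreover have "0 \<le> p l" "0 \<le> p (Suc l)" using pos that m by auto
    moreover have "\<eta> l \<in> borel_measurable (F (p l))" using \<eta> that m by auto
    ultimately show ?thesis
      by (intro borel_measurable_times borel_measurable_diff W_F_le) (auto intro: measurable_F_mono)
  qed
  then show ?thesis unfolding step_sum_def by (intro borel_measurable_sum) auto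
qed

text \<open>Induction on the last cell: the earlier sum times \<open>\<eta> L\<close> is known at
  \<open>p L\<close>, so the mixed term has mean zero, and the new square contributes the cell
  length times the second moment of \<open>\<eta> L\<close>.\<close>

lemma step_sum_isometry:
  assumes p: "0 \<le> p 0" "\<And>l. l < L \<Longrightarrow> p l \<le> p (Suc l)"
    and \<eta>: "\<And>l. l < L \<Longrightarrow> \<eta> l \<in> borel_measurable (F (p l))"
    and B: "\<And>l. l < L \<Longrightarrow> \<exists>B. \<forall>\<omega>\<in>space M. \<bar>\<eta> l \<omega>\<bar> \<le> B"
  shows "integrable M (step_sum p \<eta> L) \<and> expectation (step_sum p \<eta> L) = 0 \<and>
    integrable M (\<lambda>\<omega>. (step_sum p \<eta> L \<omega>)\<^sup>2) \<and>
    expectation (\<lambda>\<omega>. (step_sum p \<eta> L \<omega>)\<^sup>2) = (\<Sum>l<L. (p (Suc l) - p l) * expectation (\<lambda>\<omega>. (\<eta> l \<omega>)\<^sup>2))"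
  using p(2) \<eta> B
proof (induction L)
  case (Suc L)
  have pos: "0 \<le> p L" using grid_mono[of L p 0 L] p(1) Suc.prems(1) by force
  have le: "p L \<le> p (Suc L)" using Suc.prems(1) by auto
  have IH: "integrable M (step_sum p \<eta> L)" "expectation (step_sum p \<eta> L) = 0"
    "integrable M (\<lambda>\<omega>. (step_sum p \<eta> L \<omega>)\<^sup>2)"
    "expectation (\<lambda>\<omega>. (step_sum p \<eta> L \<omega>)\<^sup>2) = (\<Sum>l<L. (p (Suc l) - p l) * expectation (\<lambda>\<omega>. (\<eta> l \<omega>)\<^sup>2))"
    using Suc.IH Suc.prems by (auto simp: less_Suc_eq)
  have Y: "step_sum p \<eta> L \<in> borel_measurable (F (p L))"
    by (rule step_sum_measurable[of p L]) (use p Suc.prems in auto)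
  have e: "\<eta> L \<in> borel_measurable (F (p L))" using Suc.prems by auto
  have eM[measurable]: "\<eta> L \<in> borel_measurable M" using e pos measurable_F_M by blast
  obtain B where B: "\<And>\<omega>. \<omega> \<in> space M \<Longrightarrow> \<bar>\<eta> L \<omega>\<bar> \<le> B" using Suc.prems(3)[of L] by auto
  have ei: "integrable M (\<eta> L)" using B by (intro integrable_const_bound[of _ B]) auto
  have e2i: "integrable M (\<lambda>\<omega>. (\<eta> L \<omega>)\<^sup>2)"
    using B by (intro integrable_const_bound[of _ "B\<^sup>2"] AE_I2) (auto intro: abs_le_imp_square_le)
  \<comment> \<open>The bound \<open>B\<close> on the last coefficient makes the mixed term
    integrable, as it is dominated by a multiple of the earlier sum.\<close>
  have Yei: "integrable M (\<lambda>\<omega>. 2 * step_sum p \<eta> L \<omega> * \<eta> L \<omega>)"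
  proof (rule Bochner_Integration.integrable_bound[OF integrable_mult_right[OF IH(1), of "2*B"]])
    show "AE \<omega> in M. norm (2 * step_sum p \<eta> L \<omega> * \<eta> L \<omega>) \<le> norm (2 * B * step_sum p \<eta> L \<omega>)"
    proof (rule AE_I2)
      fix \<omega> assume "\<omega> \<in> space M"
      then have "\<bar>\<eta> L \<omega>\<bar> \<le> \<bar>B\<bar>" using B by force
      then have "\<bar>step_sum p \<eta> L \<omega>\<bar> * \<bar>\<eta> L \<omega>\<bar> \<le> \<bar>step_sum p \<eta> L \<omega>\<bar> * \<bar>B\<bar>" by (intro mult_left_mono) auto
      then show "norm (2 * step_sum p \<eta> L \<omega> * \<eta> L \<omega>) \<le> norm (2 * B * step_sum p \<eta> L \<omega>)"
        by (simp add: abs_mult mult.commute)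
    qed
  qed (use IH(1) in \<open>auto simp: integrable_iff_bounded\<close>)
  let ?D = "\<lambda>\<omega>. W (p (Suc L)) \<omega> - W (p L) \<omega>"
  note m1 = increment_mult_integrable[OF pos le e ei] increment_mult_expectation[OF pos le e ei]
  note m2 = increment_square_mult_integrable[OF pos le _ e2i] increment_square_mult_expectation[OF pos le _ e2i]
  note m3 = increment_mult_integrable[OF pos le _ Yei] increment_mult_expectation[OF pos le _ Yei]
  have sq: "(step_sum p \<eta> (Suc L) \<omega>)\<^sup>2 = (step_sum p \<eta> L \<omega>)\<^sup>2 + 2 * step_sum p \<eta> L \<omega> * \<eta> L \<omega> * ?D \<omega> + (\<eta> L \<omega>)\<^sup>2 * (?D \<omega>)\<^sup>2" for \<omega>
    by (simp add: step_sum_Suc power2_eq_square algebra_simps)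
  have "(\<lambda>\<omega>. (\<eta> L \<omega>)\<^sup>2) \<in> borel_measurable (F (p L))" "(\<lambda>\<omega>. 2 * step_sum p \<eta> L \<omega> * \<eta> L \<omega>) \<in> borel_measurable (F (p L))"
    using e Y by measurable
  note m = m1 m2[OF this(1)] m3[OF this(2)]
  have "step_sum p \<eta> (Suc L) = (\<lambda>\<omega>. step_sum p \<eta> L \<omega> + \<eta> L \<omega> * ?D \<omega>)"
    by (auto simp: step_sum_Suc)
  moreover have "integrable M (\<lambda>\<omega>. step_sum p \<eta> L \<omega> + \<eta> L \<omega> * ?D \<omega>)"
    using IH(1) m(1) by (rule Bochner_Integration.integrable_add)
  moreover have "expectation (\<lambda>\<omega>. step_sum p \<eta> L \<omega> + \<eta> L \<omega> * ?D \<omega>) = 0"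
    using IH(2) m(2) by (subst Bochner_Integration.integral_add[OF IH(1) m(1)]) auto
  moreover have "integrable M (\<lambda>\<omega>. (step_sum p \<eta> (Suc L) \<omega>)\<^sup>2)"
    unfolding sq by (intro Bochner_Integration.integrable_add IH m)
  moreover have "expectation (\<lambda>\<omega>. (step_sum p \<eta> (Suc L) \<omega>)\<^sup>2) = (\<Sum>l<Suc L. (p (Suc l) - p l) * expectation (\<lambda>\<omega>. (\<eta> l \<omega>)\<^sup>2))"
    unfolding sq
    by (subst Bochner_Integration.integral_add[OF Bochner_Integration.integrable_add[OF IH(3) m(5)] m(3)],
        subst Bochner_Integration.integral_add[OF IH(3) m(5)], unfold IH(4) m(4) m(6)) simp
  ultimately show ?case by (simp only: simp_thms)
next
  case 0
  have "step_sum p \<eta> 0 = (\<lambda>_. 0)" by (simp add: fun_eq_iff)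
  then show ?case by simp
qed

text \<open>Stopping the coefficients at the first large partial sum reduces the maximal inequality to
  Chebyshev's.\<close>

lemma step_sum_lenglart:
  assumes p: "0 \<le> p 0" "\<And>l. l < L \<Longrightarrow> p l < p (Suc l)"
    and v: "\<And>l. l < L \<Longrightarrow> v l \<in> borel_measurable (F (p l))" and \<epsilon>: "0 < \<epsilon>" and \<delta>: "0 \<le> \<delta>"
  shows "prob {\<omega>\<in>space M. (\<exists>m\<le>L. \<bar>step_sum p v m \<omega>\<bar> > \<epsilon>) \<and> (\<Sum>l<L. (v l \<omega>)\<^sup>2 * (p (Suc l) - p l)) \<le> \<delta>} \<le> \<delta> / \<epsilon>\<^sup>2"
    (is "prob ?E \<le> _")
proof -
  have p': "l < L \<Longrightarrow> p l \<le> p (Suc l)" for l using p(2)[of l] by simp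
  have pos: "0 \<le> p i" if "i \<le> L" for i using grid_mono[of L p 0 i] p(1) p' that by force
  have mono: "p i \<le> p j" if "i \<le> j" "j \<le> L" for i j using grid_mono[of L p i j] p' that by auto
  define a where "a l \<omega> = (if l < L then (v l \<omega>)\<^sup>2 * (p (Suc l) - p l) else 0)" for l \<omega>
  have a0: "0 \<le> a l \<omega>" for l \<omega> using p'[of l] by (simp add: a_def)
  \<comment> \<open>The cap includes the current term \<open>a l\<close>, which is already known at
    \<open>p l\<close>. It bounds the stopped coefficients, so that the isometry applies although
    \<open>v\<close> itself may be unbounded.\<close>
  define K where "K l \<omega> \<longleftrightarrow> (\<forall>m\<le>l. \<bar>step_sum p v m \<omega>\<bar> \<le> \<epsilon>) \<and> (\<Sum>j\<le>l. a j \<omega>) \<le> \<delta>" for l \<omega>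
  define \<eta> where "\<eta> l \<omega> = (if K l \<omega> then v l \<omega> else 0)" for l \<omega>
  have vm: "v j \<in> borel_measurable (F (p l))" if "j \<le> l" "l < L" for j l
    by (rule measurable_F_mono[OF pos mono v]) (use that in auto)
  have sm: "step_sum p v m \<in> borel_measurable (F (p l))" if "m \<le> l" "l \<le> L" for m l
    by (rule measurable_F_mono[OF pos mono step_sum_measurable[of p L]]) (use that p(1) p' v in auto)
  have \<eta>m: "\<eta> l \<in> borel_measurable (F (p l))" if l: "l < L" for l
  proof -
    have [measurable]: "v l \<in> borel_measurable (F (p l))" using v l by simp
    have "a j \<in> borel_measurable (F (p l))" if "j \<le> l" for j
    proof -
      have [measurable]: "v j \<in> borel_measurable (F (p l))" using vm that l by simp
      show ?thesis unfolding a_def by measurable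
    qed
    then have "(\<lambda>\<omega>. \<Sum>j\<le>l. a j \<omega>) \<in> borel_measurable (F (p l))" by (intro borel_measurable_sum) auto
    then have A: "Measurable.pred (F (p l)) (\<lambda>\<omega>. (\<Sum>j\<le>l. a j \<omega>) \<le> \<delta>)" by measurable
    have "Measurable.pred (F (p l)) (\<lambda>\<omega>. \<forall>m\<in>{..l}. \<bar>step_sum p v m \<omega>\<bar> \<le> \<epsilon>)"
    proof (rule pred_intros_finite)
      fix m assume "m \<in> {..l}"
      then have [measurable]: "step_sum p v m \<in> borel_measurable (F (p l))" using sm l by simp
      show "Measurable.pred (F (p l)) (\<lambda>\<omega>. \<bar>step_sum p v m \<omega>\<bar> \<le> \<epsilon>)" by measurable
    qed simp
    then have "Measurable.pred (F (p l)) (\<lambda>\<omega>. \<forall>m\<le>l. \<bar>step_sum p v m \<omega>\<bar> \<le> \<epsilon>)"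
      by (simp only: Ball_def atMost_iff)
    then have "Measurable.pred (F (p l)) (K l)"
      unfolding K_def using A by (rule pred_intros_logic)
    then show ?thesis unfolding \<eta>_def by measurable
  qed
  have \<eta>b: "\<exists>B. \<forall>\<omega>\<in>space M. \<bar>\<eta> l \<omega>\<bar> \<le> B" if l: "l < L" for l
  proof (intro exI ballI)
    fix \<omega>
    have d: "0 < p (Suc l) - p l" using p(2)[OF l] by simp
    \<comment> \<open>A single term within the cap already bounds the coefficient. This divides by
      the cell length, hence the strictly increasing grid.\<close>
    show "\<bar>\<eta> l \<omega>\<bar> \<le> sqrt (\<delta> / (p (Suc l) - p l))"
    proof (cases "K l \<omega>")
      case True
      have "(v l \<omega>)\<^sup>2 * (p (Suc l) - p l) = a l \<omega>" using l by (simp add: a_def)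
      also have "\<dots> \<le> (\<Sum>j\<le>l. a j \<omega>)" using a0 by (intro member_le_sum) auto
      also have "\<dots> \<le> \<delta>" using True by (simp add: K_def)
      finally have "(v l \<omega>)\<^sup>2 \<le> \<delta> / (p (Suc l) - p l)" using d by (simp add: field_simps)
      then show ?thesis using True by (auto simp: \<eta>_def intro: real_le_rsqrt)
    qed (use d \<delta> in \<open>auto simp: \<eta>_def\<close>)
  qed
  note iso = step_sum_isometry[of p L \<eta>, OF p(1) p' \<eta>m \<eta>b]
  have \<eta>2: "integrable M (\<lambda>\<omega>. (\<eta> l \<omega>)\<^sup>2)" if l: "l < L" for l
    proof -
      obtain B where B: "\<And>\<omega>. \<omega>\<in>space M \<Longrightarrow> \<bar>\<eta> l \<omega>\<bar> \<le> B" using \<eta>b[OF l] by auto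
      have [measurable]: "\<eta> l \<in> borel_measurable M" using \<eta>m[OF l] pos[of l] l measurable_F_M by auto
      show ?thesis using B by (intro integrable_const_bound[of _ "B\<^sup>2"] AE_I2) (auto intro: abs_le_imp_square_le)
    qed
  have "expectation (\<lambda>\<omega>. (step_sum p \<eta> L \<omega>)\<^sup>2) = expectation (\<lambda>\<omega>. \<Sum>l<L. (p (Suc l) - p l) * (\<eta> l \<omega>)\<^sup>2)"
    using iso \<eta>2 by (subst Bochner_Integration.integral_sum) auto
  also have "\<dots> \<le> \<delta>"
  proof (rule integral_le_const[OF _ AE_I2])
    show "integrable M (\<lambda>\<omega>. \<Sum>l<L. (p (Suc l) - p l) * (\<eta> l \<omega>)\<^sup>2)"
      using \<eta>2 by (intro Bochner_Integration.integrable_sum) auto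
    fix \<omega>
    have "(\<Sum>l<L. (p (Suc l) - p l) * (\<eta> l \<omega>)\<^sup>2) \<le> (\<Sum>l<L. if (\<Sum>j\<le>l. a j \<omega>) \<le> \<delta> then a l \<omega> else 0)"
      using p' by (intro sum_mono) (auto simp: \<eta>_def K_def a_def)
    also have "\<dots> \<le> \<delta>" by (rule capped_partial_sums) (use a0 \<delta> in auto)
    finally show "(\<Sum>l<L. (p (Suc l) - p l) * (\<eta> l \<omega>)\<^sup>2) \<le> \<delta>" .
  qed
  finally have E2: "expectation (\<lambda>\<omega>. (step_sum p \<eta> L \<omega>)\<^sup>2) \<le> \<delta>" .
  have [measurable]: "step_sum p \<eta> L \<in> borel_measurable M" using iso by auto
  have "?E \<subseteq> {\<omega>\<in>space M. \<epsilon>\<^sup>2 \<le> (step_sum p \<eta> L \<omega>)\<^sup>2}"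
  proof safe
    fix \<omega> m assume w: "\<omega> \<in> space M" and m: "m \<le> L" "\<epsilon> < \<bar>step_sum p v m \<omega>\<bar>"
      and le: "(\<Sum>l<L. (v l \<omega>)\<^sup>2 * (p (Suc l) - p l)) \<le> \<delta>"
    define m0 where "m0 = (LEAST m. \<epsilon> < \<bar>step_sum p v m \<omega>\<bar>)"
    have m0: "\<epsilon> < \<bar>step_sum p v m0 \<omega>\<bar>" "m0 \<le> L" and min: "\<And>l. l < m0 \<Longrightarrow> \<bar>step_sum p v l \<omega>\<bar> \<le> \<epsilon>"
      unfolding m0_def using m LeastI[of "\<lambda>m. \<epsilon> < \<bar>step_sum p v m \<omega>\<bar>" m] Least_le[of "\<lambda>m. \<epsilon> < \<bar>step_sum p v m \<omega>\<bar>" m]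
      by (auto dest: not_less_Least)
    have cap: "(\<Sum>j\<le>l. a j \<omega>) \<le> \<delta>" if "l < L" for l
    proof -
      have "(\<Sum>j\<le>l. a j \<omega>) \<le> (\<Sum>j<L. a j \<omega>)" using a0 that by (intro sum_mono2) auto
      also have "\<dots> \<le> \<delta>" using le by (simp add: a_def)
      finally show ?thesis .
    qed
    \<comment> \<open>Under the assumed total bound the cap is never active, so the coefficients are
      cut exactly from the first exceedance \<open>m0\<close> on, and the stopped sum over the whole
      grid is the sum at \<open>m0\<close>.\<close>
    have "\<eta> l \<omega> = (if l < m0 then v l \<omega> else 0)" if "l < L" for l
      using min cap[OF that] m0(1) by (auto simp: \<eta>_def K_def not_less not_le)
    then have "step_sum p \<eta> L \<omega> = (\<Sum>l<L. if l < m0 then v l \<omega> * (W (p (Suc l)) \<omega> - W (p l) \<omega>) else 0)"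
      unfolding step_sum_def by (intro sum.cong) auto
    also have "\<dots> = step_sum p v m0 \<omega>"
      unfolding step_sum_def using m0(2) by (intro sum.mono_neutral_cong_right) auto
    finally show "\<epsilon>\<^sup>2 \<le> (step_sum p \<eta> L \<omega>)\<^sup>2"
      using m0(1) \<epsilon> by (simp add: abs_le_square_iff[symmetric])
  qed
  then have "prob ?E \<le> prob {\<omega>\<in>space M. \<epsilon>\<^sup>2 \<le> (step_sum p \<eta> L \<omega>)\<^sup>2}"
    by (intro finite_measure_mono) auto
  also have "\<dots> \<le> expectation (\<lambda>\<omega>. (step_sum p \<eta> L \<omega>)\<^sup>2) / \<epsilon>\<^sup>2"
    using iso \<epsilon> by (intro integral_Markov_inequality_measure[of _ _ "{}"]) auto
  also have "\<dots> \<le> \<delta> / \<epsilon>\<^sup>2" using E2 by (intro divide_right_mono) auto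
  finally show ?thesis .
qed

end

section \<open>Grids\<close>

definition ugrid :: "real \<Rightarrow> real \<Rightarrow> nat \<Rightarrow> nat \<Rightarrow> real" where
  "ugrid s t n k = s + real k * (t - s) / real n"

lemma ugrid_0 [simp]: "ugrid s t n 0 = s"
  by (simp add: ugrid_def)

lemma ugrid_end [simp]: "0 < n \<Longrightarrow> ugrid s t n n = t"
  by (simp add: ugrid_def)

lemma ugrid_Suc_diff: "ugrid s t n (Suc k) - ugrid s t n k = (t - s) / real n"
  by (simp add: ugrid_def field_simps add_divide_distrib diff_divide_distrib)

lemma ugrid_mono: "s \<le> t \<Longrightarrow> i \<le> j \<Longrightarrow> ugrid s t n i \<le> ugrid s t n j"
  by (auto simp: ugrid_def intro!: divide_right_mono mult_right_mono)

lemma ugrid_le: "s \<le> t \<Longrightarrow> i \<le> n \<Longrightarrow> ugrid s t n i \<le> t"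
  using ugrid_mono[of s t i n n] by (cases "n = 0") auto

lemma ugrid_ge: "s \<le> t \<Longrightarrow> s \<le> ugrid s t n i"
  using ugrid_mono[of s t 0 i n] by simp

lemma ugrid_Suc_le: "s \<le> t \<Longrightarrow> ugrid s t n k \<le> ugrid s t n (Suc k)"
  by (rule ugrid_mono) auto

text \<open>The factor \<open>2\<close> is slack. It matches the window used with
  \<open>osc_event\<close>, whose bound is strict and must also cover neighbouring grid points,
  whose distance equals the mesh.\<close>

lemma ugrid_floor:
  assumes "s < t" "0 < n" "s \<le> u" "u \<le> t"
  shows "\<exists>k\<le>n. ugrid s t n k \<le> u \<and> u - ugrid s t n k < 2 * (t - s) / real n"
proof -
  define k where "k = nat \<lfloor>(u - s) * n / (t - s)\<rfloor>"
  have nn: "0 \<le> (u - s) * n / (t - s)" using assms by simp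
  have k1: "real k \<le> (u - s) * n / (t - s)" and k2: "(u - s) * n / (t - s) < real k + 1"
    unfolding k_def using nn by linarith+
  have "(u - s) * n / (t - s) \<le> n" using assms by (simp add: field_simps mult_mono)
  then have "k \<le> n" using k1 by linarith
  moreover have "real k * (t - s) / n \<le> u - s" using k1 assms by (simp add: field_simps)
  moreover have "u - s < (real k + 1) * (t - s) / n" using k2 assms by (simp add: field_simps)
  then have "u - s - real k * (t - s) / n < (t - s) / n" by (simp add: add_divide_distrib distrib_right)
  moreover have "(t - s) / n \<le> 2 * (t - s) / n" using assms by (intro divide_right_mono) auto
  ultimately show ?thesis unfolding ugrid_def by (intro exI[of _ k]) auto
qed

text \<open>Sorting a set removes repetitions, which gives the strict increase that
  \<open>step_sum_lenglart\<close> needs; the grid of a simple process may repeat points and may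
  leave \<open>[s, T]\<close>.\<close>

lemma merged_grid:
  assumes A: "finite A" and sT: "(s::real) < T"
  shows "\<exists>L p. p 0 = s \<and> p L = T \<and> (\<forall>l<L. p l < p (Suc l)) \<and>
    (\<forall>c\<in>A. \<forall>l<L. \<not> (p l < c \<and> c < p (Suc l))) \<and> (\<forall>c\<in>A. s \<le> c \<and> c \<le> T \<longrightarrow> (\<exists>m\<le>L. p m = c))"
proof -
  define B where "B = (A \<inter> {s..T}) \<union> {s, T}"
  define xs where "xs = sorted_list_of_set B"
  define L where "L = length xs - 1"
  have B: "finite B" "s \<in> B" "T \<in> B" "B \<subseteq> {s..T}" using A sT by (auto simp: B_def)
  have set: "set xs = B" and st: "sorted_wrt (<) xs" unfolding xs_def using B by auto
  have ne: "xs \<noteq> []" using set B by auto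
  have len: "length xs = Suc L" using ne by (cases xs) (auto simp: L_def)
  have lt: "xs ! i < xs ! j" if "i < j" "j \<le> L" for i j
    using st that len by (simp add: sorted_wrt_iff_nth_less)
  have le: "xs ! i \<le> xs ! j" if "i \<le> j" "j \<le> L" for i j
    using lt[of i j] that by (cases "i = j") auto
  have mem: "xs ! i \<in> B" if "i \<le> L" for i using set len that nth_mem[of i xs] by auto
  have ex: "\<exists>m\<le>L. xs ! m = c" if "c \<in> B" for c
    using that set len by (metis in_set_conv_nth less_Suc_eq_le)
  have "xs ! 0 = s"
  proof -
    obtain m where "m \<le> L" "xs ! m = s" using ex B by blast
    then have "xs ! 0 \<le> s" using le[of 0 m] by auto
    moreover have "s \<le> xs ! 0" using mem[of 0] B by auto
    ultimately show ?thesis by simp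
  qed
  moreover have "xs ! L = T"
  proof -
    obtain m where "m \<le> L" "xs ! m = T" using ex B by blast
    then have "T \<le> xs ! L" using le[of m L] by auto
    moreover have "xs ! L \<le> T" using mem[of L] B by auto
    ultimately show ?thesis by simp
  qed
  moreover have "\<forall>l<L. xs ! l < xs ! Suc l" using lt by auto
  moreover have "\<not> (xs ! l < c \<and> c < xs ! Suc l)" if "c \<in> A" "l < L" for c l
  proof
    assume c: "xs ! l < c \<and> c < xs ! Suc l"
    have "xs ! l \<in> {s..T}" "xs ! Suc l \<in> {s..T}" using mem[of l] mem[of "Suc l"] B that by auto
    then have "c \<in> B" using c that by (auto simp: B_def)
    then obtain m where m: "m \<le> L" "xs ! m = c" using ex by blast
    then show False using c le[of m l] le[of "Suc l" m] that by (cases "m \<le> l") auto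
  qed
  moreover have "\<exists>m\<le>L. xs ! m = c" if "c \<in> A" "s \<le> c" "c \<le> T" for c
    using ex[of c] that by (auto simp: B_def)
  ultimately show ?thesis by (intro exI[of _ L] exI[of _ "(!) xs"]) auto
qed

text \<open>No cell is split by \<open>a\<close> or \<open>b\<close>, so each contributes its whole
  increment or nothing, and its right endpoint decides which.\<close>

lemma grid_telescope:
  fixes w :: "real \<Rightarrow> real"
  assumes p: "\<And>l. l < L \<Longrightarrow> p l < p (Suc l)" and ab: "a \<le> b"
    and av: "\<And>l. l < L \<Longrightarrow> \<not> (p l < a \<and> a < p (Suc l))" "\<And>l. l < L \<Longrightarrow> \<not> (p l < b \<and> b < p (Suc l))"
    and m: "m \<le> L"
  shows "(w (min b (p m)) - w (min a (p m))) - (w (min b (p 0)) - w (min a (p 0))) =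
    (\<Sum>l<m. indicator {a<..b} (p (Suc l)) * (w (p (Suc l)) - w (p l)))"
  using m
proof (induction m)
  case (Suc m)
  then have m: "p m < p (Suc m)" "a \<le> p m \<or> p (Suc m) \<le> a" "b \<le> p m \<or> p (Suc m) \<le> b"
    using p[of m] av[of m] by auto
  have "(w (min b (p (Suc m))) - w (min a (p (Suc m)))) - (w (min b (p m)) - w (min a (p m))) =
    indicator {a<..b} (p (Suc m)) * (w (p (Suc m)) - w (p m))"
    using m ab by (auto simp: indicator_def min_def)
  then show ?case using Suc by simp
qed simp

lemma (in brownian) simple_integral_grid:
  assumes p: "\<And>l. l < L \<Longrightarrow> p l < p (Suc l)" and a: "\<And>i. i < k \<Longrightarrow> a i \<le> a (Suc i)"
    and av: "\<And>i l. i \<le> k \<Longrightarrow> l < L \<Longrightarrow> \<not> (p l < a i \<and> a i < p (Suc l))" and m: "m \<le> L"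
  shows "simple_integral k a \<xi> W (p m) \<omega> - simple_integral k a \<xi> W (p 0) \<omega> =
    step_sum p (\<lambda>l. simple_value k a \<xi> (p (Suc l))) m \<omega>"
proof -
  have "simple_integral k a \<xi> W (p m) \<omega> - simple_integral k a \<xi> W (p 0) \<omega> =
    (\<Sum>i<k. \<xi> i \<omega> * ((W (min (a (Suc i)) (p m)) \<omega> - W (min (a i) (p m)) \<omega>) - (W (min (a (Suc i)) (p 0)) \<omega> - W (min (a i) (p 0)) \<omega>)))"
    unfolding simple_integral_def sum_subtractf[symmetric] by (intro sum.cong) (auto simp: algebra_simps)
  also have "\<dots> = (\<Sum>i<k. \<xi> i \<omega> * (\<Sum>l<m. indicator {a i<..a (Suc i)} (p (Suc l)) * (W (p (Suc l)) \<omega> - W (p l) \<omega>)))"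
  proof (intro sum.cong refl arg_cong2[where f="(*)"])
    fix i assume "i \<in> {..<k}"
    then show "(W (min (a (Suc i)) (p m)) \<omega> - W (min (a i) (p m)) \<omega>) - (W (min (a (Suc i)) (p 0)) \<omega> - W (min (a i) (p 0)) \<omega>)
      = (\<Sum>l<m. indicator {a i<..a (Suc i)} (p (Suc l)) * (W (p (Suc l)) \<omega> - W (p l) \<omega>))"
      by (intro grid_telescope[of L p _ _ _ "\<lambda>t. W t \<omega>"] p a av m) auto
  qed
  also have "\<dots> = (\<Sum>l<m. \<Sum>i<k. \<xi> i \<omega> * (indicator {a i<..a (Suc i)} (p (Suc l)) * (W (p (Suc l)) \<omega> - W (p l) \<omega>)))"
    by (simp only: sum_distrib_left) (rule sum.swap)
  also have "\<dots> = step_sum p (\<lambda>l. simple_value k a \<xi> (p (Suc l))) m \<omega>"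
    unfolding step_sum_def simple_value_def sum_distrib_right by (intro sum.cong refl) (simp add: mult.assoc)
  finally show ?thesis .
qed

lemma simple_value_const:
  assumes "\<And>i. i \<le> k \<Longrightarrow> \<not> (q < a i \<and> a i < r)" "q < x" "x \<le> r"
  shows "simple_value k a \<xi> x \<omega> = simple_value k a \<xi> r \<omega>"
  unfolding simple_value_def
proof (intro sum.cong refl arg_cong2[where f="(*)"])
  fix i assume "i \<in> {..<k}"
  then have "\<not> (q < a i \<and> a i < r)" "\<not> (q < a (Suc i) \<and> a (Suc i) < r)" using assms(1)[of i] assms(1)[of "Suc i"] by auto
  then show "(indicator {a i<..a (Suc i)} x :: real) = indicator {a i<..a (Suc i)} r"
    using assms(2,3) by (auto simp: indicator_def)
qed

lemma simple_value_on:
  assumes a: "\<And>i. i < k \<Longrightarrow> a i \<le> a (Suc i)" and j: "j < k" "a j < x" "x \<le> a (Suc j)"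
  shows "simple_value k a \<xi> x \<omega> = \<xi> j \<omega>"
proof -
  have "\<xi> i \<omega> * indicator {a i<..a (Suc i)} x = (if i = j then \<xi> j \<omega> else 0)" if "i < k" for i
  proof (cases "i = j")
    case False
    have "a (Suc i) \<le> a j" if "i < j" using grid_mono[of k a "Suc i" j] a j that by auto
    moreover have "a (Suc j) \<le> a i" if "j < i" using grid_mono[of k a "Suc j" i] a \<open>i < k\<close> that by auto
    ultimately have "x \<notin> {a i<..a (Suc i)}" using j False by (cases "i < j") (auto simp: not_less)
    then show ?thesis using False by simp
  qed (use j in auto)
  then show ?thesis unfolding simple_value_def using j by (simp add: sum.delta')
qed

text \<open>A coefficient active at \<open>r\<close> has \<open>a i < r\<close>, hence
  \<open>a i \<le> q\<close>, since no \<open>a i\<close> lies strictly between. The value at the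
  right endpoint of a cell is therefore known at its left endpoint.\<close>

lemma (in filtered_prob_space) simple_value_measurable:
  assumes a: "0 \<le> a 0" "\<And>i. i < k \<Longrightarrow> a i \<le> a (Suc i)"
    and \<xi>: "\<And>i. i < k \<Longrightarrow> \<xi> i \<in> borel_measurable (F (a i))"
    and av: "\<And>i. i \<le> k \<Longrightarrow> \<not> (q < a i \<and> a i < r)" and qr: "0 \<le> q"
  shows "simple_value k a \<xi> r \<in> borel_measurable (F q)"
proof -
  have "(\<lambda>\<omega>. \<xi> i \<omega> * indicator {a i<..a (Suc i)} r) \<in> borel_measurable (F q)" if i: "i < k" for i
  proof (cases "r \<in> {a i<..a (Suc i)}")
    case True
    then have "a i \<le> q" using av[of i] i by auto
    moreover have "0 \<le> a i" using grid_mono[of k a 0 i] a i by force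
    ultimately have "\<xi> i \<in> borel_measurable (F q)" using \<xi>[OF i] measurable_F_mono by blast
    then show ?thesis by simp
  qed simp
  then show ?thesis unfolding simple_value_def by (intro borel_measurable_sum) auto
qed

section \<open>Modulus of continuity\<close>

locale continuous_adapted = filtered_prob_space M F
  for M :: "'a measure" and F +
  fixes X :: "real \<Rightarrow> 'a \<Rightarrow> real"
  assumes X_F: "0 \<le> t \<Longrightarrow> X t \<in> borel_measurable (F t)"
    and X_cont: "\<omega> \<in> space M \<Longrightarrow> continuous_on {0..} (\<lambda>t. X t \<omega>)"
begin

lemma X_F_le: "0 \<le> s \<Longrightarrow> s \<le> t \<Longrightarrow> X s \<in> borel_measurable (F t)"
  using X_F measurable_F_mono by blast

lemma X_M: "0 \<le> t \<Longrightarrow> X t \<in> borel_measurable M"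
  using X_F measurable_F_M by blast

definition clamped :: "real \<Rightarrow> real \<Rightarrow> 'a \<Rightarrow> real" where
  "clamped T r = X (max 0 (min T r))"

text \<open>Clamping the times allows to quantify over all rationals, which keeps the event measurable.\<close>

definition osc_event :: "real \<Rightarrow> real \<Rightarrow> real \<Rightarrow> 'a set" where
  "osc_event T h \<eta> = {\<omega>\<in>space M. \<forall>r\<in>\<rat>. \<forall>q\<in>\<rat>. \<bar>r - q\<bar> < h \<longrightarrow> \<bar>clamped T r \<omega> - clamped T q \<omega>\<bar> \<le> \<eta>}"

lemma osc_event_sets [measurable]: "osc_event T h \<eta> \<in> sets M"
proof -
  have [measurable]: "clamped T r \<in> borel_measurable M" for r unfolding clamped_def by (rule X_M) simp
  show ?thesis unfolding osc_event_def
    by (intro sets.sets_Collect_countable_All' countable_rat) measurable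
qed

lemma clamped_continuous: "\<omega> \<in> space M \<Longrightarrow> continuous_on UNIV (\<lambda>r. clamped T r \<omega>)"
  unfolding clamped_def
  by (rule continuous_on_compose2[OF X_cont]) (auto intro!: continuous_intros)

text \<open>Rational times approximating \<open>u\<close> and \<open>v\<close> eventually satisfy
  the strict bound \<open>< h\<close>, and continuity passes to the limit.\<close>

lemma osc_eventD:
  assumes w: "\<omega> \<in> osc_event T h \<eta>" and uv: "0 \<le> u" "u \<le> T" "0 \<le> v" "v \<le> T" "\<bar>u - v\<bar> < h"
  shows "\<bar>X u \<omega> - X v \<omega>\<bar> \<le> \<eta>"
proof -
  have wM: "\<omega> \<in> space M" using w by (simp add: osc_event_def)
  let ?f = "\<lambda>r. clamped T r \<omega>"
  have cf: "isCont ?f x" for x using clamped_continuous[OF wM, of T] by (simp add: continuous_on_eq_continuous_at)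
  have "\<exists>q\<in>\<rat>. \<bar>q - x\<bar> < e" if "0 < e" for x e :: real
    using Rats_dense_in_real[of x "x + e"] that by force
  then have "\<exists>q. q \<in> \<rat> \<and> \<bar>q - x\<bar> < 1 / real (Suc n)" for x :: real and n by (metis of_nat_0_less_iff zero_less_Suc zero_less_divide_1_iff)
  then obtain qq where qq: "\<And>x n. qq x n \<in> \<rat>" "\<And>x n. \<bar>qq x n - x\<bar> < 1 / real (Suc n)" by metis
  have lim: "qq x \<longlonglongrightarrow> x" for x
  proof (rule LIM_zero_cancel, rule Lim_null_comparison[OF _ LIMSEQ_inverse_real_of_nat])
    show "\<forall>\<^sub>F n in sequentially. norm (qq x n - x) \<le> inverse (real (Suc n))"
      using qq(2)[of x] by (auto simp: inverse_eq_divide intro!: always_eventually less_imp_le)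
  qed
  have "(\<lambda>n. \<bar>?f (qq u n) - ?f (qq v n)\<bar>) \<longlonglongrightarrow> \<bar>?f u - ?f v\<bar>"
    by (intro tendsto_intros isCont_tendsto_compose[OF cf] lim)
  moreover have "(\<lambda>n. \<bar>qq u n - qq v n\<bar>) \<longlonglongrightarrow> \<bar>u - v\<bar>" by (intro tendsto_intros lim)
  then have "\<forall>\<^sub>F n in sequentially. \<bar>qq u n - qq v n\<bar> < h" using uv(5) by (rule order_tendstoD)
  then have "\<forall>\<^sub>F n in sequentially. \<bar>?f (qq u n) - ?f (qq v n)\<bar> \<le> \<eta>"
    by eventually_elim (use w qq(1) in \<open>auto simp: osc_event_def\<close>)
  ultimately have "\<bar>?f u - ?f v\<bar> \<le> \<eta>" by (intro tendsto_upperbound) auto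
  then show ?thesis using uv by (simp add: clamped_def)
qed

text \<open>The complements decrease as the window shrinks, and by uniform continuity on a compact
  interval no path lies in all of them.\<close>

lemma osc_event_prob:
  assumes "0 < \<eta>"
  shows "(\<lambda>n. prob (space M - osc_event T (c / real n) \<eta>)) \<longlonglongrightarrow> 0"
proof -
  \<comment> \<open>The index is shifted because \<open>c / 0 = 0\<close> turns the event at
    \<open>n = 0\<close> into the whole space, which would spoil monotonicity.\<close>
  let ?A = "\<lambda>n. space M - osc_event T (c / real (Suc n)) \<eta>"
  have mono: "osc_event T h \<eta> \<subseteq> osc_event T h' \<eta>" if "h' \<le> h" for h h'
  proof
    fix \<omega> assume w: "\<omega> \<in> osc_event T h \<eta>"
    have "\<bar>r - q\<bar> < h" if "\<bar>r - q\<bar> < h'" for r q using that \<open>h' \<le> h\<close> by simp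
    then show "\<omega> \<in> osc_event T h' \<eta>" using w unfolding osc_event_def by blast
  qed
  have dec: "decseq ?A"
  proof (cases "c \<le> 0")
    case True
    have "\<not> \<bar>r - q\<bar> < c / real (Suc n)" for n and r q :: real
    proof -
      have "c / real (Suc n) \<le> 0" using True by (simp add: divide_nonpos_pos)
      then show ?thesis by linarith
    qed
    then have "osc_event T (c / real (Suc n)) \<eta> = space M" for n
      unfolding osc_event_def by blast
    then show ?thesis by (simp add: decseq_def)
  next
    case False
    have "c / real (Suc n) \<le> c / real (Suc m)" if "m \<le> n" for m n
      using that False by (intro divide_left_mono) auto
    then show ?thesis unfolding decseq_def using mono by blast
  qed
  have "(\<Inter>n. ?A n) = {}"
  proof (rule ccontr)
    assume "(\<Inter>n. ?A n) \<noteq> {}"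
    then obtain \<omega> where w: "\<omega> \<in> space M" "\<And>n. \<omega> \<notin> osc_event T (c / real (Suc n)) \<eta>" by auto
    have "uniformly_continuous_on {0..max 0 T} (\<lambda>t. X t \<omega>)"
      by (intro compact_uniformly_continuous continuous_on_subset[OF X_cont[OF w(1)]]) auto
    then obtain d where d: "0 < d" "\<And>u v. u \<in> {0..max 0 T} \<Longrightarrow> v \<in> {0..max 0 T} \<Longrightarrow> dist v u < d \<Longrightarrow> dist (X v \<omega>) (X u \<omega>) < \<eta>"
      using assms unfolding uniformly_continuous_on_def by metis
    have "(\<lambda>n. c / real (Suc n)) \<longlonglongrightarrow> 0"
      using filterlim_sequentially_Suc[of "\<lambda>n. c / real n"] lim_const_over_n[of c] by blast
    then have "\<forall>\<^sub>F n in sequentially. c / real (Suc n) < d" using d(1) by (rule order_tendstoD)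
    then obtain n where n: "c / real (Suc n) < d" by (auto simp: eventually_sequentially)
    have "\<omega> \<in> osc_event T (c / real (Suc n)) \<eta>"
      unfolding osc_event_def clamped_def
    proof (safe, rule w(1))
      fix r q :: real assume "\<bar>r - q\<bar> < c / real (Suc n)"
      then have "\<bar>r - q\<bar> < d" using n by simp
      then have "dist (max 0 (min T r)) (max 0 (min T q)) < d" by (auto simp: dist_real_def)
      then have "dist (X (max 0 (min T r)) \<omega>) (X (max 0 (min T q)) \<omega>) < \<eta>" by (intro d(2)) auto
      then show "\<bar>X (max 0 (min T r)) \<omega> - X (max 0 (min T q)) \<omega>\<bar> \<le> \<eta>" by (simp add: dist_real_def)
    qed
    then show False using w(2) by blast
  qed
  moreover have "(\<lambda>n. prob (?A n)) \<longlonglongrightarrow> prob (\<Inter>n. ?A n)"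
    by (rule finite_Lim_measure_decseq[OF _ dec]) auto
  ultimately have "(\<lambda>n. prob (?A n)) \<longlonglongrightarrow> 0" by (simp only: measure_empty)
  then show ?thesis by (subst (asm) filterlim_sequentially_Suc[of "\<lambda>n. prob (space M - osc_event T (c / real n) \<eta>)"])
qed

end

section \<open>Riemann sums approximate the Ito integral\<close>

locale brownian_adapted = brownian M F W + continuous_adapted M F X
  for M :: "'a measure" and F W X
begin

abbreviation riemann_sum :: "real \<Rightarrow> real \<Rightarrow> nat \<Rightarrow> nat \<Rightarrow> 'a \<Rightarrow> real" where
  "riemann_sum s T N \<equiv> step_sum (ugrid s T N) (\<lambda>i \<omega>. 2 * X (ugrid s T N i) \<omega>)"

lemma simple_value_bounded: "\<bar>simple_value k a \<xi> x \<omega>\<bar> \<le> (\<Sum>i<k. \<bar>\<xi> i \<omega>\<bar>)"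
  unfolding simple_value_def
  by (rule order_trans[OF sum_abs]) (intro sum_mono, auto simp: abs_mult indicator_def)

lemma simple_value_diff_integrable:
  assumes w: "\<omega> \<in> space M" and T: "0 \<le> T"
  shows "set_integrable lborel {0..T} (\<lambda>x. (simple_value k a \<xi> x \<omega> - 2 * X x \<omega>)\<^sup>2)"
proof -
  have c: "continuous_on {0..T} (\<lambda>x. X x \<omega>)" using continuous_on_subset[OF X_cont[OF w]] by auto
  have "compact ((\<lambda>x. X x \<omega>) ` {0..T})" using c by (intro compact_continuous_image) auto
  then obtain K where K: "\<And>x. x \<in> {0..T} \<Longrightarrow> \<bar>X x \<omega>\<bar> \<le> K"
    using compact_imp_bounded[THEN bounded_iff[THEN iffD1]] by force
  have [measurable]: "(\<lambda>x. indicator {0..T} x *\<^sub>R X x \<omega>) \<in> borel_measurable lborel"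
    using borel_measurable_continuous_on_indicator[OF _ c] by simp
  have [measurable]: "(\<lambda>x. simple_value k a \<xi> x \<omega>) \<in> borel_measurable lborel"
    unfolding simple_value_def by measurable
  define B where "B = (\<Sum>i<k. \<bar>\<xi> i \<omega>\<bar>) + 2 * K"
  have eq: "(\<lambda>x. indicator {0..T} x *\<^sub>R (simple_value k a \<xi> x \<omega> - 2 * X x \<omega>)\<^sup>2) =
     (\<lambda>x. indicator {0..T} x *\<^sub>R (simple_value k a \<xi> x \<omega> - 2 * (indicator {0..T} x *\<^sub>R X x \<omega>))\<^sup>2)"
    by (auto simp: indicator_def)
  have "integrable lborel (\<lambda>x. indicator {0..T} x *\<^sub>R (simple_value k a \<xi> x \<omega> - 2 * (indicator {0..T} x *\<^sub>R X x \<omega>))\<^sup>2)"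
  proof (rule Bochner_Integration.integrable_bound[of _ "\<lambda>x. indicator {0..T} x *\<^sub>R B\<^sup>2"])
    show "AE x in lborel. norm (indicator {0..T} x *\<^sub>R (simple_value k a \<xi> x \<omega> - 2 * (indicator {0..T} x *\<^sub>R X x \<omega>))\<^sup>2) \<le> norm (indicator {0..T} x *\<^sub>R B\<^sup>2)"
    proof (rule AE_I2)
      fix x
      have "(simple_value k a \<xi> x \<omega> - 2 * X x \<omega>)\<^sup>2 \<le> B\<^sup>2" if "x \<in> {0..T}"
        using K[OF that] simple_value_bounded[of k a \<xi> x \<omega>] unfolding B_def by (intro abs_le_imp_square_le) linarith
      then show "norm (indicator {0..T} x *\<^sub>R (simple_value k a \<xi> x \<omega> - 2 * (indicator {0..T} x *\<^sub>R X x \<omega>))\<^sup>2) \<le> norm (indicator {0..T} x *\<^sub>R B\<^sup>2)"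
        by (cases "x \<in> {0..T}") auto
    qed
    show "integrable lborel (\<lambda>x. indicator {0..T} x *\<^sub>R B\<^sup>2)"
      by (intro integrable_scaleR_left integrable_real_indicator) (auto simp: emeasure_lborel_Icc_eq)
  qed measurable
  then show ?thesis unfolding set_integrable_def eq .
qed

text \<open>On a common refinement of the two grids, the difference is a single step sum.\<close>

lemma simple_integral_riemann:
  fixes N :: nat
  assumes sp: "simple_process F k a \<xi>" and sT: "0 \<le> s" "s < T" and N: "0 < N" and pos: "0 < \<eta>" "0 < \<epsilon>"
  defines "u \<equiv> ugrid s T N"
  shows "prob {\<omega>\<in>space M. (\<exists>i\<le>N. \<bar>simple_integral k a \<xi> W (u i) \<omega> - simple_integral k a \<xi> W s \<omega> - step_sum u (\<lambda>i \<omega>. 2 * X (u i) \<omega>) i \<omega>\<bar> > \<epsilon>) \<and>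
      \<omega> \<in> osc_event T (2 * (T - s) / N) \<eta> \<and>
      (LINT x:{0..T}|lborel. (simple_value k a \<xi> x \<omega> - 2 * X x \<omega>)\<^sup>2) \<le> \<eta>\<^sup>2} \<le> (2 + 8 * T) * \<eta>\<^sup>2 / \<epsilon>\<^sup>2"
    (is "prob ?E \<le> _")
proof -
  have a: "0 \<le> a 0" "\<And>i. i < k \<Longrightarrow> a i \<le> a (Suc i)" "\<And>i. i < k \<Longrightarrow> \<xi> i \<in> borel_measurable (F (a i))"
    using sp by (auto simp: simple_process_def)
  have u0: "u 0 = s" "u N = T" using N by (auto simp: u_def)
  have um: "u i \<le> u (Suc i)" for i unfolding u_def using sT by (intro ugrid_Suc_le) auto
  have ul: "s \<le> u i" for i unfolding u_def using sT by (intro ugrid_ge) auto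
  have uT: "u i \<le> T" if "i \<le> N" for i unfolding u_def using sT that by (intro ugrid_le) auto
  have uij: "u i \<le> u j" if "i \<le> j" for i j unfolding u_def using sT that by (intro ugrid_mono) auto
  define A where "A = a ` {..k} \<union> u ` {..N}"
  have "finite A" by (simp add: A_def)
  from merged_grid[OF this sT(2)] obtain L p where p0: "p 0 = s" "p L = T" and p: "\<And>l. l < L \<Longrightarrow> p l < p (Suc l)"
    and av: "\<And>c l. c \<in> A \<Longrightarrow> l < L \<Longrightarrow> \<not> (p l < c \<and> c < p (Suc l))"
    and hit: "\<And>c. c \<in> A \<Longrightarrow> s \<le> c \<Longrightarrow> c \<le> T \<Longrightarrow> \<exists>m\<le>L. p m = c" by blast
  have pm: "p i \<le> p j" if "i \<le> j" "j \<le> L" for i j using grid_mono[of L p i j] p that by (auto intro: less_imp_le)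
  have ps: "s \<le> p i" "p i \<le> T" if "i \<le> L" for i using pm[of 0 i] pm[of i L] that p0 by auto
  let ?G = "\<lambda>i \<omega>. 2 * X (u i) \<omega>"
  have Gm: "?G i \<in> borel_measurable (F (u i))" for i using X_F[of "u i"] ul[of i] sT by auto
  define v where "v l \<omega> = simple_value k a \<xi> (p (Suc l)) \<omega> - simple_value N u ?G (p (Suc l)) \<omega>" for l \<omega>
  have ava: "\<not> (p l < a i \<and> a i < p (Suc l))" if "i \<le> k" "l < L" for i l using av[of "a i" l] that by (auto simp: A_def)
  have avu: "\<not> (p l < u i \<and> u i < p (Suc l))" if "i \<le> N" "l < L" for i l using av[of "u i" l] that by (auto simp: A_def)
  have vm: "v l \<in> borel_measurable (F (p l))" if l: "l < L" for l
  proof -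
    have "0 \<le> p l" using ps[of l] l sT by auto
    then have "simple_value k a \<xi> (p (Suc l)) \<in> borel_measurable (F (p l))"
      "simple_value N u ?G (p (Suc l)) \<in> borel_measurable (F (p l))"
      using a ava avu l u0 sT um Gm by (auto intro!: simple_value_measurable)
    then show ?thesis unfolding v_def by measurable
  qed
  \<comment> \<open>From \<open>(b + 2 * c)\<^sup>2 \<le> 2 * b\<^sup>2 + 8 * c\<^sup>2\<close>: the
    \<open>L\<^sup>2\<close> distance contributes at most \<open>2 * \<eta>\<^sup>2\<close>, the
    increments of \<open>X\<close> within the cells of \<open>u\<close> at most
    \<open>8 * T * \<eta>\<^sup>2\<close>.\<close>
  let ?\<delta> = "(2 + 8 * T) * \<eta>\<^sup>2"
  let ?E' = "{\<omega>\<in>space M. (\<exists>m\<le>L. \<bar>step_sum p v m \<omega>\<bar> > \<epsilon>) \<and> (\<Sum>l<L. (v l \<omega>)\<^sup>2 * (p (Suc l) - p l)) \<le> ?\<delta>}"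
  have "?E \<subseteq> ?E'"
  proof safe
    fix \<omega> i assume w: "\<omega> \<in> space M" and i: "i \<le> N"
      and gt: "\<epsilon> < \<bar>simple_integral k a \<xi> W (u i) \<omega> - simple_integral k a \<xi> W s \<omega> - step_sum u ?G i \<omega>\<bar>"
    from i obtain m where m: "m \<le> L" "p m = u i" using hit[of "u i"] uT[of i] ul[of i] by (auto simp: A_def)
    have 1: "simple_integral k a \<xi> W (u i) \<omega> - simple_integral k a \<xi> W s \<omega> = step_sum p (\<lambda>l. simple_value k a \<xi> (p (Suc l))) m \<omega>"
      using simple_integral_grid[of L p k a m \<xi> \<omega>] p a ava m p0 by auto
    \<comment> \<open>The Riemann sum is itself a \<open>simple_integral\<close> over the grid
      \<open>u\<close>, so the same algebra rewrites it on \<open>p\<close>. Its coefficients are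
      unbounded, which the maximal inequality tolerates.\<close>
    have 2: "simple_integral N u ?G W (u i) \<omega> - simple_integral N u ?G W s \<omega> = step_sum p (\<lambda>l. simple_value N u ?G (p (Suc l))) m \<omega>"
      using simple_integral_grid[of L p N u m ?G \<omega>] p um avu m p0 by auto
    have 3: "simple_integral N u ?G W s \<omega> = 0"
      unfolding simple_integral_def using ul by (simp add: min_absorb2)
    have 4: "simple_integral N u ?G W (u i) \<omega> = step_sum u ?G i \<omega>"
    proof -
      have "simple_integral N u ?G W (u i) \<omega> = (\<Sum>j<N. if j < i then ?G j \<omega> * (W (u (Suc j)) \<omega> - W (u j) \<omega>) else 0)"
        unfolding simple_integral_def using uij
        by (intro sum.cong) (auto simp: min_absorb1 min_absorb2 not_less)
      also have "\<dots> = step_sum u ?G i \<omega>"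
        unfolding step_sum_def using i by (intro sum.mono_neutral_cong_right) auto
      finally show ?thesis .
    qed
    have "step_sum p v m \<omega> = step_sum p (\<lambda>l. simple_value k a \<xi> (p (Suc l))) m \<omega> - step_sum p (\<lambda>l. simple_value N u ?G (p (Suc l))) m \<omega>"
      unfolding step_sum_def v_def by (simp add: left_diff_distrib sum_subtractf)
    then have "step_sum p v m \<omega> = simple_integral k a \<xi> W (u i) \<omega> - simple_integral k a \<xi> W s \<omega> - step_sum u ?G i \<omega>"
      using 1 2 3 4 by simp
    then show "\<exists>m\<le>L. \<epsilon> < \<bar>step_sum p v m \<omega>\<bar>" using gt m by auto
  next
    fix \<omega> assume w: "\<omega> \<in> space M" and osc: "\<omega> \<in> osc_event T (2 * (T - s) / N) \<eta>"
      and I: "(LINT x:{0..T}|lborel. (simple_value k a \<xi> x \<omega> - 2 * X x \<omega>)\<^sup>2) \<le> \<eta>\<^sup>2"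
    let ?f = "\<lambda>x. (simple_value k a \<xi> x \<omega> - 2 * X x \<omega>)\<^sup>2"
    have int: "set_integrable lborel {0..T} ?f" using simple_value_diff_integrable[OF w, of T k a \<xi>] sT by simp
    have int': "set_integrable lborel {x<..y} ?f" if "0 \<le> x" "y \<le> T" for x y
      by (rule set_integrable_subset[OF int]) (use that in auto)
    \<comment> \<open>The cell of \<open>p\<close> lies in \<open>(u i, u (Suc i)]\<close> for the
      \<open>i\<close> found below. There the Riemann coefficient is frozen at \<open>u i\<close>,
      so \<open>v l\<close> differs from the integrand error at \<open>x\<close> only by an
      increment of \<open>2 * X\<close> within one window of \<open>osc_event\<close>.\<close>
    have bd: "(v l \<omega>)\<^sup>2 \<le> 2 * ?f x + 8 * \<eta>\<^sup>2" if l: "l < L" and x: "p l < x" "x \<le> p (Suc l)" for l x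
    proof -
      define j where "j = (LEAST j. p (Suc l) \<le> u j)"
      have ex: "p (Suc l) \<le> u N" using ps[of "Suc l"] l u0 by auto
      have j1: "p (Suc l) \<le> u j" unfolding j_def using ex by (rule LeastI)
      have jN: "j \<le> N" unfolding j_def using ex by (rule Least_le)
      have j0: "j \<noteq> 0" using j1 u0 ps[of l] p[OF l] l by (intro notI) auto
      then obtain i where i: "j = Suc i" by (cases j) auto
      have i1: "u i < p (Suc l)" using not_less_Least[of i "\<lambda>j. p (Suc l) \<le> u j"] i unfolding j_def by auto
      then have i2: "u i \<le> p l" using avu[of i l] jN i l by auto
      have "simple_value N u ?G (p (Suc l)) \<omega> = 2 * X (u i) \<omega>"
        by (rule simple_value_on) (use um jN i i1 j1 in auto)
      moreover have "simple_value k a \<xi> x \<omega> = simple_value k a \<xi> (p (Suc l)) \<omega>"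
        by (rule simple_value_const[of _ "p l"]) (use ava l x in auto)
      ultimately have v: "v l \<omega> = (simple_value k a \<xi> x \<omega> - 2 * X x \<omega>) + 2 * (X x \<omega> - X (u i) \<omega>)"
        by (simp add: v_def)
      have "\<bar>x - u i\<bar> < 2 * (T - s) / N"
      proof -
        have "x - u i \<le> u (Suc i) - u i" using x j1 i by simp
        also have "\<dots> = (T - s) / N" by (simp add: u_def ugrid_Suc_diff)
        also have "\<dots> < 2 * (T - s) / N" using sT N by (simp add: field_simps)
        finally show ?thesis using x i2 by auto
      qed
      then have "\<bar>X x \<omega> - X (u i) \<omega>\<bar> \<le> \<eta>"
        using x ps[of "Suc l"] l ul[of i] uT[of i] jN i sT i2 by (intro osc_eventD[OF osc]) auto
      then have "(X x \<omega> - X (u i) \<omega>)\<^sup>2 \<le> \<eta>\<^sup>2" by (rule abs_le_imp_square_le)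
      moreover have "(b + 2 * c)\<^sup>2 \<le> 2 * b\<^sup>2 + 8 * c\<^sup>2" for b c :: real
      proof -
        have "0 \<le> (b - 2 * c)\<^sup>2" by simp
        then show ?thesis by (simp add: power2_eq_square algebra_simps)
      qed
      ultimately show ?thesis unfolding v by (smt (verit))
    qed
    have "(\<Sum>l<m. (v l \<omega>)\<^sup>2 * (p (Suc l) - p l)) \<le> 2 * (LINT x:{s<..p m}|lborel. ?f x) + 8 * \<eta>\<^sup>2 * (p m - s)" if "m \<le> L" for m
      using that
    proof (induction m)
      case (Suc m)
      have m: "s \<le> p m" "p m \<le> p (Suc m)" "p (Suc m) \<le> T" "0 \<le> p m"
        using ps[of m] ps[of "Suc m"] p[of m] Suc.prems sT by auto
      have c: "set_integrable lborel {p m<..p (Suc m)} (\<lambda>_. b)" for b :: real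
        unfolding set_integrable_def using m by (intro integrable_scaleR_left integrable_real_indicator) auto
      have f2: "set_integrable lborel {p m<..p (Suc m)} (\<lambda>x. 2 * ?f x)"
        by (rule set_integrable_mult_right) (rule int'[OF m(4,3)])
      have "(v m \<omega>)\<^sup>2 * (p (Suc m) - p m) = (LINT x:{p m<..p (Suc m)}|lborel. (v m \<omega>)\<^sup>2)"
        using m by (simp add: set_integral_const)
      also have "\<dots> \<le> (LINT x:{p m<..p (Suc m)}|lborel. 2 * ?f x + 8 * \<eta>\<^sup>2)"
        using Suc.prems bd by (intro set_integral_mono set_integral_add(1) c f2) auto
      also have "\<dots> = 2 * (LINT x:{p m<..p (Suc m)}|lborel. ?f x) + 8 * \<eta>\<^sup>2 * (p (Suc m) - p m)"
        using m by (subst set_integral_add(2)[OF f2 c]) (simp add: set_integral_const)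
      finally have *: "(v m \<omega>)\<^sup>2 * (p (Suc m) - p m) \<le> \<dots>" .
      have "{s<..p (Suc m)} = {s<..p m} \<union> {p m<..p (Suc m)}" using m by auto
      then have "(LINT x:{s<..p (Suc m)}|lborel. ?f x) = (LINT x:{s<..p m}|lborel. ?f x) + (LINT x:{p m<..p (Suc m)}|lborel. ?f x)"
        using m sT by (simp only:) (subst set_integral_Un, auto intro!: int')
      then show ?case using * Suc by (simp add: algebra_simps)
    qed (simp add: p0 set_lebesgue_integral_def)
    from this[of L] have "(\<Sum>l<L. (v l \<omega>)\<^sup>2 * (p (Suc l) - p l)) \<le> 2 * (LINT x:{s<..T}|lborel. ?f x) + 8 * \<eta>\<^sup>2 * (T - s)"
      using p0 by simp
    also have "\<dots> \<le> 2 * \<eta>\<^sup>2 + 8 * \<eta>\<^sup>2 * T"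
    proof -
      have "(LINT x:{s<..T}|lborel. ?f x) \<le> (LINT x:{0..T}|lborel. ?f x)"
        unfolding set_lebesgue_integral_def
        using int int'[of s T] sT by (intro integral_mono) (auto simp: set_integrable_def indicator_def)
      moreover have "8 * \<eta>\<^sup>2 * (T - s) \<le> 8 * \<eta>\<^sup>2 * T" using sT by (intro mult_left_mono) auto
      ultimately show ?thesis using I by linarith
    qed
    finally show "(\<Sum>l<L. (v l \<omega>)\<^sup>2 * (p (Suc l) - p l)) \<le> ?\<delta>" by (simp add: algebra_simps)
  qed
  moreover have "?E' \<in> events"
  proof -
    have pp: "0 \<le> p l" if "l \<le> L" for l using ps[of l] that sT by auto
    have [measurable]: "(\<lambda>\<omega>. \<Sum>l<L. (v l \<omega>)\<^sup>2 * (p (Suc l) - p l)) \<in> borel_measurable M"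
      using measurable_F_M[OF pp vm] by (intro borel_measurable_sum) auto
    have "step_sum p v m \<in> borel_measurable M" if "m \<le> L" for m
      by (rule measurable_F_M[OF pp[OF that] step_sum_measurable[of p L]]) (use p0 sT p vm that in \<open>auto intro: less_imp_le\<close>)
    then have "{\<omega>\<in>space M. \<exists>m\<in>{..L}. \<bar>step_sum p v m \<omega>\<bar> > \<epsilon>} \<in> events"
      by (intro sets.sets_Collect_finite_Ex) auto
    moreover have "{\<omega>\<in>space M. (\<Sum>l<L. (v l \<omega>)\<^sup>2 * (p (Suc l) - p l)) \<le> ?\<delta>} \<in> events" by measurable
    ultimately have "{\<omega>\<in>space M. \<exists>m\<in>{..L}. \<bar>step_sum p v m \<omega>\<bar> > \<epsilon>} \<inter> {\<omega>\<in>space M. (\<Sum>l<L. (v l \<omega>)\<^sup>2 * (p (Suc l) - p l)) \<le> ?\<delta>} \<in> events"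
      by (rule sets.Int)
    also have "{\<omega>\<in>space M. \<exists>m\<in>{..L}. \<bar>step_sum p v m \<omega>\<bar> > \<epsilon>} \<inter> {\<omega>\<in>space M. (\<Sum>l<L. (v l \<omega>)\<^sup>2 * (p (Suc l) - p l)) \<le> ?\<delta>} = ?E'" by auto
    finally show ?thesis .
  qed
  ultimately have "prob ?E \<le> prob ?E'" by (rule finite_measure_mono)
  also have "\<dots> \<le> ?\<delta> / \<epsilon>\<^sup>2"
    by (rule step_sum_lenglart) (use p0 p vm pos sT in auto)
  finally show ?thesis .
qed

text \<open>For fixed \<open>N\<close> only finitely many grid times occur, so convergence in
  probability at each of them suffices and \<open>n\<close> can be sent to infinity first. What
  remains is a multiple of \<open>\<eta>\<^sup>2\<close> and the probability of a large oscillation: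
  \<open>\<eta>\<close> is then fixed small and \<open>N\<close> sent to infinity.\<close>

theorem riemann_approx:
  assumes sp: "\<And>n. simple_process F (k n) (a n) (\<xi> n)"
    and l2: "\<And>t. 0 \<le> t \<Longrightarrow> tendsto_in_prob M (\<lambda>n \<omega>. LINT x:{0..t}|lborel. (simple_value (k n) (a n) (\<xi> n) x \<omega> - 2 * X x \<omega>)\<^sup>2) (\<lambda>\<omega>. 0)"
    and J: "\<And>t. 0 \<le> t \<Longrightarrow> tendsto_in_prob M (\<lambda>n. simple_integral (k n) (a n) (\<xi> n) W t) (J t)"
    and sT: "0 \<le> s" "s < T" and \<epsilon>: "0 < \<epsilon>"
  shows "(\<lambda>N. prob {\<omega>\<in>space M. \<exists>i\<le>N. \<bar>J (ugrid s T N i) \<omega> - J s \<omega> - riemann_sum s T N i \<omega>\<bar> > \<epsilon>}) \<longlonglongrightarrow> 0"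
    (is "(\<lambda>N. prob (?P N)) \<longlonglongrightarrow> 0")
proof -
  have u: "0 \<le> ugrid s T N i" for N i using ugrid_ge[of s T N i] sT by auto
  define S where "S n = simple_integral (k n) (a n) (\<xi> n) W" for n
  define I where "I n \<omega> = (LINT x:{0..T}|lborel. (simple_value (k n) (a n) (\<xi> n) x \<omega> - 2 * X x \<omega>)\<^sup>2)" for n \<omega>
  have Sm[measurable]: "0 \<le> t \<Longrightarrow> S n t \<in> borel_measurable M" for n t using J[of t] by (auto simp: tendsto_in_prob_def S_def)
  have Jm: "0 \<le> t \<Longrightarrow> J t \<in> borel_measurable M" for t using J[of t] by (auto simp: tendsto_in_prob_def)
  have Im[measurable]: "I n \<in> borel_measurable M" for n using l2[of T] sT unfolding tendsto_in_prob_def I_def by auto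
  have Rm: "riemann_sum s T N i \<in> borel_measurable M" for N i
    unfolding step_sum_def using X_M[OF u] W_M[OF u] by (intro borel_measurable_sum borel_measurable_times borel_measurable_diff) auto
  have bound: "prob (?P N) \<le> 4 * (2 + 8 * T) * \<eta>\<^sup>2 / \<epsilon>\<^sup>2 + prob (space M - osc_event T (2 * (T - s) / real N) \<eta>)"
    if N: "0 < N" and \<eta>: "0 < \<eta>" for N \<eta>
  proof -
    let ?u = "ugrid s T N"
    let ?C = "4 * (2 + 8 * T) * \<eta>\<^sup>2 / \<epsilon>\<^sup>2 + prob (space M - osc_event T (2 * (T - s) / real N) \<eta>)"
    let ?B = "\<lambda>n i. {\<omega>\<in>space M. \<bar>S n (?u i) \<omega> - J (?u i) \<omega>\<bar> > \<epsilon> / 4}"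
    let ?D = "\<lambda>n. {\<omega>\<in>space M. \<bar>I n \<omega> - 0\<bar> > \<eta>\<^sup>2}"
    let ?O = "space M - osc_event T (2 * (T - s) / real N) \<eta>"
    let ?A = "\<lambda>n. {\<omega>\<in>space M. (\<exists>i\<le>N. \<bar>S n (?u i) \<omega> - S n s \<omega> - step_sum ?u (\<lambda>i \<omega>. 2 * X (?u i) \<omega>) i \<omega>\<bar> > \<epsilon> / 2) \<and>
      \<omega> \<in> osc_event T (2 * (T - s) / real N) \<eta> \<and> I n \<omega> \<le> \<eta>\<^sup>2}"
    have Bm: "?B n i \<in> events" for n i using Sm[OF u] Jm[OF u] by auto
    have Am: "?A n \<in> events" for n
    proof -
      have "{\<omega>\<in>space M. \<exists>i\<in>{..N}. \<bar>S n (?u i) \<omega> - S n s \<omega> - step_sum ?u (\<lambda>i \<omega>. 2 * X (?u i) \<omega>) i \<omega>\<bar> > \<epsilon> / 2} \<in> events"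
        using Sm[OF u] Sm[OF sT(1)] Rm[of N] by (intro sets.sets_Collect_finite_Ex) auto
      moreover have "{\<omega>\<in>space M. I n \<omega> \<le> \<eta>\<^sup>2} \<in> events" by measurable
      ultimately have "({\<omega>\<in>space M. \<exists>i\<in>{..N}. \<bar>S n (?u i) \<omega> - S n s \<omega> - step_sum ?u (\<lambda>i \<omega>. 2 * X (?u i) \<omega>) i \<omega>\<bar> > \<epsilon> / 2} \<inter> osc_event T (2 * (T - s) / real N) \<eta>) \<inter> {\<omega>\<in>space M. I n \<omega> \<le> \<eta>\<^sup>2} \<in> events"
        by (intro sets.Int osc_event_sets)
      then show ?thesis by (rule back_subst[of "\<lambda>A. A \<in> events"]) auto
    qed
    have le: "prob (?P N) \<le> ?C + (prob (?D n) + (\<Sum>i\<le>N. prob (?B n i)))" for n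
    proof -
      have "?P N \<subseteq> ?A n \<union> (?O \<union> (?D n \<union> (\<Union>i\<in>{..N}. ?B n i)))"
      proof
        fix \<omega> assume "\<omega> \<in> ?P N"
        then obtain i where w: "\<omega> \<in> space M" and i: "i \<le> N" and gt: "\<bar>J (?u i) \<omega> - J s \<omega> - step_sum ?u (\<lambda>i \<omega>. 2 * X (?u i) \<omega>) i \<omega>\<bar> > \<epsilon>"
          by auto
        show "\<omega> \<in> ?A n \<union> (?O \<union> (?D n \<union> (\<Union>i\<in>{..N}. ?B n i)))"
        proof (rule ccontr)
          assume "\<not> ?thesis"
          then have A0: "\<omega> \<notin> ?A n" "\<omega> \<in> osc_event T (2 * (T - s) / real N) \<eta>" "I n \<omega> \<le> \<eta>\<^sup>2"
            and Ball: "\<And>j. j \<le> N \<Longrightarrow> \<omega> \<notin> ?B n j"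
            using w by auto
          have B: "\<bar>S n (?u j) \<omega> - J (?u j) \<omega>\<bar> \<le> \<epsilon> / 4" if "j \<le> N" for j
            using Ball[OF that] w by (simp add: not_less)
          note A = A0 B[OF i] B[OF le0, unfolded ugrid_0]
          then have "\<bar>S n (?u i) \<omega> - S n s \<omega> - step_sum ?u (\<lambda>i \<omega>. 2 * X (?u i) \<omega>) i \<omega>\<bar> \<le> \<epsilon> / 2"
            using w i A0 by (auto simp: not_less)
          then show False using A(4,5) gt by linarith
        qed
      qed
      moreover have UB: "(\<Union>i\<in>{..N}. ?B n i) \<in> events" by (rule sets.finite_UN[OF finite_atMost Bm])
      moreover have DM: "?D n \<in> events" by measurable
      moreover have OM: "?O \<in> events" by measurable
      ultimately have "prob (?P N) \<le> prob (?A n \<union> (?O \<union> (?D n \<union> (\<Union>i\<in>{..N}. ?B n i))))"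
        using Am by (intro finite_measure_mono sets.Un)
      also have "\<dots> \<le> prob (?A n) + prob (?O \<union> (?D n \<union> (\<Union>i\<in>{..N}. ?B n i)))"
        using UB DM OM Am by (intro measure_Un_le sets.Un)
      also have "prob (?O \<union> (?D n \<union> (\<Union>i\<in>{..N}. ?B n i))) \<le> prob ?O + prob (?D n \<union> (\<Union>i\<in>{..N}. ?B n i))"
        using UB DM OM by (intro measure_Un_le sets.Un)
      also have "prob (?D n \<union> (\<Union>i\<in>{..N}. ?B n i)) \<le> prob (?D n) + prob (\<Union>i\<in>{..N}. ?B n i)"
        using UB DM by (intro measure_Un_le)
      also have "prob (\<Union>i\<in>{..N}. ?B n i) \<le> (\<Sum>i\<le>N. prob (?B n i))"
        by (rule measure_UNION_le[OF finite_atMost]) (use Bm in blast)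
      finally have "prob (?P N) \<le> prob (?A n) + (prob ?O + (prob (?D n) + (\<Sum>i\<le>N. prob (?B n i))))"
        by simp
      moreover have "prob (?A n) \<le> (2 + 8 * T) * \<eta>\<^sup>2 / (\<epsilon> / 2)\<^sup>2"
        unfolding S_def I_def by (rule simple_integral_riemann[OF sp sT N \<eta>]) (use \<epsilon> in simp)
      moreover have "(2 + 8 * T) * \<eta>\<^sup>2 / (\<epsilon> / 2)\<^sup>2 = 4 * (2 + 8 * T) * \<eta>\<^sup>2 / \<epsilon>\<^sup>2" by (simp add: power_divide)
      ultimately show ?thesis by linarith
    qed
    have "(\<lambda>n. ?C + (prob (?D n) + (\<Sum>i\<le>N. prob (?B n i)))) \<longlonglongrightarrow> ?C + (0 + (\<Sum>i\<le>N. 0))"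
    proof (intro tendsto_intros)
      show "(\<lambda>n. prob (?D n)) \<longlonglongrightarrow> 0"
        using l2[of T] sT \<eta> unfolding tendsto_in_prob_def I_def by auto
      show "(\<lambda>n. prob (?B n i)) \<longlonglongrightarrow> 0" for i
      proof -
        have "0 < \<epsilon> / 4" using \<epsilon> by simp
        then show ?thesis using J[OF u[of N i]] unfolding tendsto_in_prob_def S_def by blast
      qed
    qed
    then show ?thesis using le by (intro LIMSEQ_le_const[of _ ?C]) auto
  qed
  show ?thesis
  proof (rule LIMSEQ_I)
    fix r :: real assume r: "0 < r"
    define C where "C = 4 * (2 + 8 * T) / \<epsilon>\<^sup>2"
    have C: "0 < C" using sT \<epsilon> by (simp add: C_def)
    define \<eta> where "\<eta> = sqrt (r / (2 * C))"
    have \<eta>: "0 < \<eta>" "C * \<eta>\<^sup>2 = r / 2" using r C by (auto simp: \<eta>_def)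
    have "\<forall>\<^sub>F N in sequentially. prob (space M - osc_event T (2 * (T - s) / real N) \<eta>) < r / 2"
      using osc_event_prob[OF \<eta>(1), of T "2 * (T - s)"] r by (intro order_tendstoD) auto
    then have "\<forall>\<^sub>F N in sequentially. norm (prob (?P N) - 0) < r"
      using eventually_gt_at_top[of 0]
    proof eventually_elim
      case (elim N)
      then show ?case using bound[of N \<eta>] \<eta> by (simp add: C_def)
    qed
    then show "\<exists>no. \<forall>n\<ge>no. norm (prob (?P n) - 0) < r" by (simp add: eventually_sequentially)
  qed
qed

end

section \<open>Good-lambda inequalities\<close>

lemma ennreal_le_mono: "a \<le> b \<Longrightarrow> ennreal b \<le> z \<Longrightarrow> ennreal a \<le> z"
  by (meson ennreal_leI order_trans)

lemma ennreal_less_mono: "0 \<le> a \<Longrightarrow> a < b \<Longrightarrow> ennreal b \<le> z \<Longrightarrow> ennreal a < z"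
  by (meson ennreal_lessI less_le_trans le_less_trans)

context filtered_prob_space
begin

lemma stopping_time_measurable:
  assumes "ext_stopping_time F \<tau>"
  shows "\<tau> \<in> borel_measurable M"
proof (rule borel_measurableI_le)
  fix y :: ennreal
  show "{x \<in> space M. \<tau> x \<le> y} \<in> events"
  proof (cases y)
    case (real t)
    have "{x \<in> space (F t). \<tau> x \<le> ennreal t} \<in> sets (F t)"
      using assms real unfolding ext_stopping_time_def by (simp add: pred_def)
    then show ?thesis using real sets_F_subset[of t] space_F[of t] by auto
  qed simp
qed

lemma stopping_time_less_sets:
  assumes "ext_stopping_time F \<tau>" "0 \<le> s" "s \<le> t"
  shows "{\<omega>\<in>space M. ennreal s < \<tau> \<omega>} \<in> sets (F t)"
proof -
  have "{x \<in> space (F s). \<tau> x \<le> ennreal s} \<in> sets (F s)"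
    using assms unfolding ext_stopping_time_def by (simp add: pred_def)
  then have "space (F s) - {x \<in> space (F s). \<tau> x \<le> ennreal s} \<in> sets (F s)" by auto
  moreover have "space (F s) - {x \<in> space (F s). \<tau> x \<le> ennreal s} = {\<omega>\<in>space M. ennreal s < \<tau> \<omega>}"
    using space_F[OF assms(2)] by auto
  ultimately show ?thesis using F_mono[OF assms(2,3)] by auto
qed

end

section \<open>Second moments of stopped sums\<close>

context brownian
begin

lemma step_sum_between:
  assumes "\<And>k. k < N \<Longrightarrow> \<eta> k \<omega> = (if \<sigma> \<le> k \<and> k < \<rho> then v k \<omega> else 0)" "\<sigma> \<le> \<rho>" "\<rho> \<le> N"
  shows "step_sum p \<eta> N \<omega> = step_sum p v \<rho> \<omega> - step_sum p v \<sigma> \<omega>"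
proof -
  let ?a = "\<lambda>k. v k \<omega> * (W (p (Suc k)) \<omega> - W (p k) \<omega>)"
  have "step_sum p \<eta> N \<omega> = (\<Sum>k<N. if \<sigma> \<le> k \<and> k < \<rho> then ?a k else 0)"
    unfolding step_sum_def using assms(1) by (intro sum.cong) auto
  also have "\<dots> = (\<Sum>k\<in>{\<sigma>..<\<rho>}. ?a k)"
    using assms(3) by (intro sum.mono_neutral_cong_right) auto
  also have "\<dots> = (\<Sum>k<\<rho>. ?a k) - (\<Sum>k<\<sigma>. ?a k)"
    using assms(2) sum_diff[of "{..<\<rho>}" "{..<\<sigma>}" ?a]
    by (simp add: lessThan_minus_lessThan)
  finally show ?thesis by (simp add: step_sum_def)
qed

text \<open>Off \<open>A\<close> all coefficients vanish. The event may look ahead of the grid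
  times, as it enters only through the second moments of the coefficients; it supplies the
  probability on the right-hand side of the good-lambda inequalities.\<close>

lemma step_sum_square_le:
  assumes sT: "0 \<le> s" "s < T"
    and \<eta>: "\<And>i. i < N \<Longrightarrow> \<eta> i \<in> borel_measurable (F (ugrid s T N i))"
    and A[measurable]: "A \<in> events"
    and bd: "\<And>i \<omega>. i < N \<Longrightarrow> \<omega> \<in> space M \<Longrightarrow> \<bar>\<eta> i \<omega>\<bar> \<le> K * indicator A \<omega>"
  shows "integrable M (\<lambda>\<omega>. (step_sum (ugrid s T N) \<eta> N \<omega>)\<^sup>2)"
    and "expectation (\<lambda>\<omega>. (step_sum (ugrid s T N) \<eta> N \<omega>)\<^sup>2) \<le> (T - s) * K\<^sup>2 * prob A"
proof -
  let ?u = "ugrid s T N"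
  have u: "0 \<le> ?u 0" "\<And>l. l < N \<Longrightarrow> ?u l \<le> ?u (Suc l)" "\<And>l. 0 \<le> ?u l"
    using sT ugrid_Suc_le[of s T N] ugrid_ge[of s T N] by (auto intro: order_trans[OF sT(1)])
  have "\<exists>B. \<forall>\<omega>\<in>space M. \<bar>\<eta> i \<omega>\<bar> \<le> B" if "i < N" for i
  proof (intro exI[of _ "\<bar>K\<bar>"] ballI)
    fix \<omega> assume "\<omega> \<in> space M"
    from bd[OF that this] show "\<bar>\<eta> i \<omega>\<bar> \<le> \<bar>K\<bar>" by (cases "\<omega> \<in> A") auto
  qed
  note iso = step_sum_isometry[of ?u N \<eta>, OF u(1,2) \<eta> this]
  show "integrable M (\<lambda>\<omega>. (step_sum (ugrid s T N) \<eta> N \<omega>)\<^sup>2)" using iso by auto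
  have e: "expectation (\<lambda>\<omega>. (\<eta> i \<omega>)\<^sup>2) \<le> K\<^sup>2 * prob A" if "i < N" for i
  proof -
    have [measurable]: "\<eta> i \<in> borel_measurable M" using \<eta>[OF that] u(3) measurable_F_M by blast
    have le: "(\<eta> i \<omega>)\<^sup>2 \<le> K\<^sup>2 * indicator A \<omega>" if "\<omega> \<in> space M" for \<omega>
      using abs_le_imp_square_le[OF bd[OF \<open>i < N\<close> that]] by (cases "\<omega> \<in> A") auto
    have "expectation (\<lambda>\<omega>. (\<eta> i \<omega>)\<^sup>2) \<le> expectation (\<lambda>\<omega>. K\<^sup>2 * indicator A \<omega>)"
    proof (rule integral_mono)
      have "norm ((\<eta> i \<omega>)\<^sup>2) \<le> K\<^sup>2" if "\<omega> \<in> space M" for \<omega>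
        using le[OF that] by (cases "\<omega> \<in> A") auto
      then show "integrable M (\<lambda>\<omega>. (\<eta> i \<omega>)\<^sup>2)" by (intro integrable_const_bound[of _ "K\<^sup>2"] AE_I2) auto
      show "integrable M (\<lambda>\<omega>. K\<^sup>2 * indicator A \<omega>)" by (intro integrable_mult_right integrable_real_indicator) (auto simp: emeasure_eq_measure)
    qed (rule le)
    then show ?thesis by simp
  qed
  have "expectation (\<lambda>\<omega>. (step_sum ?u \<eta> N \<omega>)\<^sup>2) = (\<Sum>l<N. (T - s) / N * expectation (\<lambda>\<omega>. (\<eta> l \<omega>)\<^sup>2))"
    using iso by (simp add: ugrid_Suc_diff)
  also have "\<dots> \<le> (\<Sum>l<N. (T - s) / N * (K\<^sup>2 * prob A))"
    using e sT by (intro sum_mono mult_left_mono) auto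
  also have "\<dots> \<le> (T - s) * K\<^sup>2 * prob A" using sT by (cases "N = 0") auto
  finally show "expectation (\<lambda>\<omega>. (step_sum ?u \<eta> N \<omega>)\<^sup>2) \<le> (T - s) * K\<^sup>2 * prob A" .
qed

lemma step_sum_chebyshev:
  assumes sT: "0 \<le> s" "s < T"
    and \<eta>: "\<And>i. i < N \<Longrightarrow> \<eta> i \<in> borel_measurable (F (ugrid s T N i))"
    and A[measurable]: "A \<in> events"
    and bd: "\<And>i \<omega>. i < N \<Longrightarrow> \<omega> \<in> space M \<Longrightarrow> \<bar>\<eta> i \<omega>\<bar> \<le> K * indicator A \<omega>" and c: "0 < c"
  shows "{\<omega>\<in>space M. c\<^sup>2 \<le> (step_sum (ugrid s T N) \<eta> N \<omega>)\<^sup>2} \<in> events \<and>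
    prob {\<omega>\<in>space M. c\<^sup>2 \<le> (step_sum (ugrid s T N) \<eta> N \<omega>)\<^sup>2} \<le> (T - s) * K\<^sup>2 * prob A / c\<^sup>2"
proof -
  note I = step_sum_square_le[OF sT \<eta> A bd]
  have [measurable]: "(\<lambda>\<omega>. (step_sum (ugrid s T N) \<eta> N \<omega>)\<^sup>2) \<in> borel_measurable M" using I(1) by auto
  have "prob {\<omega>\<in>space M. c\<^sup>2 \<le> (step_sum (ugrid s T N) \<eta> N \<omega>)\<^sup>2} \<le> expectation (\<lambda>\<omega>. (step_sum (ugrid s T N) \<eta> N \<omega>)\<^sup>2) / c\<^sup>2"
    using I(1) c by (intro integral_Markov_inequality_measure[of _ _ "{}"]) auto
  also have "\<dots> \<le> (T - s) * K\<^sup>2 * prob A / c\<^sup>2" using I(2) by (intro divide_right_mono) auto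
  finally show ?thesis by auto
qed

end

text \<open>Path properties hold for every path, and the stochastic equation for the square survives
  only as convergence of Riemann sums. \<open>bessel_regularisation\<close> obtains such a version
  from the stochastic equation by a change on a null set.\<close>

locale bessel = brownian_adapted M F W X
  for M :: "'a measure" and F W X +
  fixes \<alpha> :: real
  assumes alpha: "1 \<le> \<alpha>"
    and X_nonneg: "\<omega> \<in> space M \<Longrightarrow> 0 \<le> t \<Longrightarrow> 0 \<le> X t \<omega>"
    and riemann: "0 \<le> s \<Longrightarrow> s < T \<Longrightarrow> 0 < \<epsilon> \<Longrightarrow>
      (\<lambda>N. prob {\<omega>\<in>space M. \<exists>i\<le>N. \<bar>(X (ugrid s T N i) \<omega>)\<^sup>2 - (X s \<omega>)\<^sup>2 - \<alpha> * (ugrid s T N i - s)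
        - riemann_sum s T N i \<omega>\<bar> > \<epsilon>}) \<longlonglongrightarrow> 0"
begin

definition approx_event :: "real \<Rightarrow> real \<Rightarrow> nat \<Rightarrow> real \<Rightarrow> 'a set" where
  "approx_event s T N \<epsilon> = {\<omega>\<in>space M. \<forall>i\<le>N. \<bar>(X (ugrid s T N i) \<omega>)\<^sup>2 - (X s \<omega>)\<^sup>2 - \<alpha> * (ugrid s T N i - s)
        - riemann_sum s T N i \<omega>\<bar> \<le> \<epsilon>}"

lemma riemann_sum_measurable:
  assumes "0 \<le> s" "s < T"
  shows "riemann_sum s T N i \<in> borel_measurable M"
proof -
  have u: "0 \<le> ugrid s T N i" for i using ugrid_ge[of s T N i] assms by auto
  show ?thesis unfolding step_sum_def using X_M[OF u] W_M[OF u]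
    by (intro borel_measurable_sum borel_measurable_times borel_measurable_diff) auto
qed

lemma approx_event_sets: 
  assumes "0 \<le> s" "s < T"
  shows "approx_event s T N \<epsilon> \<in> events"
proof -
  have u: "0 \<le> ugrid s T N i" for i using ugrid_ge[of s T N i] assms by auto
  have "{\<omega>\<in>space M. \<forall>i\<in>{..N}. \<bar>(X (ugrid s T N i) \<omega>)\<^sup>2 - (X s \<omega>)\<^sup>2 - \<alpha> * (ugrid s T N i - s)
        - riemann_sum s T N i \<omega>\<bar> \<le> \<epsilon>} \<in> events"
  proof (intro sets.sets_Collect_finite_All)
    fix i
    note [measurable] = X_M[OF u[of i]] X_M[OF assms(1)] riemann_sum_measurable[OF assms, of N i]
    show "{\<omega>\<in>space M. \<bar>(X (ugrid s T N i) \<omega>)\<^sup>2 - (X s \<omega>)\<^sup>2 - \<alpha> * (ugrid s T N i - s)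
        - riemann_sum s T N i \<omega>\<bar> \<le> \<epsilon>} \<in> events" by measurable
  qed auto
  then show ?thesis by (simp only: approx_event_def Ball_def atMost_iff)
qed

lemma approx_event_prob:
  assumes "0 \<le> s" "s < T" "0 < \<epsilon>"
  shows "(\<lambda>N. prob (space M - approx_event s T N \<epsilon>)) \<longlonglongrightarrow> 0"
proof -
  have "space M - approx_event s T N \<epsilon> = {\<omega>\<in>space M. \<exists>i\<le>N. \<bar>(X (ugrid s T N i) \<omega>)\<^sup>2 - (X s \<omega>)\<^sup>2 - \<alpha> * (ugrid s T N i - s)
        - riemann_sum s T N i \<omega>\<bar> > \<epsilon>}" for N
    by (auto simp: approx_event_def not_le)
  then show ?thesis using riemann[OF assms] by simp
qed

text \<open>By continuity \<open>X > c\<close> persists at rational times just before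
  \<open>t\<close>, which still satisfy the constraint by \<open>\<tau>\<close>; times after
  \<open>t\<close> might violate it. The time \<open>0\<close> is itself rational.\<close>

lemma exceed_event_sets:
  assumes \<tau>: "ext_stopping_time F \<tau>"
  shows "{\<omega>\<in>space M. \<exists>t\<ge>0. ennreal t \<le> \<tau> \<omega> \<and> c < X t \<omega>} \<in> events"
proof -
  have [measurable]: "\<tau> \<in> borel_measurable M" using stopping_time_measurable[OF \<tau>] .
  let ?Q = "{q::real. q \<in> \<rat> \<and> 0 \<le> q}"
  have "{\<omega>\<in>space M. \<exists>t\<ge>0. ennreal t \<le> \<tau> \<omega> \<and> c < X t \<omega>} = {\<omega>\<in>space M. \<exists>t\<in>?Q. ennreal t \<le> \<tau> \<omega> \<and> c < X t \<omega>}"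
  proof (intro Collect_cong conj_cong refl iffI)
    fix \<omega> assume w: "\<omega> \<in> space M" and "\<exists>t\<ge>0. ennreal t \<le> \<tau> \<omega> \<and> c < X t \<omega>"
    then obtain t where t: "0 \<le> t" "ennreal t \<le> \<tau> \<omega>" "c < X t \<omega>" by auto
    show "\<exists>t\<in>?Q. ennreal t \<le> \<tau> \<omega> \<and> c < X t \<omega>"
    proof (cases "t = 0")
      case False
      have "continuous (at t within {0..}) (\<lambda>t. X t \<omega>)"
        using X_cont[OF w] t(1) by (auto simp: continuous_on_eq_continuous_within)
      then have "((\<lambda>t. X t \<omega>) \<longlongrightarrow> X t \<omega>) (at t within {0..})" by (simp add: continuous_within)
      then have "\<forall>\<^sub>F r in at t within {0..}. c < X r \<omega>" using t(3) by (rule order_tendstoD)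
      then obtain d where d: "0 < d" "\<And>r. 0 \<le> r \<Longrightarrow> r \<noteq> t \<Longrightarrow> dist r t < d \<Longrightarrow> c < X r \<omega>"
        unfolding eventually_at by auto
      have "max 0 (t - d) < t" using False t d by auto
      from Rats_dense_in_real[OF this] obtain q where q: "q \<in> \<rat>" "max 0 (t - d) < q" "q < t" by auto
      have "ennreal q \<le> \<tau> \<omega>" using q t(2) by (intro ennreal_le_mono[of q t]) auto
      moreover have "c < X q \<omega>" using q by (intro d(2)) (auto simp: dist_real_def)
      ultimately show ?thesis using q by (intro bexI[of _ q]) auto
    qed (use t in auto)
  qed auto
  also have "\<dots> \<in> events"
  proof (rule sets.sets_Collect_countable_Ex')
    show "countable ?Q" using countable_rat by (rule countable_subset[rotated]) auto
    fix q assume "q \<in> ?Q"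
    then have [measurable]: "X q \<in> borel_measurable M" using X_M by auto
    show "{\<omega> \<in> space M. ennreal q \<le> \<tau> \<omega> \<and> c < X q \<omega>} \<in> events" by measurable
  qed
  finally show ?thesis .
qed

text \<open>On the event the grid values of \<open>X\<close> climb from at most
  \<open>11 / 10 * \<kappa>\<close> to more than \<open>3 / 2 * \<kappa>\<close> before
  \<open>T\<close>, too soon for the drift, so the sum in between is at least
  \<open>\<kappa>\<^sup>2 / 2\<close>. Its coefficients are at most \<open>3 * \<kappa>\<close> and
  vanish unless \<open>X\<close> passes \<open>\<kappa>\<close> up to time \<open>\<tau>\<close>;
  Chebyshev gives \<open>T * (3 * \<kappa>)\<^sup>2 / (\<kappa>\<^sup>2 / 2)\<^sup>2 = 36 *
  \<delta>\<^sup>2\<close>.\<close>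

lemma max_good_lambda:
  assumes \<tau>: "ext_stopping_time F \<tau>" and \<kappa>: "0 < \<kappa>" and \<delta>: "0 < \<delta>" "\<alpha> * \<delta>\<^sup>2 \<le> 1 / 4"
  shows "prob {\<omega>\<in>space M. (\<exists>t\<ge>0. ennreal t \<le> \<tau> \<omega> \<and> 2 * \<kappa> < X t \<omega>) \<and> \<tau> \<omega> \<le> ennreal (\<delta>\<^sup>2 * \<kappa>\<^sup>2) \<and> X 0 \<omega> \<le> \<delta> * \<kappa>}
    \<le> 36 * \<delta>\<^sup>2 * prob {\<omega>\<in>space M. \<exists>t\<ge>0. ennreal t \<le> \<tau> \<omega> \<and> \<kappa> < X t \<omega>}"
    (is "prob ?E \<le> 36 * \<delta>\<^sup>2 * prob ?A")
proof -
  define T where "T = \<delta>\<^sup>2 * \<kappa>\<^sup>2"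
  have T: "0 < T" using \<kappa> \<delta> by (simp add: T_def)
  have "1 * \<delta>\<^sup>2 \<le> \<alpha> * \<delta>\<^sup>2" using alpha by (intro mult_right_mono) auto
  then have "\<delta>\<^sup>2 \<le> 1 / 4" using \<delta>(2) by linarith
  then have "\<delta>\<^sup>2 \<le> (1 / 2)\<^sup>2" by (simp add: power_divide)
  then have d2: "\<delta> \<le> 1 / 2" using power2_le_imp_le[of \<delta> "1/2"] by simp
  have A: "?A \<in> events" by (rule exceed_event_sets[OF \<tau>])
  have bound: "prob ?E \<le> 36 * \<delta>\<^sup>2 * prob ?A + (prob (space M - osc_event T (2 * T / real N) (\<kappa> / 10)) + prob (space M - approx_event 0 T N (\<kappa>\<^sup>2 / 10)))"
    if N: "0 < N" for N
  proof -
    define u where "u = ugrid 0 T N"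
    have u0: "0 \<le> u k" for k unfolding u_def using ugrid_ge[of 0 T N k] T by simp
    have um: "u i \<le> u j" if "i \<le> j" for i j unfolding u_def using T that by (intro ugrid_mono) auto
    have us: "u i < u j" if "i < j" for i j
      unfolding u_def ugrid_def using T N that by (intro add_strict_left_mono divide_strict_right_mono mult_strict_right_mono) auto
    \<comment> \<open>The sum runs from the first grid time above \<open>\<kappa>\<close> to the
      first above \<open>3 / 2 * \<kappa>\<close>, and only while \<open>u k < \<tau>\<close>, which
      is decided at time \<open>u k\<close>.\<close>
    define B where "B k = {\<omega>\<in>space M. ennreal (u k) < \<tau> \<omega> \<and> (\<exists>j\<le>k. \<kappa> < X (u j) \<omega>) \<and> (\<forall>j\<le>k. X (u j) \<omega> \<le> 3 / 2 * \<kappa>)}" for k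
    define \<eta> where "\<eta> k \<omega> = indicator (B k) \<omega> * (2 * X (u k) \<omega>)" for k \<omega>
    have Bm: "B k \<in> sets (F (u k))" for k
    proof -
      have sp: "space (F (u k)) = space M" by (rule space_F[OF u0])
      have Xm: "X (u j) \<in> borel_measurable (F (u k))" if "j \<le> k" for j by (rule X_F_le[OF u0 um[OF that]])
      have 1: "{\<omega>\<in>space (F (u k)). \<exists>j\<in>{..k}. \<kappa> < X (u j) \<omega>} \<in> sets (F (u k))"
        by (intro sets.sets_Collect_finite_Ex) (use Xm in auto)
      have 2: "{\<omega>\<in>space (F (u k)). \<forall>j\<in>{..k}. X (u j) \<omega> \<le> 3 / 2 * \<kappa>} \<in> sets (F (u k))"
        by (intro sets.sets_Collect_finite_All) (use Xm in auto)
      note 3 = stopping_time_less_sets[OF \<tau> u0 order_refl, of k]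
      have "B k = {\<omega>\<in>space M. ennreal (u k) < \<tau> \<omega>} \<inter> {\<omega>\<in>space (F (u k)). \<exists>j\<in>{..k}. \<kappa> < X (u j) \<omega>} \<inter> {\<omega>\<in>space (F (u k)). \<forall>j\<in>{..k}. X (u j) \<omega> \<le> 3 / 2 * \<kappa>}"
        unfolding B_def sp by auto
      then show ?thesis using 1 2 3 by auto
    qed
    have \<eta>m: "\<eta> k \<in> borel_measurable (F (u k))" for k
    proof -
      note [measurable] = Bm[of k] X_F[OF u0[of k]]
      show ?thesis unfolding \<eta>_def by measurable
    qed
    have \<eta>b: "\<bar>\<eta> k \<omega>\<bar> \<le> 3 * \<kappa> * indicator ?A \<omega>" if w: "\<omega> \<in> space M" for k \<omega>
    proof (cases "\<omega> \<in> B k")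
      case True
      then obtain j where j: "j \<le> k" "\<kappa> < X (u j) \<omega>" "ennreal (u k) < \<tau> \<omega>" "X (u k) \<omega> \<le> 3 / 2 * \<kappa>" by (auto simp: B_def)
      have "ennreal (u j) \<le> \<tau> \<omega>" using um[OF j(1)] j(3) by (intro ennreal_le_mono[of "u j" "u k"]) auto
      then have "\<omega> \<in> ?A" using w j u0 by blast
      moreover have "\<bar>2 * X (u k) \<omega>\<bar> \<le> 3 * \<kappa>" using j X_nonneg[OF w u0[of k]] by simp
      ultimately show ?thesis using True by (simp add: \<eta>_def)
    qed (use \<kappa> in \<open>simp add: \<eta>_def\<close>)
    let ?Y = "step_sum u \<eta> N"
    let ?C = "{\<omega>\<in>space M. (\<kappa>\<^sup>2 / 2)\<^sup>2 \<le> (?Y \<omega>)\<^sup>2}"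
    have C: "?C \<in> events" "prob ?C \<le> (T - 0) * (3 * \<kappa>)\<^sup>2 * prob ?A / (\<kappa>\<^sup>2 / 2)\<^sup>2"
      using step_sum_chebyshev[of 0 T N \<eta> ?A "3 * \<kappa>" "\<kappa>\<^sup>2 / 2"] T \<eta>m \<eta>b A \<kappa> unfolding u_def by auto
    let ?O = "osc_event T (2 * T / real N) (\<kappa> / 10)" and ?R = "approx_event 0 T N (\<kappa>\<^sup>2 / 10)"
    have sub: "?E \<subseteq> ?C \<union> ((space M - ?O) \<union> (space M - ?R))"
    proof
      fix \<omega> assume "\<omega> \<in> ?E"
      then obtain t where w: "\<omega> \<in> space M" and t: "0 \<le> t" "ennreal t \<le> \<tau> \<omega>" "2 * \<kappa> < X t \<omega>"
        and \<tau>T: "\<tau> \<omega> \<le> ennreal T" and X0: "X 0 \<omega> \<le> \<delta> * \<kappa>" by (auto simp: T_def)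
      show "\<omega> \<in> ?C \<union> ((space M - ?O) \<union> (space M - ?R))"
      proof (rule ccontr)
        assume "\<not> ?thesis"
        then have O: "\<omega> \<in> ?O" and R: "\<omega> \<in> ?R" and nC: "\<omega> \<notin> ?C" using w by auto
        have tT: "t \<le> T" using order_trans[OF t(2) \<tau>T] T by (simp add: ennreal_le_iff)
        obtain k where k: "k \<le> N" "u k \<le> t" "t - u k < 2 * T / real N"
          using ugrid_floor[of 0 T N t] T N t(1) tT unfolding u_def by auto
        have "\<bar>X t \<omega> - X (u k) \<omega>\<bar> \<le> \<kappa> / 10"
          using k t(1) tT u0[of k] by (intro osc_eventD[OF O]) auto
        \<comment> \<open>The grid may miss the value above \<open>2 * \<kappa>\<close>; the lower
          target \<open>3 / 2 * \<kappa>\<close> leaves room for an oscillation of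
          \<open>\<kappa> / 10\<close>.\<close>
        then have Xk: "3 / 2 * \<kappa> < X (u k) \<omega>" using t(3) \<kappa> by linarith
        define \<rho> where "\<rho> = (LEAST k. 3 / 2 * \<kappa> < X (u k) \<omega>)"
        have \<rho>1: "3 / 2 * \<kappa> < X (u \<rho>) \<omega>" unfolding \<rho>_def using Xk by (rule LeastI)
        have \<rho>k: "\<rho> \<le> k" unfolding \<rho>_def using Xk by (rule Least_le)
        have \<rho>min: "X (u j) \<omega> \<le> 3 / 2 * \<kappa>" if "j < \<rho>" for j using not_less_Least[OF that[unfolded \<rho>_def]] by simp
        have l1: "\<kappa> < X (u \<rho>) \<omega>" using \<rho>1 \<kappa> by linarith
        define \<sigma> where "\<sigma> = (LEAST k. \<kappa> < X (u k) \<omega>)"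
        have \<sigma>1: "\<kappa> < X (u \<sigma>) \<omega>" unfolding \<sigma>_def using l1 by (rule LeastI)
        have \<sigma>\<rho>: "\<sigma> \<le> \<rho>" unfolding \<sigma>_def using l1 by (rule Least_le)
        have \<sigma>min: "X (u j) \<omega> \<le> \<kappa>" if "j < \<sigma>" for j using not_less_Least[OF that[unfolded \<sigma>_def]] by simp
        \<comment> \<open>The small initial value provides a predecessor of \<open>\<sigma>\<close>,
          so the overshoot over \<open>\<kappa>\<close> is at most one grid increment, that is
          \<open>\<kappa> / 10\<close>.\<close>
        have "X 0 \<omega> \<le> 1 / 2 * \<kappa>" using X0 mult_right_mono[OF d2, of \<kappa>] \<kappa> by linarith
        then have "\<sigma> \<noteq> 0" using \<sigma>1 \<kappa> by (intro notI) (simp add: u_def)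
        then obtain j where j: "\<sigma> = Suc j" by (cases \<sigma>) auto
        have uT: "u i \<le> T" if "i \<le> N" for i unfolding u_def using T that by (intro ugrid_le) auto
        have "u (Suc j) - u j = T / N" unfolding u_def by (simp add: ugrid_Suc_diff)
        moreover have "T / N < 2 * T / N" using T N by (simp add: field_simps)
        ultimately have "\<bar>X (u (Suc j)) \<omega> - X (u j) \<omega>\<bar> \<le> \<kappa> / 10"
          using u0[of j] u0[of "Suc j"] uT[of j] uT[of "Suc j"] j \<sigma>\<rho> \<rho>k k(1) um[of j "Suc j"]
          by (intro osc_eventD[OF O]) auto
        then have X\<sigma>: "X (u \<sigma>) \<omega> \<le> 11 / 10 * \<kappa>" using \<sigma>min[of j] unfolding j by linarith
        have \<rho>N: "\<rho> \<le> N" using \<rho>k k(1) by simp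
        have "\<eta> i \<omega> = (if \<sigma> \<le> i \<and> i < \<rho> then 2 * X (u i) \<omega> else 0)" for i
        proof -
          have "\<omega> \<in> B i \<longleftrightarrow> \<sigma> \<le> i \<and> i < \<rho>"
          proof
            assume "\<omega> \<in> B i"
            then obtain j where "j \<le> i" "\<kappa> < X (u j) \<omega>" and a: "\<forall>j\<le>i. X (u j) \<omega> \<le> 3 / 2 * \<kappa>" by (auto simp: B_def)
            then have "\<sigma> \<le> i" using \<sigma>min[of j] by (cases "j < \<sigma>") auto
            moreover have "i < \<rho>" using a \<rho>1 by (meson not_le)
            ultimately show "\<sigma> \<le> i \<and> i < \<rho>" by simp
          next
            assume i: "\<sigma> \<le> i \<and> i < \<rho>"
            then have "u i < t" using us[of i \<rho>] um[OF \<rho>k] k(2) by auto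
            then have "ennreal (u i) < \<tau> \<omega>" using t(2) u0[of i] by (intro ennreal_less_mono[of "u i" t])
            then show "\<omega> \<in> B i" using w i \<sigma>1 \<rho>min unfolding B_def by auto
          qed
          then show ?thesis by (simp add: \<eta>_def)
        qed
        then have "?Y \<omega> = step_sum u (\<lambda>i \<omega>. 2 * X (u i) \<omega>) \<rho> \<omega> - step_sum u (\<lambda>i \<omega>. 2 * X (u i) \<omega>) \<sigma> \<omega>"
          using \<sigma>\<rho> \<rho>N by (intro step_sum_between) auto
        moreover have "\<bar>(X (u i) \<omega>)\<^sup>2 - (X 0 \<omega>)\<^sup>2 - \<alpha> * (u i - 0) - step_sum u (\<lambda>i \<omega>. 2 * X (u i) \<omega>) i \<omega>\<bar> \<le> \<kappa>\<^sup>2 / 10" if "i \<le> N" for i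
          using R that unfolding approx_event_def u_def by auto
        note this[OF \<rho>N] this[OF order_trans[OF \<sigma>\<rho> \<rho>N]]
        moreover have "9 / 4 * \<kappa>\<^sup>2 \<le> (X (u \<rho>) \<omega>)\<^sup>2"
          using power_mono[of "3 / 2 * \<kappa>" "X (u \<rho>) \<omega>" 2] \<rho>1 \<kappa> by (simp add: power_mult_distrib power_divide)
        moreover have "(X (u \<sigma>) \<omega>)\<^sup>2 \<le> 121 / 100 * \<kappa>\<^sup>2"
          using power_mono[of "X (u \<sigma>) \<omega>" "11 / 10 * \<kappa>" 2] X\<sigma> \<sigma>1 \<kappa> by (simp add: power_mult_distrib power_divide)
        moreover have "\<alpha> * (u \<rho> - 0) \<le> 1 / 4 * \<kappa>\<^sup>2"
        proof -
          have "\<alpha> * (u \<rho> - 0) \<le> \<alpha> * T" using uT[OF \<rho>N] alpha by (intro mult_left_mono) auto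
          also have "\<dots> = (\<alpha> * \<delta>\<^sup>2) * \<kappa>\<^sup>2" by (simp add: T_def)
          also have "\<dots> \<le> 1 / 4 * \<kappa>\<^sup>2" using \<delta> by (intro mult_right_mono) auto
          finally show ?thesis .
        qed
        moreover have "0 \<le> \<alpha> * (u \<sigma> - 0)" using alpha u0[of \<sigma>] by simp
        \<comment> \<open>\<open>9/4 - 121/100 - 1/4 - 2/10\<close> exceeds \<open>1/2\<close>; the
          last term pays for the approximation errors at \<open>\<rho>\<close> and
          \<open>\<sigma>\<close>.\<close>
        ultimately have "\<kappa>\<^sup>2 / 2 \<le> ?Y \<omega>" using zero_le_power2[of \<kappa>] by linarith
        then have "(\<kappa>\<^sup>2 / 2)\<^sup>2 \<le> (?Y \<omega>)\<^sup>2" by (intro power_mono) auto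
        then show False using nC w by auto
      qed
    qed
    have Om: "space M - ?O \<in> events" and Rm: "space M - ?R \<in> events"
      using approx_event_sets[of 0 T] T by auto
    have "prob ?E \<le> prob (?C \<union> ((space M - ?O) \<union> (space M - ?R)))"
      by (rule finite_measure_mono[OF sub]) (intro sets.Un C Om Rm)
    also have "\<dots> \<le> prob ?C + prob ((space M - ?O) \<union> (space M - ?R))"
      by (intro measure_Un_le C sets.Un Om Rm)
    also have "prob ((space M - ?O) \<union> (space M - ?R)) \<le> prob (space M - ?O) + prob (space M - ?R)"
      by (intro measure_Un_le Om Rm)
    finally have "prob ?E \<le> prob ?C + (prob (space M - ?O) + prob (space M - ?R))" by simp
    moreover have "(T - 0) * (3 * \<kappa>)\<^sup>2 * prob ?A / (\<kappa>\<^sup>2 / 2)\<^sup>2 = 36 * \<delta>\<^sup>2 * prob ?A"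
      using \<kappa> by (simp add: T_def power2_eq_square field_simps)
    ultimately show ?thesis using C(2) by linarith
  qed
  have "(\<lambda>N. 36 * \<delta>\<^sup>2 * prob ?A + (prob (space M - osc_event T (2 * T / real N) (\<kappa> / 10)) + prob (space M - approx_event 0 T N (\<kappa>\<^sup>2 / 10)))) \<longlonglongrightarrow> 36 * \<delta>\<^sup>2 * prob ?A + (0 + 0)"
    using \<kappa> T by (intro tendsto_intros osc_event_prob approx_event_prob) auto
  then show ?thesis
    by (intro tendsto_lowerbound[of _ _ sequentially "prob ?E"]) (auto intro!: eventually_mono[OF eventually_gt_at_top[of 0] bound])
qed

text \<open>Over an interval of length \<open>2 * \<kappa>\<^sup>2\<close> the drift of the square
  is at least \<open>2 * \<kappa>\<^sup>2\<close>, since \<open>\<alpha> \<ge> 1\<close>. If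
  \<open>X\<close> stays below \<open>\<delta> * \<kappa>\<close>, the sum must compensate by at
  least \<open>\<kappa>\<^sup>2\<close>, while its coefficients are at most
  \<open>2 * \<delta> * \<kappa>\<close>; this gives \<open>2 * 4 * \<delta>\<^sup>2\<close>.
  \<open>P\<close> will be \<open>ennreal \<kappa> < root_at \<tau> \<omega>\<close>.\<close>

lemma time_good_lambda:
  assumes \<tau>: "ext_stopping_time F \<tau>" and \<kappa>: "0 < \<kappa>" and \<delta>: "0 < \<delta>" "\<delta>\<^sup>2 \<le> 1 / 2"
    and \<delta>u: "\<And>\<omega>. \<omega> \<in> space M \<Longrightarrow> \<tau> \<omega> > ennreal (\<kappa>\<^sup>2) \<Longrightarrow> P \<omega>"
    and Pm: "{\<omega>\<in>space M. P \<omega>} \<in> events"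
  shows "prob {\<omega>\<in>space M. ennreal (3 * \<kappa>\<^sup>2) \<le> \<tau> \<omega> \<and> (\<forall>t\<ge>0. ennreal t \<le> \<tau> \<omega> \<longrightarrow> X t \<omega> \<le> \<delta> * \<kappa>)}
    \<le> 8 * \<delta>\<^sup>2 * prob {\<omega>\<in>space M. P \<omega>}"
    (is "prob ?E \<le> 8 * \<delta>\<^sup>2 * prob ?A")
proof -
  define s T where "s = \<kappa>\<^sup>2" and "T = 3 * \<kappa>\<^sup>2"
  have sT: "0 < s" "s < T" "T - s = 2 * \<kappa>\<^sup>2" using \<kappa> by (auto simp: s_def T_def)
  have bound: "prob ?E \<le> 8 * \<delta>\<^sup>2 * prob ?A + prob (space M - approx_event s T N (\<kappa>\<^sup>2 / 2))"
    if N: "0 < N" for N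
  proof -
    define u where "u = ugrid s T N"
    have u0: "0 \<le> u k" for k unfolding u_def using ugrid_ge[of s T N k] sT by simp
    have um: "u i \<le> u j" if "i \<le> j" for i j unfolding u_def using sT that by (intro ugrid_mono) auto
    have us: "s \<le> u i" for i unfolding u_def using sT by (intro ugrid_ge) auto
    \<comment> \<open>\<open>s < \<tau>\<close> is decided at time \<open>s\<close>, so it can be
      attached to every coefficient. On the event in question \<open>\<tau>\<close> is at least
      \<open>T\<close>, so no later stopping at \<open>\<tau>\<close> is built in.\<close>
    define B where "B k = {\<omega>\<in>space M. ennreal s < \<tau> \<omega> \<and> (\<forall>j\<le>k. X (u j) \<omega> \<le> \<delta> * \<kappa>)}" for k
    define \<eta> where "\<eta> k \<omega> = indicator (B k) \<omega> * (2 * X (u k) \<omega>)" for k \<omega>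
    have Bm: "B k \<in> sets (F (u k))" for k
    proof -
      have sp: "space (F (u k)) = space M" by (rule space_F[OF u0])
      have Xm: "X (u j) \<in> borel_measurable (F (u k))" if "j \<le> k" for j by (rule X_F_le[OF u0 um[OF that]])
      have 2: "{\<omega>\<in>space (F (u k)). \<forall>j\<in>{..k}. X (u j) \<omega> \<le> \<delta> * \<kappa>} \<in> sets (F (u k))"
        by (intro sets.sets_Collect_finite_All) (use Xm in auto)
      have 3: "{\<omega>\<in>space M. ennreal s < \<tau> \<omega>} \<in> sets (F (u k))"
        by (rule stopping_time_less_sets[OF \<tau> _ us]) (use sT in simp)
      have "B k = {\<omega>\<in>space M. ennreal s < \<tau> \<omega>} \<inter> {\<omega>\<in>space (F (u k)). \<forall>j\<in>{..k}. X (u j) \<omega> \<le> \<delta> * \<kappa>}"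
        unfolding B_def sp by auto
      then show ?thesis using 2 3 by auto
    qed
    have \<eta>m: "\<eta> k \<in> borel_measurable (F (u k))" for k
    proof -
      note [measurable] = Bm[of k] X_F[OF u0[of k]]
      show ?thesis unfolding \<eta>_def by measurable
    qed
    have \<eta>b: "\<bar>\<eta> k \<omega>\<bar> \<le> 2 * \<delta> * \<kappa> * indicator ?A \<omega>" if w: "\<omega> \<in> space M" for k \<omega>
    proof (cases "\<omega> \<in> B k")
      case True
      then have j: "ennreal s < \<tau> \<omega>" "X (u k) \<omega> \<le> \<delta> * \<kappa>" by (auto simp: B_def)
      have "\<omega> \<in> ?A" using w \<delta>u j by (auto simp: s_def)
      moreover have "\<bar>2 * X (u k) \<omega>\<bar> \<le> 2 * \<delta> * \<kappa>" using j X_nonneg[OF w u0[of k]] by simp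
      ultimately show ?thesis using True by (simp add: \<eta>_def)
    qed (use \<kappa> \<delta> in \<open>simp add: \<eta>_def\<close>)
    let ?Y = "step_sum u \<eta> N"
    let ?C = "{\<omega>\<in>space M. (\<kappa>\<^sup>2)\<^sup>2 \<le> (?Y \<omega>)\<^sup>2}"
    have C: "?C \<in> events" "prob ?C \<le> (T - s) * (2 * \<delta> * \<kappa>)\<^sup>2 * prob ?A / (\<kappa>\<^sup>2)\<^sup>2"
      using step_sum_chebyshev[of s T N \<eta> ?A "2 * \<delta> * \<kappa>" "\<kappa>\<^sup>2"] sT \<eta>m \<eta>b Pm \<kappa> unfolding u_def by auto
    let ?R = "approx_event s T N (\<kappa>\<^sup>2 / 2)"
    have sub: "?E \<subseteq> ?C \<union> (space M - ?R)"
    proof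
      fix \<omega> assume "\<omega> \<in> ?E"
      then have w: "\<omega> \<in> space M" and \<tau>T: "ennreal T \<le> \<tau> \<omega>"
        and le: "\<And>t. 0 \<le> t \<Longrightarrow> ennreal t \<le> \<tau> \<omega> \<Longrightarrow> X t \<omega> \<le> \<delta> * \<kappa>" by (auto simp: T_def)
      show "\<omega> \<in> ?C \<union> (space M - ?R)"
      proof (rule ccontr)
        assume "\<not> ?thesis"
        then have R: "\<omega> \<in> ?R" and nC: "\<omega> \<notin> ?C" using w by auto
        have uT: "u i \<le> T" if "i \<le> N" for i unfolding u_def using sT that by (intro ugrid_le) auto
        have Xu: "X (u i) \<omega> \<le> \<delta> * \<kappa>" if "i \<le> N" for i
          by (rule le[OF u0 ennreal_le_mono[OF uT[OF that] \<tau>T]])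
        have s\<tau>: "ennreal s < \<tau> \<omega>" using sT \<tau>T by (intro ennreal_less_mono[of s T]) auto
        have "\<eta> i \<omega> = (if 0 \<le> i \<and> i < N then 2 * X (u i) \<omega> else 0)" if "i < N" for i
          using w s\<tau> Xu that by (simp add: \<eta>_def B_def)
        then have "?Y \<omega> = step_sum u (\<lambda>i \<omega>. 2 * X (u i) \<omega>) N \<omega> - step_sum u (\<lambda>i \<omega>. 2 * X (u i) \<omega>) 0 \<omega>"
          by (intro step_sum_between) auto
        moreover have "\<bar>(X (u N) \<omega>)\<^sup>2 - (X s \<omega>)\<^sup>2 - \<alpha> * (u N - s) - step_sum u (\<lambda>i \<omega>. 2 * X (u i) \<omega>) N \<omega>\<bar> \<le> \<kappa>\<^sup>2 / 2"
          using R unfolding approx_event_def u_def by auto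
        moreover have "(X (u N) \<omega>)\<^sup>2 \<le> 1 / 2 * \<kappa>\<^sup>2"
        proof -
          have "(X (u N) \<omega>)\<^sup>2 \<le> (\<delta> * \<kappa>)\<^sup>2" using Xu[of N] X_nonneg[OF w u0] by (intro power_mono) auto
          also have "\<dots> \<le> 1 / 2 * \<kappa>\<^sup>2" unfolding power_mult_distrib using \<delta> by (intro mult_right_mono) auto
          finally show ?thesis .
        qed
        moreover have "1 * (2 * \<kappa>\<^sup>2) \<le> \<alpha> * (u N - s)" 
        proof -
          have "u N = T" using N by (simp add: u_def)
          then show ?thesis unfolding \<open>u N = T\<close> sT(3) using alpha by (intro mult_right_mono) auto
        qed
        ultimately have "\<kappa>\<^sup>2 \<le> \<bar>?Y \<omega>\<bar>" using zero_le_power2[of "X s \<omega>"] zero_le_power2[of \<kappa>] unfolding step_sum_0 by linarith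
        then have "(\<kappa>\<^sup>2)\<^sup>2 \<le> \<bar>?Y \<omega>\<bar>\<^sup>2" by (intro power_mono) auto
        then show False using nC w by auto
      qed
    qed
    have Rm: "space M - ?R \<in> events" using approx_event_sets[of s T] sT by auto
    have "prob ?E \<le> prob (?C \<union> (space M - ?R))"
      by (rule finite_measure_mono[OF sub]) (intro sets.Un C Rm)
    also have "\<dots> \<le> prob ?C + prob (space M - ?R)"
      by (intro measure_Un_le C Rm)
    finally have "prob ?E \<le> prob ?C + prob (space M - ?R)" by simp
    moreover have "(T - s) * (2 * \<delta> * \<kappa>)\<^sup>2 * prob ?A / (\<kappa>\<^sup>2)\<^sup>2 = 8 * \<delta>\<^sup>2 * prob ?A"
      using \<kappa> unfolding sT(3) by (simp add: power2_eq_square field_simps)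
    ultimately show ?thesis using C(2) by linarith
  qed
  have "(\<lambda>N. 8 * \<delta>\<^sup>2 * prob ?A + prob (space M - approx_event s T N (\<kappa>\<^sup>2 / 2))) \<longlonglongrightarrow> 8 * \<delta>\<^sup>2 * prob ?A + 0"
    using \<kappa> sT by (intro tendsto_intros approx_event_prob) auto
  then show ?thesis
    by (intro tendsto_lowerbound[of _ _ sequentially "prob ?E"]) (auto intro!: eventually_mono[OF eventually_gt_at_top[of 0] bound])
qed

end

section \<open>Conditional moments of the increments\<close>

text \<open>A weight known at \<open>s\<close> moves into the coefficients, as
  \<open>g * \<eta>\<close> for the mean and as \<open>sqrt g * \<eta>\<close> for the second
  moment. With \<open>g\<close> arbitrary this is the isometry conditional on
  \<open>F s\<close>.\<close>

lemma (in brownian) weighted_step_sum: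
  assumes sT: "0 \<le> s" "s < T"
    and \<eta>: "\<And>i. i < N \<Longrightarrow> \<eta> i \<in> borel_measurable (F (ugrid s T N i))"
    and bd: "\<And>i \<omega>. i < N \<Longrightarrow> \<omega> \<in> space M \<Longrightarrow> \<bar>\<eta> i \<omega>\<bar> \<le> K"
    and g: "g \<in> borel_measurable (F s)" "\<And>\<omega>. \<omega> \<in> space M \<Longrightarrow> 0 \<le> g \<omega>" "\<And>\<omega>. \<omega> \<in> space M \<Longrightarrow> g \<omega> \<le> G"
  defines "Y \<equiv> step_sum (ugrid s T N) \<eta> N"
  shows "integrable M (\<lambda>\<omega>. g \<omega> * Y \<omega>)" "expectation (\<lambda>\<omega>. g \<omega> * Y \<omega>) = 0"
    "integrable M (\<lambda>\<omega>. g \<omega> * (Y \<omega>)\<^sup>2)"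
    "expectation (\<lambda>\<omega>. g \<omega> * (Y \<omega>)\<^sup>2) = (\<Sum>i<N. (T - s) / N * expectation (\<lambda>\<omega>. g \<omega> * (\<eta> i \<omega>)\<^sup>2))"
    "\<And>i. i < N \<Longrightarrow> integrable M (\<lambda>\<omega>. g \<omega> * (\<eta> i \<omega>)\<^sup>2)"
proof -
  let ?u = "ugrid s T N"
  have u: "0 \<le> ?u 0" "\<And>l. l < N \<Longrightarrow> ?u l \<le> ?u (Suc l)" "\<And>l. 0 \<le> ?u l" "\<And>l. s \<le> ?u l"
    using sT ugrid_Suc_le[of s T N] ugrid_ge[of s T N] by (auto intro: order_trans[OF sT(1)])
  have gm: "g \<in> borel_measurable (F (?u i))" for i by (rule measurable_F_mono[OF sT(1) u(4) g(1)])
  have [measurable]: "g \<in> borel_measurable M" by (rule measurable_F_M[OF sT(1) g(1)])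
  have m1: "(\<lambda>\<omega>. g \<omega> * \<eta> i \<omega>) \<in> borel_measurable (F (?u i))" if "i < N" for i
    using gm \<eta>[OF that] by (rule borel_measurable_times)
  have m2: "(\<lambda>\<omega>. sqrt (g \<omega>) * \<eta> i \<omega>) \<in> borel_measurable (F (?u i))" if "i < N" for i
    using gm \<eta>[OF that] by measurable
  have b1: "\<exists>B. \<forall>\<omega>\<in>space M. \<bar>g \<omega> * \<eta> i \<omega>\<bar> \<le> B" if "i < N" for i
  proof (intro exI[of _ "G * K"] ballI)
    fix \<omega> assume w: "\<omega> \<in> space M"
    have "0 \<le> K" using bd[OF that w] by simp
    then show "\<bar>g \<omega> * \<eta> i \<omega>\<bar> \<le> G * K" unfolding abs_mult
      using bd[OF that w] g(2,3)[OF w] by (intro mult_mono) auto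
  qed
  have b2: "\<exists>B. \<forall>\<omega>\<in>space M. \<bar>sqrt (g \<omega>) * \<eta> i \<omega>\<bar> \<le> B" if "i < N" for i
  proof (intro exI[of _ "sqrt G * K"] ballI)
    fix \<omega> assume w: "\<omega> \<in> space M"
    have "0 \<le> K" using bd[OF that w] by simp
    then show "\<bar>sqrt (g \<omega>) * \<eta> i \<omega>\<bar> \<le> sqrt G * K" unfolding abs_mult
      using bd[OF that w] g(2,3)[OF w] by (intro mult_mono) auto
  qed
  note i1 = step_sum_isometry[of ?u N "\<lambda>i \<omega>. g \<omega> * \<eta> i \<omega>", OF u(1,2) m1 b1]
  note i2 = step_sum_isometry[of ?u N "\<lambda>i \<omega>. sqrt (g \<omega>) * \<eta> i \<omega>", OF u(1,2) m2 b2]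
  have e1: "step_sum ?u (\<lambda>i \<omega>. g \<omega> * \<eta> i \<omega>) N \<omega> = g \<omega> * Y \<omega>" for \<omega>
    unfolding Y_def step_sum_def sum_distrib_left by (intro sum.cong) auto
  have e2: "(step_sum ?u (\<lambda>i \<omega>. sqrt (g \<omega>) * \<eta> i \<omega>) N \<omega>)\<^sup>2 = g \<omega> * (Y \<omega>)\<^sup>2" if w: "\<omega> \<in> space M" for \<omega>
  proof -
    have "step_sum ?u (\<lambda>i \<omega>. sqrt (g \<omega>) * \<eta> i \<omega>) N \<omega> = sqrt (g \<omega>) * Y \<omega>"
      unfolding Y_def step_sum_def sum_distrib_left by (intro sum.cong) auto
    then show ?thesis using g(2)[OF w] by (simp add: power_mult_distrib)
  qed
  have e3: "(sqrt (g \<omega>) * \<eta> i \<omega>)\<^sup>2 = g \<omega> * (\<eta> i \<omega>)\<^sup>2" if w: "\<omega> \<in> space M" for \<omega> i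
    using g(2)[OF w] by (simp add: power_mult_distrib)
  have E1: "step_sum ?u (\<lambda>i \<omega>. g \<omega> * \<eta> i \<omega>) N = (\<lambda>\<omega>. g \<omega> * Y \<omega>)" by (rule ext) (rule e1)
  show "integrable M (\<lambda>\<omega>. g \<omega> * Y \<omega>)" "expectation (\<lambda>\<omega>. g \<omega> * Y \<omega>) = 0"
    using i1 unfolding E1 by auto
  have "integrable M (\<lambda>\<omega>. (step_sum ?u (\<lambda>i \<omega>. sqrt (g \<omega>) * \<eta> i \<omega>) N \<omega>)\<^sup>2)" using i2 by blast
  then show "integrable M (\<lambda>\<omega>. g \<omega> * (Y \<omega>)\<^sup>2)"
    by (rule Bochner_Integration.integrable_cong[THEN iffD1, rotated 2]) (simp_all only: e2)
  have "expectation (\<lambda>\<omega>. g \<omega> * (Y \<omega>)\<^sup>2) = expectation (\<lambda>\<omega>. (step_sum ?u (\<lambda>i \<omega>. sqrt (g \<omega>) * \<eta> i \<omega>) N \<omega>)\<^sup>2)"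
    by (intro Bochner_Integration.integral_cong refl) (simp only: e2)
  also have "\<dots> = (\<Sum>i<N. (T - s) / N * expectation (\<lambda>\<omega>. (sqrt (g \<omega>) * \<eta> i \<omega>)\<^sup>2))"
    using i2 by (simp add: ugrid_Suc_diff)
  also have "\<dots> = (\<Sum>i<N. (T - s) / N * expectation (\<lambda>\<omega>. g \<omega> * (\<eta> i \<omega>)\<^sup>2))"
    by (intro sum.cong refl arg_cong2[where f="(*)"] Bochner_Integration.integral_cong) (simp only: e3)
  finally show "expectation (\<lambda>\<omega>. g \<omega> * (Y \<omega>)\<^sup>2) = (\<Sum>i<N. (T - s) / N * expectation (\<lambda>\<omega>. g \<omega> * (\<eta> i \<omega>)\<^sup>2))" .
  fix i assume i: "i < N"
  have [measurable]: "\<eta> i \<in> borel_measurable M" by (rule measurable_F_M[OF u(3) \<eta>[OF i]])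
  show "integrable M (\<lambda>\<omega>. g \<omega> * (\<eta> i \<omega>)\<^sup>2)"
  proof (rule integrable_const_bound[of _ "G * K\<^sup>2"])
    show "AE \<omega> in M. norm (g \<omega> * (\<eta> i \<omega>)\<^sup>2) \<le> G * K\<^sup>2"
    proof (rule AE_I2)
      fix \<omega> assume w: "\<omega> \<in> space M"
      show "norm (g \<omega> * (\<eta> i \<omega>)\<^sup>2) \<le> G * K\<^sup>2"
        using g(2,3)[OF w] abs_le_imp_square_le[OF bd[OF i w]] by (auto simp: abs_mult intro!: mult_mono)
    qed
  qed measurable
qed

section \<open>Riemann sums stopped at a level, and moments of the square\<close>

context bessel
begin

text \<open>All grids are taken together so that \<open>L\<close> can be fixed before
  \<open>N\<close>; the countable family of times keeps the event measurable.\<close>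

definition range_event :: "real \<Rightarrow> real \<Rightarrow> real \<Rightarrow> 'a set" where
  "range_event s t L = {\<omega>\<in>space M. \<forall>N::nat. \<forall>i\<in>{..N}. X (ugrid s t N i) \<omega> \<le> L}"

lemma range_event_sets:
  assumes "0 \<le> s" "s < t"
  shows "range_event s t L \<in> events"
  unfolding range_event_def
proof (intro sets.sets_Collect_countable_All sets.sets_Collect_finite_All)
  fix N i :: nat
  have "0 \<le> ugrid s t N i" using ugrid_ge[of s t N i] assms by auto
  from X_M[OF this] have [measurable]: "X (ugrid s t N i) \<in> borel_measurable M" .
  show "{\<omega> \<in> space M. X (ugrid s t N i) \<omega> \<le> L} \<in> events" by measurable
qed auto

lemma range_event_prob:
  assumes st: "0 \<le> s" "s < t" and e: "0 < e"
  shows "\<exists>L>0. prob (space M - range_event s t L) \<le> e"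
proof -
  let ?A = "\<lambda>m::nat. space M - range_event s t (real m)"
  have "range_event s t (real m) \<subseteq> range_event s t (real n)" if "m \<le> n" for m n :: nat
    unfolding range_event_def using that by (force intro: order_trans[of _ "real m"])
  then have "decseq ?A" unfolding decseq_def by blast
  then have "(\<lambda>m. prob (?A m)) \<longlonglongrightarrow> prob (\<Inter>m. ?A m)"
    using range_event_sets[OF st] by (intro finite_Lim_measure_decseq) auto
  moreover have "(\<Inter>m. ?A m) = {}"
  proof (rule ccontr)
    assume "(\<Inter>m. ?A m) \<noteq> {}"
    then obtain \<omega> where w: "\<omega> \<in> space M" "\<And>m. \<omega> \<notin> range_event s t (real m)" by auto
    have "continuous_on {s..t} (\<lambda>u. X u \<omega>)" using continuous_on_subset[OF X_cont[OF w(1)]] st by auto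
    then have "compact ((\<lambda>u. X u \<omega>) ` {s..t})" by (intro compact_continuous_image) auto
    then obtain K where K: "\<And>u. u \<in> {s..t} \<Longrightarrow> \<bar>X u \<omega>\<bar> \<le> K"
      using compact_imp_bounded[THEN bounded_iff[THEN iffD1]] by force
    obtain m :: nat where m: "K \<le> real m" using real_arch_simple by auto
    have "X (ugrid s t N i) \<omega> \<le> real m" if "i \<le> N" for N i
      using K[of "ugrid s t N i"] ugrid_ge[of s t N i] ugrid_le[of s t i N] st that m by auto
    then have "\<omega> \<in> range_event s t (real m)" using w(1) by (auto simp: range_event_def)
    then show False using w(2) by blast
  qed
  ultimately have "(\<lambda>m. prob (?A m)) \<longlonglongrightarrow> 0" by (simp only: measure_empty)
  then have "\<forall>\<^sub>F m in sequentially. prob (?A m) < e" using e by (rule order_tendstoD)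
  then have "\<forall>\<^sub>F m in sequentially. prob (?A m) < e \<and> 0 < m" using eventually_gt_at_top[of 0] by eventually_elim auto
  then obtain m where "prob (?A m) < e" "0 < m" by (auto simp: eventually_sequentially)
  then show ?thesis by (intro exI[of _ "real m"]) auto
qed

text \<open>With \<open>c = 1\<close> the stopped sum approximates the increment of \<open>X\<^sup>2 - 2 X\<^sub>s W\<close> instead of that of \<open>X\<^sup>2\<close>.\<close>

definition stopped_coeff :: "real \<Rightarrow> real \<Rightarrow> nat \<Rightarrow> real \<Rightarrow> real \<Rightarrow> nat \<Rightarrow> 'a \<Rightarrow> real" where
  "stopped_coeff s t N L c k \<omega> =
    (if \<forall>j\<in>{..k}. X (ugrid s t N j) \<omega> \<le> L then 2 * (X (ugrid s t N k) \<omega> - c * X s \<omega>) else 0)"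

lemma stopped_coeff_measurable:
  assumes st: "0 \<le> s" "s < t"
  shows "stopped_coeff s t N L c k \<in> borel_measurable (F (ugrid s t N k))"
proof -
  let ?u = "ugrid s t N"
  have u0: "0 \<le> ?u k" for k using ugrid_ge[of s t N k] st by simp
  have um: "?u i \<le> ?u j" if "i \<le> j" for i j using st that by (intro ugrid_mono) auto
  have Xm: "X (?u j) \<in> borel_measurable (F (?u k))" if "j \<le> k" for j by (rule X_F_le[OF u0 um[OF that]])
  have [measurable]: "X (?u k) \<in> borel_measurable (F (?u k))" "X s \<in> borel_measurable (F (?u k))"
    using Xm[of k] Xm[of 0] by auto
  have [measurable]: "Measurable.pred (F (?u k)) (\<lambda>\<omega>. \<forall>j\<in>{..k}. X (?u j) \<omega> \<le> L)"
    by (intro pred_intros_finite) (use Xm in auto)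
  show ?thesis unfolding stopped_coeff_def by measurable
qed

lemma stopped_coeff_bound:
  assumes st: "0 \<le> s" "s < t" and w: "\<omega> \<in> space M" and L: "0 < L" and c: "c \<in> {0, 1}"
  shows "\<bar>stopped_coeff s t N L c k \<omega>\<bar> \<le> 2 * L"
proof -
  have u0: "0 \<le> ugrid s t N k" using ugrid_ge[of s t N k] st by simp
  show ?thesis
  proof (cases "\<forall>j\<in>{..k}. X (ugrid s t N j) \<omega> \<le> L")
    case True
    then have "X (ugrid s t N k) \<omega> \<le> L" "X (ugrid s t N 0) \<omega> \<le> L" by (auto simp del: ugrid_0)
    moreover have "stopped_coeff s t N L c k \<omega> = 2 * (X (ugrid s t N k) \<omega> - c * X s \<omega>)"
      using True by (simp add: stopped_coeff_def)
    moreover have "0 \<le> c * X s \<omega>" "c * X s \<omega> \<le> X s \<omega>" using c X_nonneg[OF w st(1)] by auto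
    moreover have "\<bar>2 * (a - b)\<bar> \<le> 2 * L" if "0 \<le> a" "a \<le> L" "0 \<le> b" "b \<le> L" for a b :: real
      using that by (simp add: abs_le_iff)
    ultimately show ?thesis using X_nonneg[OF w u0] by (metis order_trans ugrid_0)
  next
    case False
    then have "stopped_coeff s t N L c k \<omega> = 0" unfolding stopped_coeff_def by (rule if_not_P)
    then show ?thesis using L by simp
  qed
qed

lemma stopped_sum_range:
  assumes st: "0 \<le> s" "s < t" and N: "0 < N" and w: "\<omega> \<in> range_event s t L"
  shows "step_sum (ugrid s t N) (stopped_coeff s t N L c) N \<omega> =
    riemann_sum s t N N \<omega> - 2 * c * X s \<omega> * (W t \<omega> - W s \<omega>)"
proof -
  let ?u = "ugrid s t N"
  have "step_sum ?u (stopped_coeff s t N L c) N \<omega> = (\<Sum>k<N. 2 * X (?u k) \<omega> * (W (?u (Suc k)) \<omega> - W (?u k) \<omega>) - 2 * c * X s \<omega> * (W (?u (Suc k)) \<omega> - W (?u k) \<omega>))"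
    unfolding step_sum_def
  proof (intro sum.cong refl)
    fix k assume "k \<in> {..<N}"
    then have "stopped_coeff s t N L c k \<omega> = 2 * (X (?u k) \<omega> - c * X s \<omega>)"
      using w by (auto simp: stopped_coeff_def range_event_def)
    then show "stopped_coeff s t N L c k \<omega> * (W (?u (Suc k)) \<omega> - W (?u k) \<omega>) = 2 * X (?u k) \<omega> * (W (?u (Suc k)) \<omega> - W (?u k) \<omega>) - 2 * c * X s \<omega> * (W (?u (Suc k)) \<omega> - W (?u k) \<omega>)"
      by (simp only:) (simp add: algebra_simps)
  qed
  also have "\<dots> = step_sum ?u (\<lambda>i \<omega>. 2 * X (?u i) \<omega>) N \<omega> - 2 * c * X s \<omega> * (\<Sum>k<N. W (?u (Suc k)) \<omega> - W (?u k) \<omega>)"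
    unfolding step_sum_def sum_distrib_left by (rule sum_subtractf)
  also have "(\<Sum>k<N. W (?u (Suc k)) \<omega> - W (?u k) \<omega>) = W t \<omega> - W s \<omega>"
    using N by (simp add: sum_lessThan_telescope[of "\<lambda>k. W (?u k) \<omega>"])
  finally show ?thesis .
qed

text \<open>The stopped sum is the Riemann sum at the first grid time \<open>\<rho>\<close> with
  \<open>X > L\<close>, or at the end. There the approximation holds as well, and the square is
  nonnegative; so the bound does not require \<open>X\<close> to stay below
  \<open>L\<close>.\<close>

lemma stopped_sum_lower:
  assumes st: "0 \<le> s" "s < t" and N: "0 < N" and w: "\<omega> \<in> approx_event s t N \<epsilon>"
  shows "0 \<le> (X s \<omega>)\<^sup>2 + \<alpha> * (t - s) + \<epsilon> + step_sum (ugrid s t N) (stopped_coeff s t N L 0) N \<omega>"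
proof -
  let ?u = "ugrid s t N"
  have wM: "\<omega> \<in> space M" using w by (simp add: approx_event_def)
  define \<rho> where "\<rho> = (if \<exists>k<N. L < X (?u k) \<omega> then LEAST k. L < X (?u k) \<omega> else N)"
  have \<rho>: "\<rho> \<le> N" "\<And>j. j < \<rho> \<Longrightarrow> X (?u j) \<omega> \<le> L" "\<And>k. \<rho> \<le> k \<Longrightarrow> k < N \<Longrightarrow> L < X (?u \<rho>) \<omega>"
  proof -
    consider "\<exists>k<N. L < X (?u k) \<omega>" "\<rho> = (LEAST k. L < X (?u k) \<omega>)" | "\<not> (\<exists>k<N. L < X (?u k) \<omega>)" "\<rho> = N"
      unfolding \<rho>_def by argo
    then have "\<rho> \<le> N \<and> (\<forall>j<\<rho>. X (?u j) \<omega> \<le> L) \<and> (\<forall>k\<ge>\<rho>. k < N \<longrightarrow> L < X (?u \<rho>) \<omega>)"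
    proof cases
      case 1
      then obtain k where k: "k < N" "L < X (?u k) \<omega>" by auto
      show ?thesis using Least_le[of "\<lambda>k. L < X (?u k) \<omega>", OF k(2)] LeastI[of "\<lambda>k. L < X (?u k) \<omega>", OF k(2)] k(1)
          not_less_Least[of _ "\<lambda>k. L < X (?u k) \<omega>"] unfolding 1(2) by (force simp: not_less)
    next
      case 2
      then have "\<forall>k<N. X (?u k) \<omega> \<le> L" by (metis not_le)
      then show ?thesis unfolding 2(2) by simp
    qed
    then show "\<rho> \<le> N" "\<And>j. j < \<rho> \<Longrightarrow> X (?u j) \<omega> \<le> L" "\<And>k. \<rho> \<le> k \<Longrightarrow> k < N \<Longrightarrow> L < X (?u \<rho>) \<omega>" by auto
  qed
  have "stopped_coeff s t N L 0 k \<omega> = (if 0 \<le> k \<and> k < \<rho> then 2 * X (?u k) \<omega> else 0)" if "k < N" for k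
  proof (cases "k < \<rho>")
    case True
    then have "\<forall>j\<in>{..k}. X (?u j) \<omega> \<le> L" using \<rho>(2) by auto
    then have "stopped_coeff s t N L 0 k \<omega> = 2 * (X (?u k) \<omega> - 0 * X s \<omega>)"
      unfolding stopped_coeff_def by (rule if_P)
    then show ?thesis using True by simp
  next
    case False
    then have "\<not> (\<forall>j\<in>{..k}. X (?u j) \<omega> \<le> L)"
      using \<rho>(3)[of k] that by (meson atMost_iff not_le)
    then have "stopped_coeff s t N L 0 k \<omega> = 0" unfolding stopped_coeff_def by (rule if_not_P)
    then show ?thesis using False by simp
  qed
  then have "step_sum ?u (stopped_coeff s t N L 0) N \<omega> = step_sum ?u (\<lambda>i \<omega>. 2 * X (?u i) \<omega>) \<rho> \<omega> - step_sum ?u (\<lambda>i \<omega>. 2 * X (?u i) \<omega>) 0 \<omega>"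
    using \<rho>(1) by (intro step_sum_between) auto
  moreover have "\<bar>(X (?u \<rho>) \<omega>)\<^sup>2 - (X s \<omega>)\<^sup>2 - \<alpha> * (?u \<rho> - s) - step_sum ?u (\<lambda>i \<omega>. 2 * X (?u i) \<omega>) \<rho> \<omega>\<bar> \<le> \<epsilon>"
    using w \<rho>(1) by (auto simp: approx_event_def)
  moreover have "\<alpha> * (?u \<rho> - s) \<le> \<alpha> * (t - s)"
    using ugrid_le[of s t \<rho> N] st \<rho>(1) alpha by (intro mult_left_mono) auto
  ultimately show ?thesis using zero_le_power2[of "X (?u \<rho>) \<omega>"] unfolding step_sum_0 by linarith
qed

lemma nn_integral_ennreal_le:
  assumes "\<And>\<omega>. \<omega> \<in> space M \<Longrightarrow> f \<omega> \<le> ennreal (h \<omega>)" "integrable M h" "\<And>\<omega>. \<omega> \<in> space M \<Longrightarrow> 0 \<le> h \<omega>" "expectation h \<le> c"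
  shows "(\<integral>\<^sup>+\<omega>. f \<omega> \<partial>M) \<le> ennreal c"
proof -
  have "(\<integral>\<^sup>+\<omega>. f \<omega> \<partial>M) \<le> (\<integral>\<^sup>+\<omega>. ennreal (h \<omega>) \<partial>M)" using assms(1) by (rule nn_integral_mono)
  also have "\<dots> = ennreal (expectation h)" using assms(2,3) by (intro nn_integral_eq_integral AE_I2)
  also have "\<dots> \<le> ennreal c" using assms(4) by (rule ennreal_leI)
  finally show ?thesis .
qed

lemma eventually_small_prob_ex:
  assumes "(\<lambda>N. prob (A N)) \<longlonglongrightarrow> 0" "0 < e"
  shows "\<exists>N>0. prob (A N) \<le> e"
proof -
  have "\<forall>\<^sub>F N in sequentially. prob (A N) < e" using assms by (rule order_tendstoD)
  then have "\<forall>\<^sub>F N in sequentially. prob (A N) < e \<and> 0 < N" using eventually_gt_at_top[of 0] by eventually_elim auto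
  then obtain N where "prob (A N) < e" "0 < N" by (auto simp: eventually_sequentially)
  then show ?thesis by (intro exI[of _ N]) auto
qed

text \<open>Off the approximation event the stopped sum \<open>Y\<close> is only bounded below by
  \<open>- \<theta> Y\<^sup>2 - 1 / (4 \<theta>)\<close>, which is harmless since \<open>Y\<close> is bounded in \<open>L\<^sup>2\<close>.\<close>

lemma square_moment_le:
  assumes st: "0 \<le> s" "s \<le> t"
    and g: "g \<in> borel_measurable (F s)" "\<And>\<omega>. \<omega> \<in> space M \<Longrightarrow> 0 \<le> g \<omega>" "\<And>\<omega>. \<omega> \<in> space M \<Longrightarrow> g \<omega> \<le> G"
      "\<And>\<omega>. \<omega> \<in> space M \<Longrightarrow> g \<omega> * (X s \<omega>)\<^sup>2 \<le> G"
  shows "(\<integral>\<^sup>+\<omega>. ennreal (g \<omega> * (X t \<omega>)\<^sup>2) \<partial>M) \<le> ennreal (expectation (\<lambda>\<omega>. g \<omega> * ((X s \<omega>)\<^sup>2 + \<alpha> * (t - s))))"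
proof -
  have gM[measurable]: "g \<in> borel_measurable M" by (rule measurable_F_M[OF st(1) g(1)])
  have Xs[measurable]: "X s \<in> borel_measurable M" and Xt[measurable]: "X t \<in> borel_measurable M" using X_M st by auto
  obtain \<omega>0 where w0: "\<omega>0 \<in> space M" using not_empty by auto
  have G: "0 \<le> G" using g(2,3)[OF w0] by simp
  have gi: "integrable M g" using g(2,3) by (intro integrable_const_bound[of _ G] AE_I2) auto
  have gZi: "integrable M (\<lambda>\<omega>. g \<omega> * (X s \<omega>)\<^sup>2)" using g(2,4) by (intro integrable_const_bound[of _ G] AE_I2) auto
  have ei: "integrable M (\<lambda>\<omega>. g \<omega> * ((X s \<omega>)\<^sup>2 + \<alpha> * (t - s)))"
    unfolding distrib_left by (intro Bochner_Integration.integrable_add gZi integrable_mult_left gi)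
  let ?C = "expectation (\<lambda>\<omega>. g \<omega> * ((X s \<omega>)\<^sup>2 + \<alpha> * (t - s)))"
  have C0: "0 \<le> ?C" using g(2) alpha st by (intro integral_nonneg_AE AE_I2 mult_nonneg_nonneg add_nonneg_nonneg) auto
  show ?thesis
  proof (cases "s = t")
    case True
    then show ?thesis using gZi g(2) by (intro nn_integral_ennreal_le) auto
  next
    case False
    then have st': "0 \<le> s" "s < t" using st by auto
    define h where "h = t - s"
    have h: "0 < h" using st' by (simp add: h_def)
    show ?thesis
    proof (rule nn_integral_le_of_high_prob)
      show "(\<lambda>\<omega>. ennreal (g \<omega> * (X t \<omega>)\<^sup>2)) \<in> borel_measurable M" by measurable
      show "0 \<le> ?C" by (rule C0)
      fix e :: real assume e: "0 < e"
      obtain L where L: "0 < L" and pL: "prob (space M - range_event s t L) \<le> e / 2"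
        using range_event_prob[OF st', of "e / 2"] e by auto
      define D where "D = 4 * L\<^sup>2 * h * G"
      have D: "0 \<le> D" using G h by (simp add: D_def)
      define \<theta> where "\<theta> = e / (4 * (D + 1))"
      have \<theta>: "0 < \<theta>" "\<theta> * (4 * L\<^sup>2 * h * G) \<le> e / 4"
      proof -
        show "0 < \<theta>" using e D by (simp add: \<theta>_def)
        then have "\<theta> * D \<le> \<theta> * (D + 1)" by (intro mult_left_mono) auto
        also have "\<dots> = e / 4" using D by (simp add: \<theta>_def divide_simps)
        finally show "\<theta> * (4 * L\<^sup>2 * h * G) \<le> e / 4" by (simp only: D_def)
      qed
      define \<epsilon> where "\<epsilon> = e / (4 * (G + 1))"
      have \<epsilon>: "0 < \<epsilon>" "\<epsilon> * G \<le> e / 4"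
      proof -
        show "0 < \<epsilon>" using e G by (simp add: \<epsilon>_def)
        then have "\<epsilon> * G \<le> \<epsilon> * (G + 1)" by (intro mult_left_mono) auto
        also have "\<dots> = e / 4" using G by (simp add: \<epsilon>_def divide_simps)
        finally show "\<epsilon> * G \<le> e / 4" .
      qed
      define d where "d = min (e / 2) (\<theta> * e / (G + 1))"
      have d: "0 < d" "d \<le> e / 2" "1 / (4 * \<theta>) * (G * d) \<le> e / 4"
      proof -
        show "0 < d" using e \<theta>(1) G by (simp add: d_def)
        show "d \<le> e / 2" unfolding d_def by (rule min.cobounded1)
        have "G * d \<le> (G + 1) * d" using \<open>0 < d\<close> by (intro mult_right_mono) auto
        also have "\<dots> \<le> (G + 1) * (\<theta> * e / (G + 1))" using G unfolding d_def by (intro mult_left_mono min.cobounded2) auto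
        also have "\<dots> = \<theta> * e" using G by simp
        finally have "1 / (4 * \<theta>) * (G * d) \<le> 1 / (4 * \<theta>) * (\<theta> * e)" using \<theta> by (intro mult_left_mono) auto
        also have "\<dots> = e / 4" using \<theta> by simp
        finally show "1 / (4 * \<theta>) * (G * d) \<le> e / 4" .
      qed
      obtain N where N: "0 < N" and pN: "prob (space M - approx_event s t N \<epsilon>) \<le> d"
        using eventually_small_prob_ex[OF approx_event_prob[OF st' \<epsilon>(1)] d(1)] by auto
      let ?D = "range_event s t L" and ?R = "approx_event s t N \<epsilon>"
      have Dm: "?D \<in> events" and Rm: "?R \<in> events" using range_event_sets[OF st'] approx_event_sets[OF st'] by auto
      define Y where "Y = step_sum (ugrid s t N) (stopped_coeff s t N L 0) N"
      note wt = weighted_step_sum[OF st', of N "stopped_coeff s t N L 0" "2 * L" g G, OF stopped_coeff_measurable[OF st'] stopped_coeff_bound[OF st' _ L] g(1,2,3), simplified, folded Y_def]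
      have EY2: "expectation (\<lambda>\<omega>. g \<omega> * (Y \<omega>)\<^sup>2) \<le> 4 * L\<^sup>2 * h * G"
      proof -
        have "expectation (\<lambda>\<omega>. g \<omega> * (stopped_coeff s t N L 0 i \<omega>)\<^sup>2) \<le> G * (2 * L)\<^sup>2" if "i < N" for i
        proof (rule integral_le_const[OF wt(5)[OF that] AE_I2])
          fix \<omega> assume w: "\<omega> \<in> space M"
          show "g \<omega> * (stopped_coeff s t N L 0 i \<omega>)\<^sup>2 \<le> G * (2 * L)\<^sup>2"
            using g(2,3)[OF w] G abs_le_imp_square_le[OF stopped_coeff_bound[OF st' w L, of 0 N i]] by (intro mult_mono) auto
        qed
        then have "(\<Sum>i<N. (t - s) / N * expectation (\<lambda>\<omega>. g \<omega> * (stopped_coeff s t N L 0 i \<omega>)\<^sup>2)) \<le> (\<Sum>i<N. (t - s) / N * (G * (2 * L)\<^sup>2))"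
          using st' by (intro sum_mono mult_left_mono) auto
        also have "\<dots> = 4 * L\<^sup>2 * h * G" using N by (simp add: h_def power_mult_distrib)
        finally show ?thesis using wt(4) by simp
      qed
      \<comment> \<open>A nonnegative integrable majorant whose mean exceeds the target by at most
        \<open>e\<close>: the term linear in \<open>Y\<close> has mean zero, and each of the other
        three additions has mean at most \<open>e / 4\<close>.\<close>
      define rhs where "rhs \<omega> = g \<omega> * ((X s \<omega>)\<^sup>2 + \<alpha> * (t - s)) + \<epsilon> * g \<omega> + g \<omega> * Y \<omega> + \<theta> * (g \<omega> * (Y \<omega>)\<^sup>2) + 1 / (4 * \<theta>) * (g \<omega> * indicator (space M - ?R) \<omega>)" for \<omega>
      have gRi: "integrable M (\<lambda>\<omega>. g \<omega> * indicator (space M - ?R) \<omega>)"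
        using Rm gi by (intro integrable_real_mult_indicator) auto
      have rhsi: "integrable M rhs" unfolding rhs_def
        by (intro Bochner_Integration.integrable_add ei integrable_mult_right wt(1) wt(3) gi gRi)
      have rhsE: "expectation rhs \<le> ?C + e"
      proof -
        have "expectation rhs = ?C + \<epsilon> * expectation g + expectation (\<lambda>\<omega>. g \<omega> * Y \<omega>) + \<theta> * expectation (\<lambda>\<omega>. g \<omega> * (Y \<omega>)\<^sup>2) + 1 / (4 * \<theta>) * expectation (\<lambda>\<omega>. g \<omega> * indicator (space M - ?R) \<omega>)"
          unfolding rhs_def by (simp only: Bochner_Integration.integral_add ei integrable_mult_right wt(1) wt(3) gi gRi Bochner_Integration.integrable_add integral_mult_right_zero)
        moreover have "\<epsilon> * expectation g \<le> e / 4"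
        proof -
          have "expectation g \<le> G" using gi g(3) by (intro integral_le_const AE_I2) auto
          then have "\<epsilon> * expectation g \<le> \<epsilon> * G" using \<epsilon> by (intro mult_left_mono) auto
          then show ?thesis using \<epsilon>(2) by linarith
        qed
        moreover have "\<theta> * expectation (\<lambda>\<omega>. g \<omega> * (Y \<omega>)\<^sup>2) \<le> e / 4"
          using order_trans[OF mult_left_mono[OF EY2, of \<theta>] \<theta>(2)] \<theta>(1) by simp
        moreover have "1 / (4 * \<theta>) * expectation (\<lambda>\<omega>. g \<omega> * indicator (space M - ?R) \<omega>) \<le> e / 4"
        proof -
          have "expectation (\<lambda>\<omega>. g \<omega> * indicator (space M - ?R) \<omega>) \<le> expectation (\<lambda>\<omega>. G * indicator (space M - ?R) \<omega>)"
            using Rm gRi g(3) G by (intro integral_mono integrable_mult_right integrable_real_indicator) (auto simp: indicator_def emeasure_eq_measure)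
          also have "\<dots> = G * prob (space M - ?R)" using Rm by simp
          also have "\<dots> \<le> G * d" using pN G by (intro mult_left_mono) auto
          finally have "1 / (4 * \<theta>) * expectation (\<lambda>\<omega>. g \<omega> * indicator (space M - ?R) \<omega>) \<le> 1 / (4 * \<theta>) * (G * d)"
            using \<theta> by (intro mult_left_mono) auto
          then show ?thesis using d(3) by linarith
        qed
        ultimately show ?thesis using wt(2) e by linarith
      qed
      have pw: "ennreal (g \<omega> * (X t \<omega>)\<^sup>2) * indicator (?D \<inter> ?R) \<omega> \<le> ennreal (rhs \<omega>) \<and> 0 \<le> rhs \<omega>" if w: "\<omega> \<in> space M" for \<omega>
      proof (cases "\<omega> \<in> ?R")
        case True
        have r: "rhs \<omega> = g \<omega> * ((X s \<omega>)\<^sup>2 + \<alpha> * (t - s) + \<epsilon> + Y \<omega> + \<theta> * (Y \<omega>)\<^sup>2)"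
          using True by (simp add: rhs_def algebra_simps)
        have "0 \<le> (X s \<omega>)\<^sup>2 + \<alpha> * (t - s) + \<epsilon> + Y \<omega>"
          unfolding Y_def by (rule stopped_sum_lower[OF st' N True])
        moreover have "0 \<le> \<theta> * (Y \<omega>)\<^sup>2" using \<theta>(1) by simp
        ultimately have nn: "0 \<le> rhs \<omega>" unfolding r
          by (rule mult_nonneg_nonneg[OF g(2)[OF w] add_nonneg_nonneg])
        have "g \<omega> * (X t \<omega>)\<^sup>2 \<le> rhs \<omega>" if D: "\<omega> \<in> ?D"
        proof -
          have "Y \<omega> = riemann_sum s t N N \<omega>"
            unfolding Y_def using stopped_sum_range[OF st' N D, of 0] by simp
          moreover have "\<bar>(X t \<omega>)\<^sup>2 - (X s \<omega>)\<^sup>2 - \<alpha> * (t - s) - riemann_sum s t N N \<omega>\<bar> \<le> \<epsilon>"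
            using True N by (auto simp: approx_event_def dest!: spec[of _ N])
          ultimately have "(X t \<omega>)\<^sup>2 \<le> (X s \<omega>)\<^sup>2 + \<alpha> * (t - s) + \<epsilon> + Y \<omega>" by linarith
          moreover have "0 \<le> \<theta> * (Y \<omega>)\<^sup>2" using \<theta> by simp
          ultimately show ?thesis unfolding r using g(2)[OF w] by (intro mult_left_mono) linarith+
        qed
        then show ?thesis using nn True by (auto simp: indicator_def ennreal_leI)
      next
        case False
        have "0 \<le> \<theta> * (Y \<omega> + 1 / (2 * \<theta>))\<^sup>2" using \<theta> by simp
        also have "\<dots> = Y \<omega> + \<theta> * (Y \<omega>)\<^sup>2 + 1 / (4 * \<theta>)" using \<theta> by (simp add: power2_eq_square field_simps)
        finally have q: "0 \<le> Y \<omega> + \<theta> * (Y \<omega>)\<^sup>2 + 1 / (4 * \<theta>)" .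
        have r: "rhs \<omega> = g \<omega> * ((X s \<omega>)\<^sup>2 + \<alpha> * (t - s) + \<epsilon> + (Y \<omega> + \<theta> * (Y \<omega>)\<^sup>2 + 1 / (4 * \<theta>)))"
          using False w by (simp add: rhs_def algebra_simps)
        have "0 \<le> \<alpha> * (t - s)" using alpha st' by simp
        then have "0 \<le> rhs \<omega>" unfolding r using \<epsilon>(1)
          by (intro mult_nonneg_nonneg[OF g(2)[OF w]] add_nonneg_nonneg[OF _ q]) auto
        then show ?thesis using False by simp
      qed
      have "prob (space M - (?D \<inter> ?R)) \<le> prob (space M - ?D) + prob (space M - ?R)"
        unfolding Diff_Int using Dm Rm by (intro measure_Un_le) auto
      then have "prob (space M - (?D \<inter> ?R)) \<le> e" using pL pN d by linarith
      moreover have "(\<integral>\<^sup>+\<omega>. ennreal (g \<omega> * (X t \<omega>)\<^sup>2) * indicator (?D \<inter> ?R) \<omega> \<partial>M) \<le> ennreal (?C + e)"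
        by (rule nn_integral_ennreal_le[OF _ rhsi _ rhsE]) (use pw in auto)
      ultimately show "\<exists>G\<in>events. prob (space M - G) \<le> e \<and> (\<integral>\<^sup>+\<omega>. ennreal (g \<omega> * (X t \<omega>)\<^sup>2) * indicator G \<omega> \<partial>M) \<le> ennreal (?C + e)"
        using Dm Rm by (intro bexI[of _ "?D \<inter> ?R"]) auto
    qed auto
  qed
qed

text \<open>With high probability the integrand is close to the stopped sum \<open>Y\<close>, whose
  coefficients are at most \<open>2 * \<bar>X u - c * X s\<bar>\<close>, so the isometry gives
  \<open>4 * (t - s) * C\<close>; separating the approximation error doubles it.
  \<open>c = 0\<close> concerns the martingale part of the square itself, \<open>c = 1\<close> its
  deviation from \<open>2 * X s * (W t - W s)\<close>.\<close>

lemma square_increment_moment: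
  assumes st: "0 \<le> s" "s < t" and c: "c \<in> {0, 1}"
    and g: "g \<in> borel_measurable (F s)" "\<And>\<omega>. \<omega> \<in> space M \<Longrightarrow> 0 \<le> g \<omega>" "\<And>\<omega>. \<omega> \<in> space M \<Longrightarrow> g \<omega> \<le> G"
    and C: "0 \<le> C" "\<And>u. s \<le> u \<Longrightarrow> u \<le> t \<Longrightarrow> (\<integral>\<^sup>+\<omega>. ennreal (g \<omega> * (X u \<omega> - c * X s \<omega>)\<^sup>2) \<partial>M) \<le> ennreal C"
  shows "(\<integral>\<^sup>+\<omega>. ennreal (g \<omega> * ((X t \<omega>)\<^sup>2 - (X s \<omega>)\<^sup>2 - \<alpha> * (t - s) - 2 * c * X s \<omega> * (W t \<omega> - W s \<omega>))\<^sup>2) \<partial>M)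
    \<le> ennreal (8 * (t - s) * C)"
    (is "(\<integral>\<^sup>+\<omega>. ennreal (g \<omega> * (?V \<omega>)\<^sup>2) \<partial>M) \<le> _")
proof (rule nn_integral_le_of_high_prob)
  have gM[measurable]: "g \<in> borel_measurable M" by (rule measurable_F_M[OF st(1) g(1)])
  have [measurable]: "X s \<in> borel_measurable M" "X t \<in> borel_measurable M" "W s \<in> borel_measurable M" "W t \<in> borel_measurable M" 
    using X_M W_M st by auto
  obtain \<omega>0 where w0: "\<omega>0 \<in> space M" using not_empty by auto
  have G: "0 \<le> G" using g(2,3)[OF w0] by simp
  have gi: "integrable M g" using g(2,3) by (intro integrable_const_bound[of _ G] AE_I2) auto
  show "(\<lambda>\<omega>. ennreal (g \<omega> * (?V \<omega>)\<^sup>2)) \<in> borel_measurable M" by measurable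
  show "0 \<le> 8 * (t - s) * C" using C st by simp
  fix e :: real assume e: "0 < e"
  obtain L where L: "0 < L" and pL: "prob (space M - range_event s t L) \<le> e / 2"
    using range_event_prob[OF st, of "e / 2"] e by auto
  define \<epsilon> where "\<epsilon> = sqrt (e / (2 * (G + 1)))"
  have \<epsilon>: "0 < \<epsilon>" "2 * \<epsilon>\<^sup>2 * G \<le> e"
  proof -
    show "0 < \<epsilon>" using e G by (simp add: \<epsilon>_def)
    have "2 * \<epsilon>\<^sup>2 * G \<le> 2 * \<epsilon>\<^sup>2 * (G + 1)" by (intro mult_left_mono) auto
    also have "\<dots> = e" using G e by (simp add: \<epsilon>_def divide_simps)
    finally show "2 * \<epsilon>\<^sup>2 * G \<le> e" .
  qed
  obtain N where N: "0 < N" and pN: "prob (space M - approx_event s t N \<epsilon>) \<le> e / 2"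
    using eventually_small_prob_ex[OF approx_event_prob[OF st \<epsilon>(1)], of "e / 2"] e by auto
  let ?D = "range_event s t L" and ?R = "approx_event s t N \<epsilon>"
  have Dm: "?D \<in> events" and Rm: "?R \<in> events" using range_event_sets[OF st] approx_event_sets[OF st] by auto
  define Y where "Y = step_sum (ugrid s t N) (stopped_coeff s t N L c) N"
  note wt = weighted_step_sum[OF st, of N "stopped_coeff s t N L c" "2 * L" g G, OF stopped_coeff_measurable[OF st] stopped_coeff_bound[OF st _ L c] g(1,2,3), simplified, folded Y_def]
  have EY2: "expectation (\<lambda>\<omega>. g \<omega> * (Y \<omega>)\<^sup>2) \<le> 4 * (t - s) * C"
  proof -
    have "expectation (\<lambda>\<omega>. g \<omega> * (stopped_coeff s t N L c i \<omega>)\<^sup>2) \<le> 4 * C" if i: "i < N" for i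
    proof -
      let ?v = "ugrid s t N i"
      have u0: "0 \<le> ?v" using ugrid_ge[of s t N i] st by simp
      have [measurable]: "X ?v \<in> borel_measurable M" by (rule X_M[OF u0])
      have "ennreal (expectation (\<lambda>\<omega>. g \<omega> * (stopped_coeff s t N L c i \<omega>)\<^sup>2)) = (\<integral>\<^sup>+\<omega>. ennreal (g \<omega> * (stopped_coeff s t N L c i \<omega>)\<^sup>2) \<partial>M)"
        using wt(5)[OF i] g(2) by (intro nn_integral_eq_integral[symmetric] AE_I2) auto
      also have "\<dots> \<le> (\<integral>\<^sup>+\<omega>. ennreal 4 * ennreal (g \<omega> * (X ?v \<omega> - c * X s \<omega>)\<^sup>2) \<partial>M)"
      proof (rule nn_integral_mono)
        fix \<omega> assume w: "\<omega> \<in> space M"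
        have "g \<omega> * (stopped_coeff s t N L c i \<omega>)\<^sup>2 \<le> 4 * (g \<omega> * (X ?v \<omega> - c * X s \<omega>)\<^sup>2)"
          using g(2)[OF w] unfolding stopped_coeff_def by (simp only: power_mult_distrib split: if_split) simp
        then show "ennreal (g \<omega> * (stopped_coeff s t N L c i \<omega>)\<^sup>2) \<le> ennreal 4 * ennreal (g \<omega> * (X ?v \<omega> - c * X s \<omega>)\<^sup>2)"
          using g(2)[OF w] by (subst ennreal_mult[symmetric]) (auto intro: ennreal_leI)
      qed
      also have "\<dots> = ennreal 4 * (\<integral>\<^sup>+\<omega>. ennreal (g \<omega> * (X ?v \<omega> - c * X s \<omega>)\<^sup>2) \<partial>M)"
        by (rule nn_integral_cmult) measurable
      also have "\<dots> \<le> ennreal 4 * ennreal C"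
        using C(2)[of ?v] ugrid_ge[of s t N i] ugrid_le[of s t i N] st i by (intro mult_left_mono) auto
      also have "\<dots> = ennreal (4 * C)" using C(1) by (subst ennreal_mult[symmetric]) auto
      finally show ?thesis using C(1) by simp
    qed
    then have "(\<Sum>i<N. (t - s) / N * expectation (\<lambda>\<omega>. g \<omega> * (stopped_coeff s t N L c i \<omega>)\<^sup>2)) \<le> (\<Sum>i<N. (t - s) / N * (4 * C))"
      using st by (intro sum_mono mult_left_mono) auto
    also have "\<dots> = 4 * (t - s) * C" using N by simp
    finally show ?thesis using wt(4) by simp
  qed
  define rhs where "rhs \<omega> = 2 * (g \<omega> * (Y \<omega>)\<^sup>2) + 2 * \<epsilon>\<^sup>2 * g \<omega>" for \<omega>
  have rhsi: "integrable M rhs" unfolding rhs_def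
    by (intro Bochner_Integration.integrable_add integrable_mult_right wt(3) gi)
  have rhsE: "expectation rhs \<le> 8 * (t - s) * C + e"
  proof -
    have "expectation rhs = 2 * expectation (\<lambda>\<omega>. g \<omega> * (Y \<omega>)\<^sup>2) + 2 * \<epsilon>\<^sup>2 * expectation g"
      unfolding rhs_def by (simp only: Bochner_Integration.integral_add integrable_mult_right wt(3) gi integral_mult_right_zero)
    moreover have "2 * \<epsilon>\<^sup>2 * expectation g \<le> e"
    proof -
      have "expectation g \<le> G" using gi g(3) by (intro integral_le_const AE_I2) auto
      then have "2 * \<epsilon>\<^sup>2 * expectation g \<le> 2 * \<epsilon>\<^sup>2 * G" by (intro mult_left_mono) auto
      then show ?thesis using \<epsilon>(2) by linarith
    qed
    ultimately show ?thesis using EY2 by linarith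
  qed
  have rhs0: "0 \<le> rhs \<omega>" if "\<omega> \<in> space M" for \<omega> using g(2)[OF that] by (simp add: rhs_def)
  have pw: "ennreal (g \<omega> * (?V \<omega>)\<^sup>2) * indicator (?D \<inter> ?R) \<omega> \<le> ennreal (rhs \<omega>)" if w: "\<omega> \<in> space M" for \<omega>
  proof (cases "\<omega> \<in> ?D \<inter> ?R")
    case True
    have "Y \<omega> = riemann_sum s t N N \<omega> - 2 * c * X s \<omega> * (W t \<omega> - W s \<omega>)"
      unfolding Y_def using stopped_sum_range[OF st N, of \<omega> L c] True by simp
    moreover have "\<bar>(X t \<omega>)\<^sup>2 - (X s \<omega>)\<^sup>2 - \<alpha> * (t - s) - riemann_sum s t N N \<omega>\<bar> \<le> \<epsilon>"
      using True N by (auto simp: approx_event_def dest!: spec[of _ N])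
    ultimately have "\<bar>?V \<omega> - Y \<omega>\<bar> \<le> \<epsilon>" by simp
    then have 1: "(?V \<omega> - Y \<omega>)\<^sup>2 \<le> \<epsilon>\<^sup>2" by (rule abs_le_imp_square_le)
    have 2: "(a + b)\<^sup>2 \<le> 2 * a\<^sup>2 + 2 * b\<^sup>2" for a b :: real
      using zero_le_power2[of "a - b"] by (simp add: power2_eq_square algebra_simps)
    have "(?V \<omega>)\<^sup>2 \<le> 2 * (Y \<omega>)\<^sup>2 + 2 * \<epsilon>\<^sup>2" using 2[of "?V \<omega> - Y \<omega>" "Y \<omega>"] 1 by simp
    then have "g \<omega> * (?V \<omega>)\<^sup>2 \<le> g \<omega> * (2 * (Y \<omega>)\<^sup>2 + 2 * \<epsilon>\<^sup>2)" using g(2)[OF w] by (rule mult_left_mono)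
    then show ?thesis using True by (simp add: rhs_def ennreal_leI algebra_simps)
  qed simp
  have "prob (space M - (?D \<inter> ?R)) \<le> prob (space M - ?D) + prob (space M - ?R)"
    unfolding Diff_Int using Dm Rm by (intro measure_Un_le) auto
  then have "prob (space M - (?D \<inter> ?R)) \<le> e" using pL pN by linarith
  moreover have "(\<integral>\<^sup>+\<omega>. ennreal (g \<omega> * (?V \<omega>)\<^sup>2) * indicator (?D \<inter> ?R) \<omega> \<partial>M) \<le> ennreal (8 * (t - s) * C + e)"
    by (rule nn_integral_ennreal_le[OF pw rhsi rhs0 rhsE])
  ultimately show "\<exists>G\<in>events. prob (space M - G) \<le> e \<and> (\<integral>\<^sup>+\<omega>. ennreal (g \<omega> * (?V \<omega>)\<^sup>2) * indicator G \<omega> \<partial>M) \<le> ennreal (8 * (t - s) * C + e)"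
    using Dm Rm by (intro bexI[of _ "?D \<inter> ?R"]) auto
qed auto

end

text \<open>For \<open>x\<^sup>2 \<ge> h\<close> divide \<open>y\<^sup>2 - x\<^sup>2\<close> by
  \<open>y + x\<close>; for \<open>x\<^sup>2 < h\<close> use
  \<open>(y - x)\<^sup>2 \<le> \<bar>y\<^sup>2 - x\<^sup>2\<bar>\<close> and Young's inequality. The
  weight \<open>1 / (x\<^sup>2 + h)\<close> fits the square, whose increment over time
  \<open>h\<close> has variance of order \<open>h * (x\<^sup>2 + h)\<close>.\<close>

lemma sqrt_increment_bound:
  fixes x y h :: real
  assumes "0 \<le> x" "0 \<le> y" "0 < h"
  shows "(y - x)\<^sup>2 \<le> 2 * (y\<^sup>2 - x\<^sup>2)\<^sup>2 / (x\<^sup>2 + h) + h"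
proof -
  have f: "y\<^sup>2 - x\<^sup>2 = (y - x) * (y + x)" by (simp add: power2_eq_square algebra_simps)
  have pos: "0 < x\<^sup>2 + h" using assms by (simp add: add_nonneg_pos)
  show ?thesis
  proof (cases "h \<le> x\<^sup>2")
    case True
    have "(y - x)\<^sup>2 * (x\<^sup>2 + h) \<le> (y - x)\<^sup>2 * (2 * (y + x)\<^sup>2)"
    proof (rule mult_left_mono)
      have "x\<^sup>2 \<le> (y + x)\<^sup>2" using assms by (intro power_mono) auto
      then show "x\<^sup>2 + h \<le> 2 * (y + x)\<^sup>2" using True by linarith
    qed simp
    also have "\<dots> = 2 * (y\<^sup>2 - x\<^sup>2)\<^sup>2" unfolding f by (simp add: power_mult_distrib)
    finally have "(y - x)\<^sup>2 \<le> 2 * (y\<^sup>2 - x\<^sup>2)\<^sup>2 / (x\<^sup>2 + h)" using pos by (simp add: field_simps)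
    then show ?thesis using assms by simp
  next
    case False
    have "\<bar>y - x\<bar> \<le> y + x" using assms by auto
    then have "\<bar>y - x\<bar> * \<bar>y - x\<bar> \<le> \<bar>y - x\<bar> * (y + x)" by (rule mult_left_mono) simp
    also have "\<dots> = \<bar>y\<^sup>2 - x\<^sup>2\<bar>" unfolding f abs_mult using assms by simp
    finally have "(y - x)\<^sup>2 \<le> \<bar>y\<^sup>2 - x\<^sup>2\<bar>" by (simp add: power2_eq_square)
    moreover have "\<bar>b\<bar> \<le> b\<^sup>2 / (2 * h) + h / 2" for b :: real
    proof -
      have "0 \<le> (\<bar>b\<bar> - h)\<^sup>2" by simp
      then have "2 * h * \<bar>b\<bar> \<le> b\<^sup>2 + h\<^sup>2" by (simp add: power2_eq_square algebra_simps)
      then show ?thesis using assms by (simp add: field_simps power2_eq_square)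
    qed
    from this[of "y\<^sup>2 - x\<^sup>2"] have "\<bar>y\<^sup>2 - x\<^sup>2\<bar> \<le> (y\<^sup>2 - x\<^sup>2)\<^sup>2 / (2 * h) + h / 2" .
    moreover have "(y\<^sup>2 - x\<^sup>2)\<^sup>2 / (2 * h) \<le> (y\<^sup>2 - x\<^sup>2)\<^sup>2 / (x\<^sup>2 + h)"
      using False pos by (intro divide_left_mono) auto
    moreover have "0 \<le> (y\<^sup>2 - x\<^sup>2)\<^sup>2 / (x\<^sup>2 + h)" using pos by (intro divide_nonneg_pos) auto
    moreover have "2 * (y\<^sup>2 - x\<^sup>2)\<^sup>2 / (x\<^sup>2 + h) = 2 * ((y\<^sup>2 - x\<^sup>2)\<^sup>2 / (x\<^sup>2 + h))" by simp
    ultimately show ?thesis using assms by linarith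
  qed
qed

context bessel
begin

text \<open>The weight \<open>f = g / (X s\<^sup>2 + h)\<close> is again bounded and known at
  \<open>s\<close>, and both \<open>f * X s\<^sup>2\<close> and \<open>f * h\<close> are at most
  \<open>g\<close>. Hence the \<open>f\<close>-weighted second moment of the martingale part of the
  square is at most \<open>8 * h * \<alpha>\<close> times the mean of \<open>g\<close>. Of the
  constant, \<open>32 * \<alpha>\<close> is \<open>4\<close> times this \<open>8 * \<alpha>\<close>,
  \<open>4 * \<alpha>\<^sup>2\<close> stems from the drift and \<open>1\<close> from the additive
  \<open>h\<close> in \<open>sqrt_increment_bound\<close>.\<close>

lemma increment_moment:
  assumes st: "0 \<le> s" "s \<le> t"
    and g: "g \<in> borel_measurable (F s)" "\<And>\<omega>. \<omega> \<in> space M \<Longrightarrow> 0 \<le> g \<omega>" "\<And>\<omega>. \<omega> \<in> space M \<Longrightarrow> g \<omega> \<le> G"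
  shows "(\<integral>\<^sup>+\<omega>. ennreal (g \<omega> * (X t \<omega> - X s \<omega>)\<^sup>2) \<partial>M) \<le> ennreal ((1 + 32 * \<alpha> + 4 * \<alpha>\<^sup>2) * (t - s) * expectation g)"
proof (cases "s = t")
  case False
  then have st': "0 \<le> s" "s < t" using st by auto
  define h where "h = t - s"
  have h: "0 < h" using st' by (simp add: h_def)
  have gM[measurable]: "g \<in> borel_measurable M" by (rule measurable_F_M[OF st(1) g(1)])
  have Xs: "X s \<in> borel_measurable (F s)" by (rule X_F[OF st(1)])
  have [measurable]: "X s \<in> borel_measurable M" "X t \<in> borel_measurable M" using X_M st by auto
  obtain \<omega>0 where w0: "\<omega>0 \<in> space M" using not_empty by auto
  have G: "0 \<le> G" using g(2,3)[OF w0] by simp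
  have gi: "integrable M g" using g(2,3) by (intro integrable_const_bound[of _ G] AE_I2) auto
  have Eg: "0 \<le> expectation g" using g(2) by (intro integral_nonneg_AE AE_I2) auto
  define f where "f \<omega> = g \<omega> / ((X s \<omega>)\<^sup>2 + h)" for \<omega>
  have pos: "0 < (X s \<omega>)\<^sup>2 + h" for \<omega> using h by (simp add: add_nonneg_pos)
  have f1: "f \<in> borel_measurable (F s)" unfolding f_def using g(1) Xs by measurable
  have f2: "0 \<le> f \<omega>" if "\<omega> \<in> space M" for \<omega> using g(2)[OF that] pos[of \<omega>] by (simp add: f_def)
  have f3: "f \<omega> \<le> max G (G / h)" if "\<omega> \<in> space M" for \<omega>
  proof -
    have "f \<omega> \<le> G / h" unfolding f_def using g(2,3)[OF that] h by (intro frac_le) auto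
    then show ?thesis by simp
  qed
  have f4: "f \<omega> * (X s \<omega>)\<^sup>2 \<le> g \<omega>" if "\<omega> \<in> space M" for \<omega>
  proof -
    have "g \<omega> * (X s \<omega>)\<^sup>2 \<le> g \<omega> * ((X s \<omega>)\<^sup>2 + h)" using g(2)[OF that] h by (intro mult_left_mono) auto
    then show ?thesis using pos[of \<omega>] by (simp add: f_def field_simps)
  qed
  have f4': "f \<omega> * (X s \<omega>)\<^sup>2 \<le> max G (G / h)" if "\<omega> \<in> space M" for \<omega>
    using f4[OF that] g(3)[OF that] by simp
  have f5: "f \<omega> * h \<le> g \<omega>" if "\<omega> \<in> space M" for \<omega>
  proof -
    have "g \<omega> * h \<le> g \<omega> * ((X s \<omega>)\<^sup>2 + h)" using g(2)[OF that] h by (intro mult_left_mono) auto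
    then show ?thesis using pos[of \<omega>] by (simp add: f_def field_simps)
  qed
  have fM[measurable]: "f \<in> borel_measurable M" by (rule measurable_F_M[OF st(1) f1])
  have fb: "f \<omega> * ((X s \<omega>)\<^sup>2 + \<alpha> * (u - s)) \<le> \<alpha> * g \<omega>" "0 \<le> f \<omega> * ((X s \<omega>)\<^sup>2 + \<alpha> * (u - s))"
    if w: "\<omega> \<in> space M" and u: "s \<le> u" "u \<le> t" for \<omega> u
  proof -
    have "1 * (X s \<omega>)\<^sup>2 \<le> \<alpha> * (X s \<omega>)\<^sup>2" using alpha by (intro mult_right_mono) auto
    moreover have "\<alpha> * (u - s) \<le> \<alpha> * h" using alpha u by (intro mult_left_mono) (auto simp: h_def)
    ultimately have "(X s \<omega>)\<^sup>2 + \<alpha> * (u - s) \<le> \<alpha> * ((X s \<omega>)\<^sup>2 + h)" by (simp add: distrib_left)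
    then have "f \<omega> * ((X s \<omega>)\<^sup>2 + \<alpha> * (u - s)) \<le> f \<omega> * (\<alpha> * ((X s \<omega>)\<^sup>2 + h))" using f2[OF w] by (rule mult_left_mono)
    also have "\<dots> = \<alpha> * g \<omega>" using pos[of \<omega>] by (simp add: f_def)
    finally show "f \<omega> * ((X s \<omega>)\<^sup>2 + \<alpha> * (u - s)) \<le> \<alpha> * g \<omega>" .
    show "0 \<le> f \<omega> * ((X s \<omega>)\<^sup>2 + \<alpha> * (u - s))" using f2[OF w] alpha u by simp
  qed
  have sq: "(\<integral>\<^sup>+\<omega>. ennreal (f \<omega> * (X u \<omega> - 0 * X s \<omega>)\<^sup>2) \<partial>M) \<le> ennreal (\<alpha> * expectation g)" if u: "s \<le> u" "u \<le> t" for u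
  proof -
    have "(\<integral>\<^sup>+\<omega>. ennreal (f \<omega> * (X u \<omega> - 0 * X s \<omega>)\<^sup>2) \<partial>M) \<le> ennreal (expectation (\<lambda>\<omega>. f \<omega> * ((X s \<omega>)\<^sup>2 + \<alpha> * (u - s))))"
      using square_moment_le[OF st(1) u(1) f1 f2 f3 f4'] by simp
    also have "\<dots> \<le> ennreal (expectation (\<lambda>\<omega>. \<alpha> * g \<omega>))"
    proof (intro ennreal_leI integral_mono)
      show "integrable M (\<lambda>\<omega>. f \<omega> * ((X s \<omega>)\<^sup>2 + \<alpha> * (u - s)))"
        by (rule Bochner_Integration.integrable_bound[OF integrable_mult_right[OF gi, of \<alpha>]])
          (use fb[OF _ u] in \<open>auto intro!: AE_I2 order_trans[OF _ abs_ge_self]\<close>)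
    qed (use gi fb[OF _ u] in auto)
    finally show ?thesis by simp
  qed
  let ?V = "\<lambda>\<omega>. (X t \<omega>)\<^sup>2 - (X s \<omega>)\<^sup>2 - \<alpha> * (t - s) - 2 * 0 * X s \<omega> * (W t \<omega> - W s \<omega>)"
  have V: "(\<integral>\<^sup>+\<omega>. ennreal (f \<omega> * (?V \<omega>)\<^sup>2) \<partial>M) \<le> ennreal (8 * (t - s) * (\<alpha> * expectation g))"
    using alpha Eg by (intro square_increment_moment[OF st' _ f1 f2 f3 _ sq]) auto
  have "(\<integral>\<^sup>+\<omega>. ennreal (g \<omega> * (X t \<omega> - X s \<omega>)\<^sup>2) \<partial>M) \<le> (\<integral>\<^sup>+\<omega>. ennreal 4 * ennreal (f \<omega> * (?V \<omega>)\<^sup>2) + ennreal ((1 + 4 * \<alpha>\<^sup>2) * h) * ennreal (g \<omega>) \<partial>M)"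
  proof (rule nn_integral_mono)
    fix \<omega> assume w: "\<omega> \<in> space M"
    let ?B = "(X t \<omega>)\<^sup>2 - (X s \<omega>)\<^sup>2"
    have "(X t \<omega> - X s \<omega>)\<^sup>2 \<le> 2 * ?B\<^sup>2 / ((X s \<omega>)\<^sup>2 + h) + h"
      by (rule sqrt_increment_bound) (use X_nonneg[OF w] st h in auto)
    then have "g \<omega> * (X t \<omega> - X s \<omega>)\<^sup>2 \<le> g \<omega> * (2 * ?B\<^sup>2 / ((X s \<omega>)\<^sup>2 + h) + h)"
      using g(2)[OF w] by (rule mult_left_mono)
    also have "\<dots> = f \<omega> * (2 * ?B\<^sup>2) + h * g \<omega>" by (simp add: f_def algebra_simps)
    also have "f \<omega> * (2 * ?B\<^sup>2) \<le> f \<omega> * (4 * (?V \<omega>)\<^sup>2 + 4 * \<alpha>\<^sup>2 * h\<^sup>2)"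
    proof (rule mult_left_mono[OF _ f2[OF w]])
      have "(a + b)\<^sup>2 \<le> 2 * a\<^sup>2 + 2 * b\<^sup>2" for a b :: real
        using zero_le_power2[of "a - b"] by (simp add: power2_eq_square algebra_simps)
      from this[of "?V \<omega>" "\<alpha> * h"] show "2 * ?B\<^sup>2 \<le> 4 * (?V \<omega>)\<^sup>2 + 4 * \<alpha>\<^sup>2 * h\<^sup>2"
        by (simp add: h_def power_mult_distrib)
    qed
    also have "f \<omega> * (4 * (?V \<omega>)\<^sup>2 + 4 * \<alpha>\<^sup>2 * h\<^sup>2) = 4 * (f \<omega> * (?V \<omega>)\<^sup>2) + 4 * \<alpha>\<^sup>2 * h * (f \<omega> * h)"
      by (simp add: algebra_simps power2_eq_square)
    also have "4 * \<alpha>\<^sup>2 * h * (f \<omega> * h) \<le> 4 * \<alpha>\<^sup>2 * h * g \<omega>"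
      using f5[OF w] h by (intro mult_left_mono) auto
    finally have "g \<omega> * (X t \<omega> - X s \<omega>)\<^sup>2 \<le> 4 * (f \<omega> * (?V \<omega>)\<^sup>2) + (1 + 4 * \<alpha>\<^sup>2) * h * g \<omega>"
      by (simp add: algebra_simps)
    also have "ennreal \<dots> = ennreal 4 * ennreal (f \<omega> * (?V \<omega>)\<^sup>2) + ennreal ((1 + 4 * \<alpha>\<^sup>2) * h) * ennreal (g \<omega>)"
      using f2[OF w] g(2)[OF w] h by (simp add: ennreal_plus ennreal_mult[symmetric] del: ennreal_numeral)
    finally show "ennreal (g \<omega> * (X t \<omega> - X s \<omega>)\<^sup>2) \<le> \<dots>" by (simp add: ennreal_leI)
  qed
  also have "\<dots> = ennreal 4 * (\<integral>\<^sup>+\<omega>. ennreal (f \<omega> * (?V \<omega>)\<^sup>2) \<partial>M) + ennreal ((1 + 4 * \<alpha>\<^sup>2) * h) * (\<integral>\<^sup>+\<omega>. ennreal (g \<omega>) \<partial>M)"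
    by (subst nn_integral_add) (auto simp: nn_integral_cmult simp del: ennreal_numeral)
  also have "(\<integral>\<^sup>+\<omega>. ennreal (g \<omega>) \<partial>M) = ennreal (expectation g)"
    using gi g(2) by (intro nn_integral_eq_integral AE_I2) auto
  also have "ennreal 4 * (\<integral>\<^sup>+\<omega>. ennreal (f \<omega> * (?V \<omega>)\<^sup>2) \<partial>M) \<le> ennreal 4 * ennreal (8 * (t - s) * (\<alpha> * expectation g))"
    using V by (rule mult_left_mono) simp
  also have "ennreal 4 * ennreal (8 * (t - s) * (\<alpha> * expectation g)) + ennreal ((1 + 4 * \<alpha>\<^sup>2) * h) * ennreal (expectation g)
    = ennreal (4 * (8 * (t - s) * (\<alpha> * expectation g)) + (1 + 4 * \<alpha>\<^sup>2) * h * expectation g)"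
    using h Eg alpha st by (simp add: ennreal_plus ennreal_mult[symmetric] del: ennreal_numeral)
  also have "4 * (8 * (t - s) * (\<alpha> * expectation g)) + (1 + 4 * \<alpha>\<^sup>2) * h * expectation g = (1 + 32 * \<alpha> + 4 * \<alpha>\<^sup>2) * (t - s) * expectation g"
    by (simp add: h_def algebra_simps)
  finally show ?thesis by simp
qed simp

section \<open>The process spends no time at zero\<close>

lemma zero_set_events: "0 \<le> t \<Longrightarrow> {\<omega>\<in>space M. X t \<omega> = 0} \<in> events"
  using X_M[of t] by measurable

text \<open>Started at zero, the square at a later time has mean of order the elapsed time and variance of
  order its square, so by Cantelli's inequality it stays away from zero with positive probability.\<close>

lemma zero_prob_contraction:
  assumes st: "0 \<le> s" "s < t"
  shows "prob {\<omega>\<in>space M. X s \<omega> = 0 \<and> X t \<omega> = 0} \<le> (4 * \<alpha> + 16) / (\<alpha> / 2 + 4)\<^sup>2 * prob {\<omega>\<in>space M. X s \<omega> = 0}"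
    (is "prob ?E \<le> ?q * prob ?A")
\<comment> \<open>\<open>e\<close> pays for the two exceptional events, of exceeding the level
  \<open>L\<close> and of a failing Riemann approximation.\<close>
proof (rule field_le_epsilon)
  fix e :: real assume e: "0 < e"
  define h where "h = t - s"
  have h: "0 < h" using st by (simp add: h_def)
  have A: "?A \<in> events" using zero_set_events[OF st(1)] .
  define g where "g = (\<lambda>\<omega>. indicator ?A \<omega> :: real)"
  have AF: "?A \<in> sets (F s)"
  proof -
    have "{\<omega>\<in>space (F s). X s \<omega> = 0} \<in> sets (F s)" using X_F[OF st(1)] by measurable
    then show ?thesis by (simp add: space_F[OF st(1)])
  qed
  have g: "g \<in> borel_measurable (F s)" "\<And>\<omega>. 0 \<le> g \<omega>" "\<And>\<omega>. g \<omega> \<le> 1" "\<And>\<omega>. g \<omega> * (X s \<omega>)\<^sup>2 \<le> 1" "\<And>\<omega>. g \<omega> * (X s \<omega>)\<^sup>2 = 0"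
    using AF unfolding g_def by (auto simp: indicator_def)
  have gi: "integrable M g" unfolding g_def using A by (intro integrable_real_indicator) (auto simp: emeasure_eq_measure)
  have Eg: "expectation g = prob ?A" using A by (simp add: g_def)
  obtain L where L: "0 < L" and pL: "prob (space M - range_event s t L) \<le> e / 2"
    using range_event_prob[OF st, of "e / 2"] e by auto
  \<comment> \<open>Half the drift: if \<open>X\<close> vanishes at both ends, then \<open>Y\<close>
    is at most \<open>- \<alpha> * h / 2\<close> in spite of the approximation error.\<close>
  define \<epsilon> where "\<epsilon> = \<alpha> * h / 2"
  have \<epsilon>: "0 < \<epsilon>" using alpha h by (simp add: \<epsilon>_def)
  obtain N where N: "0 < N" and pN: "prob (space M - approx_event s t N \<epsilon>) \<le> e / 2"
    using eventually_small_prob_ex[OF approx_event_prob[OF st \<epsilon>], of "e / 2"] e by auto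
  let ?D = "range_event s t L" and ?R = "approx_event s t N \<epsilon>"
  have Dm: "?D \<in> events" and Rm: "?R \<in> events" using range_event_sets[OF st] approx_event_sets[OF st] by auto
  define Y where "Y = step_sum (ugrid s t N) (stopped_coeff s t N L 0) N"
  note wt = weighted_step_sum[OF st, of N "stopped_coeff s t N L 0" "2 * L" g 1, OF stopped_coeff_measurable[OF st] stopped_coeff_bound[OF st _ L] g(1,2,3), simplified, folded Y_def]
  have EY2: "expectation (\<lambda>\<omega>. g \<omega> * (Y \<omega>)\<^sup>2) \<le> 4 * \<alpha> * h\<^sup>2 * prob ?A"
  proof -
    have "expectation (\<lambda>\<omega>. g \<omega> * (stopped_coeff s t N L 0 i \<omega>)\<^sup>2) \<le> 4 * \<alpha> * h * prob ?A" if i: "i < N" for i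
    proof -
      let ?v = "ugrid s t N i"
      have u: "0 \<le> ?v" "s \<le> ?v" "?v \<le> t" using ugrid_ge[of s t N i] ugrid_le[of s t i N] st i by auto
      have [measurable]: "X ?v \<in> borel_measurable M" by (rule X_M[OF u(1)])
      have [measurable]: "g \<in> borel_measurable M" using gi by auto
      have "ennreal (expectation (\<lambda>\<omega>. g \<omega> * (stopped_coeff s t N L 0 i \<omega>)\<^sup>2)) = (\<integral>\<^sup>+\<omega>. ennreal (g \<omega> * (stopped_coeff s t N L 0 i \<omega>)\<^sup>2) \<partial>M)"
        using wt(5)[OF i] g(2) by (intro nn_integral_eq_integral[symmetric] AE_I2) auto
      also have "\<dots> \<le> (\<integral>\<^sup>+\<omega>. ennreal 4 * ennreal (g \<omega> * (X ?v \<omega>)\<^sup>2) \<partial>M)"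
      proof (rule nn_integral_mono)
        fix \<omega> assume w: "\<omega> \<in> space M"
        have "g \<omega> * (stopped_coeff s t N L 0 i \<omega>)\<^sup>2 \<le> 4 * (g \<omega> * (X ?v \<omega>)\<^sup>2)"
          using g(2) unfolding stopped_coeff_def by (simp only: power_mult_distrib split: if_split) simp
        then show "ennreal (g \<omega> * (stopped_coeff s t N L 0 i \<omega>)\<^sup>2) \<le> ennreal 4 * ennreal (g \<omega> * (X ?v \<omega>)\<^sup>2)"
          using g(2) by (subst ennreal_mult[symmetric]) (auto intro: ennreal_leI)
      qed
      also have "\<dots> = ennreal 4 * (\<integral>\<^sup>+\<omega>. ennreal (g \<omega> * (X ?v \<omega>)\<^sup>2) \<partial>M)"
        by (rule nn_integral_cmult) measurable
      also have "\<dots> \<le> ennreal 4 * ennreal (expectation (\<lambda>\<omega>. g \<omega> * ((X s \<omega>)\<^sup>2 + \<alpha> * (?v - s))))"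
        by (intro mult_left_mono square_moment_le[OF st(1) u(2) g(1,2,3,4)]) simp
      also have "(\<lambda>\<omega>. g \<omega> * ((X s \<omega>)\<^sup>2 + \<alpha> * (?v - s))) = (\<lambda>\<omega>. \<alpha> * (?v - s) * g \<omega>)"
        unfolding distrib_left g(5) by (simp add: mult_ac)
      also have "expectation (\<lambda>\<omega>. \<alpha> * (?v - s) * g \<omega>) = \<alpha> * (?v - s) * prob ?A" by (simp add: Eg)
      also have "ennreal 4 * ennreal (\<alpha> * (?v - s) * prob ?A) = ennreal (4 * (\<alpha> * (?v - s) * prob ?A))"
        using alpha u by (subst ennreal_mult[symmetric]) auto
      also have "\<dots> \<le> ennreal (4 * \<alpha> * h * prob ?A)"
        using alpha u by (intro ennreal_leI) (auto simp: h_def intro!: mult_right_mono)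
      finally show ?thesis using alpha h by simp
    qed
    then have "(\<Sum>i<N. (t - s) / N * expectation (\<lambda>\<omega>. g \<omega> * (stopped_coeff s t N L 0 i \<omega>)\<^sup>2)) \<le> (\<Sum>i<N. (t - s) / N * (4 * \<alpha> * h * prob ?A))"
      using st by (intro sum_mono mult_left_mono) auto
    also have "\<dots> = 4 * \<alpha> * h\<^sup>2 * prob ?A" using N by (simp add: h_def power2_eq_square)
    finally show ?thesis using wt(4) by simp
  qed
  \<comment> \<open>The shift by \<open>4 * h\<close> is Cantelli's. In the square of the threshold
    \<open>b = (\<alpha> / 2 + 4) * h\<close> below, the mixed term \<open>4 * \<alpha>\<close>
    balances the second moment of \<open>Y\<close> and \<open>16\<close> the shift itself;
    \<open>\<alpha>\<^sup>2 / 4\<close> is left over, so the quotient is below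
    \<open>1\<close>.\<close>
  define f where "f \<omega> = g \<omega> * (Y \<omega>)\<^sup>2 - 8 * h * (g \<omega> * Y \<omega>) + 16 * h\<^sup>2 * g \<omega>" for \<omega>
  have f_eq: "f \<omega> = g \<omega> * (Y \<omega> - 4 * h)\<^sup>2" for \<omega> by (simp add: f_def power2_eq_square algebra_simps)
  have f0: "0 \<le> f \<omega>" for \<omega> using g(2) by (simp add: f_eq)
  have fi: "integrable M f" unfolding f_def
    by (intro Bochner_Integration.integrable_add Bochner_Integration.integrable_diff integrable_mult_right wt(1) wt(3) gi)
  have fE: "expectation f \<le> (4 * \<alpha> + 16) * h\<^sup>2 * prob ?A"
  proof -
    have "expectation f = expectation (\<lambda>\<omega>. g \<omega> * (Y \<omega>)\<^sup>2) - 8 * h * expectation (\<lambda>\<omega>. g \<omega> * Y \<omega>) + 16 * h\<^sup>2 * expectation g"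
      unfolding f_def by (simp only: Bochner_Integration.integral_add Bochner_Integration.integral_diff integrable_mult_right wt(1) wt(3) gi integral_mult_right_zero Bochner_Integration.integrable_diff)
    then show ?thesis using EY2 wt(2) by (simp add: Eg algebra_simps)
  qed
  define b where "b = (\<alpha> / 2 + 4) * h"
  have b: "0 < b" using alpha h by (simp add: b_def)
  have [measurable]: "f \<in> borel_measurable M" using fi by auto
  have sub: "?E \<subseteq> {\<omega>\<in>space M. b\<^sup>2 \<le> f \<omega>} \<union> ((space M - ?D) \<union> (space M - ?R))"
  proof
    fix \<omega> assume E: "\<omega> \<in> ?E"
    show "\<omega> \<in> {\<omega>\<in>space M. b\<^sup>2 \<le> f \<omega>} \<union> ((space M - ?D) \<union> (space M - ?R))"
    proof (cases "\<omega> \<in> ?D \<and> \<omega> \<in> ?R")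
      case True
      then have D: "\<omega> \<in> ?D" and R: "\<omega> \<in> ?R" by auto
      have "Y \<omega> = riemann_sum s t N N \<omega>"
        unfolding Y_def using stopped_sum_range[OF st N D, of 0] by simp
      moreover have "\<bar>(X t \<omega>)\<^sup>2 - (X s \<omega>)\<^sup>2 - \<alpha> * (t - s) - riemann_sum s t N N \<omega>\<bar> \<le> \<epsilon>"
        using R N by (auto simp: approx_event_def dest!: spec[of _ N])
      moreover have "(X t \<omega>)\<^sup>2 = 0" "(X s \<omega>)\<^sup>2 = 0" using E by auto
      ultimately have "Y \<omega> \<le> - (\<alpha> * h) + \<alpha> * h / 2" unfolding h_def[symmetric] \<epsilon>_def by linarith
      then have "b \<le> \<bar>Y \<omega> - 4 * h\<bar>" unfolding b_def using alpha h by (simp add: distrib_right)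
      then have "b\<^sup>2 \<le> \<bar>Y \<omega> - 4 * h\<bar>\<^sup>2" using b by (intro power_mono) auto
      then have "b\<^sup>2 \<le> f \<omega>" using E by (simp add: f_eq g_def)
      then show ?thesis using E by auto
    qed (use E in auto)
  qed
  have "prob ?E \<le> prob ({\<omega>\<in>space M. b\<^sup>2 \<le> f \<omega>} \<union> ((space M - ?D) \<union> (space M - ?R)))"
    using Dm Rm by (intro finite_measure_mono[OF sub]) auto
  also have "\<dots> \<le> prob {\<omega>\<in>space M. b\<^sup>2 \<le> f \<omega>} + prob ((space M - ?D) \<union> (space M - ?R))"
    using Dm Rm by (intro measure_Un_le) auto
  also have "prob ((space M - ?D) \<union> (space M - ?R)) \<le> prob (space M - ?D) + prob (space M - ?R)"
    using Dm Rm by (intro measure_Un_le) auto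
  also have "prob {\<omega>\<in>space M. b\<^sup>2 \<le> f \<omega>} \<le> expectation f / b\<^sup>2"
    using fi b f0 by (intro integral_Markov_inequality_measure[of _ _ "{}"]) auto
  also have "\<dots> \<le> (4 * \<alpha> + 16) * h\<^sup>2 * prob ?A / b\<^sup>2" using fE by (intro divide_right_mono) auto
  also have "\<dots> = ?q * prob ?A" using h by (simp add: b_def power_mult_distrib)
  finally show "prob ?E \<le> ?q * prob ?A + e" using pL pN by linarith
qed

definition zero_prob :: "real \<Rightarrow> real" where
  "zero_prob t = prob {\<omega>\<in>space M. X t \<omega> = 0}"

text \<open>Splitting \<open>X s = 0\<close> according to \<open>X t\<close> and solving for
  \<open>zero_prob s\<close> bounds it by the probability of \<open>X s = 0 \<noteq> X t\<close>,
  divided by \<open>1 - q\<close>. This yields left limits, not the values of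
  \<open>zero_prob\<close>; \<open>zero_prob_integral\<close> converts them into vanishing in the
  mean over time.\<close>

lemma zero_prob_left_limit:
  assumes t: "0 < t"
  shows "(\<lambda>n. zero_prob (t - 1 / real (Suc n))) \<longlonglongrightarrow> 0"
proof -
  define q where "q = (4 * \<alpha> + 16) / (\<alpha> / 2 + 4)\<^sup>2"
  have q: "q < 1"
  proof -
    have "4 * \<alpha> + 16 < (\<alpha> / 2 + 4)\<^sup>2" using alpha by (simp add: power2_eq_square field_simps)
    then show ?thesis using alpha by (simp add: q_def)
  qed
  let ?s = "\<lambda>n. t - 1 / real (Suc n)"
  have sl: "?s \<longlonglongrightarrow> t - 0" by (intro tendsto_intros LIMSEQ_Suc lim_1_over_n)
  then have ev: "\<forall>\<^sub>F n in sequentially. 0 < ?s n" using t by (intro order_tendstoD) auto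
  let ?B = "\<lambda>n. {\<omega>\<in>space M. 0 < ?s n \<and> X (?s n) \<omega> = 0 \<and> X t \<omega> \<noteq> 0}"
  have Bm: "?B n \<in> events" for n
  proof (cases "0 < ?s n")
    case True
    then have [measurable]: "X (?s n) \<in> borel_measurable M" "X t \<in> borel_measurable M" using X_M[of "?s n"] X_M[of t] t by auto
    show ?thesis by measurable
  qed auto
  have "(\<lambda>n. expectation (\<lambda>\<omega>. indicat_real (?B n) \<omega>)) \<longlonglongrightarrow> expectation (\<lambda>_. 0 :: real)"
  proof (rule integral_dominated_convergence[where w = "\<lambda>_. 1"])
    show "AE \<omega> in M. (\<lambda>n. indicator (?B n) \<omega> :: real) \<longlonglongrightarrow> 0"
    proof (rule AE_I2)
      fix \<omega> assume w: "\<omega> \<in> space M"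
      have "\<forall>\<^sub>F n in sequentially. \<omega> \<notin> ?B n"
      proof (cases "X t \<omega> = 0")
        case False
        have "\<forall>\<^sub>F n in sequentially. ?s n \<in> {0..}" using ev by eventually_elim auto
        then have "(\<lambda>n. X (?s n) \<omega>) \<longlonglongrightarrow> X t \<omega>"
          using sl t by (intro continuous_on_tendsto_compose[OF X_cont[OF w]]) auto
        moreover have "0 < X t \<omega>" using False X_nonneg[OF w, of t] t by simp
        ultimately have "\<forall>\<^sub>F n in sequentially. 0 < X (?s n) \<omega>" by (rule order_tendstoD)
        then show ?thesis by eventually_elim auto
      qed auto
      then show "(\<lambda>n. indicator (?B n) \<omega> :: real) \<longlonglongrightarrow> 0"
        by (intro tendsto_eventually) (auto elim: eventually_mono)
    qed
    show "indicat_real (?B n) \<in> borel_measurable M" for n by (rule borel_measurable_indicator[OF Bm])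
    show "AE \<omega> in M. norm (indicat_real (?B n) \<omega>) \<le> 1" for n
      by (intro AE_I2) (simp only: real_norm_def indicator_abs_le_1)
  qed simp_all
  moreover have "expectation (indicat_real (?B n)) = prob (?B n)" for n
    by (subst Bochner_Integration.integral_indicator) (simp only: sets.Int_space_eq2[OF Bm])
  ultimately have B0: "(\<lambda>n. prob (?B n)) \<longlonglongrightarrow> 0" by (simp only: Bochner_Integration.integral_zero)
  have U: "\<forall>\<^sub>F n in sequentially. zero_prob (?s n) \<le> prob (?B n) / (1 - q)"
    using ev
  proof eventually_elim
    case (elim n)
    have m[measurable]: "X (?s n) \<in> borel_measurable M" "X t \<in> borel_measurable M" using X_M[of "?s n"] X_M[of t] t elim by auto
    have eq: "{\<omega>\<in>space M. X (?s n) \<omega> = 0} = {\<omega>\<in>space M. X (?s n) \<omega> = 0 \<and> X t \<omega> = 0} \<union> ?B n" using elim by auto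
    have "zero_prob (?s n) = prob ({\<omega>\<in>space M. X (?s n) \<omega> = 0 \<and> X t \<omega> = 0} \<union> ?B n)"
      unfolding zero_prob_def by (rule arg_cong[OF eq])
    also have "\<dots> \<le> prob {\<omega>\<in>space M. X (?s n) \<omega> = 0 \<and> X t \<omega> = 0} + prob (?B n)"
      by (rule measure_Un_le[OF _ Bm]) measurable
    also have "prob {\<omega>\<in>space M. X (?s n) \<omega> = 0 \<and> X t \<omega> = 0} \<le> q * zero_prob (?s n)"
      unfolding q_def zero_prob_def using elim by (intro zero_prob_contraction) auto
    finally have "zero_prob (?s n) * (1 - q) \<le> prob (?B n)" by (simp add: algebra_simps)
    then show ?case using q by (simp add: field_simps)
  qed
  have Lm: "(\<lambda>n. prob (?B n) / (1 - q)) \<longlonglongrightarrow> 0" using tendsto_divide[OF B0 tendsto_const[of "1 - q"]] q by simp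
  have Lo: "\<forall>\<^sub>F n in sequentially. 0 \<le> zero_prob (?s n)"
    by (intro always_eventually allI) (simp only: zero_prob_def measure_nonneg)
  show ?thesis by (rule tendsto_sandwich[OF Lo U tendsto_const Lm])
qed

text \<open>For \<open>m > 0\<close> the cutoff is \<open>1\<close> where
  \<open>X \<le> 1 / m\<close> and \<open>0\<close> where \<open>X \<ge> 2 / m\<close>. Being
  continuous in space it makes the expectation continuous in time, so that Riemann sums can be
  compared with the integral.\<close>

definition near_zero :: "nat \<Rightarrow> real \<Rightarrow> real" where
  "near_zero m t = expectation (\<lambda>\<omega>. max 0 (min 1 (2 - real m * X t \<omega>)))"

lemma near_zero_bounds: "0 \<le> near_zero m t" "0 \<le> t \<Longrightarrow> near_zero m t \<le> 1"
proof -
  show "0 \<le> near_zero m t" unfolding near_zero_def by (intro integral_nonneg_AE AE_I2) auto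
  assume "0 \<le> t"
  then have [measurable]: "X t \<in> borel_measurable M" by (rule X_M)
  show "near_zero m t \<le> 1" unfolding near_zero_def
    by (intro integral_le_const integrable_const_bound[of _ 1] AE_I2) auto
qed

lemma near_zero_ge:
  assumes "0 \<le> t" "0 < m"
  shows "prob {\<omega>\<in>space M. X t \<omega> \<le> 1 / real m} \<le> near_zero m t"
proof -
  have [measurable]: "X t \<in> borel_measurable M" using assms(1) by (rule X_M)
  have "prob {\<omega>\<in>space M. X t \<omega> \<le> 1 / real m} = expectation (indicator {\<omega>\<in>space M. X t \<omega> \<le> 1 / real m})" by simp
  also have "\<dots> \<le> near_zero m t" unfolding near_zero_def
  proof (rule integral_mono)
    show "integrable M (indicat_real {\<omega> \<in> space M. X t \<omega> \<le> 1 / real m})"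
      by (intro integrable_real_indicator) (auto simp: emeasure_eq_measure)
    show "integrable M (\<lambda>\<omega>. max 0 (min 1 (2 - real m * X t \<omega>)))"
      by (intro integrable_const_bound[of _ 1] AE_I2) auto
    fix \<omega> assume "\<omega> \<in> space M"
    have "real m * X t \<omega> \<le> 1" if "X t \<omega> \<le> 1 / real m" using that assms(2) by (simp add: field_simps)
    then show "indicat_real {\<omega> \<in> space M. X t \<omega> \<le> 1 / real m} \<omega> \<le> max 0 (min 1 (2 - real m * X t \<omega>))"
      by (auto simp: indicator_def)
  qed
  finally show ?thesis .
qed

lemma near_zero_continuous: "continuous_on {0..} (near_zero m)"
  unfolding continuous_on_sequentially
proof (intro allI ballI impI)
  fix x a assume "a \<in> {0::real..}" and x: "(\<forall>n. x n \<in> {0..}) \<and> x \<longlonglongrightarrow> a"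
  have "(\<lambda>n. near_zero m (x n)) \<longlonglongrightarrow> near_zero m a"
    unfolding near_zero_def
  proof (rule integral_dominated_convergence[where w = "\<lambda>_. 1"])
    show "AE \<omega> in M. (\<lambda>n. max 0 (min 1 (2 - real m * X (x n) \<omega>))) \<longlonglongrightarrow> max 0 (min 1 (2 - real m * X a \<omega>))"
    proof (rule AE_I2)
      fix \<omega> assume w: "\<omega> \<in> space M"
      have "(\<lambda>n. X (x n) \<omega>) \<longlonglongrightarrow> X a \<omega>"
        using x \<open>a \<in> {0..}\<close> by (intro continuous_on_tendsto_compose[OF X_cont[OF w]]) auto
      then show "(\<lambda>n. max 0 (min 1 (2 - real m * X (x n) \<omega>))) \<longlonglongrightarrow> max 0 (min 1 (2 - real m * X a \<omega>))"
        by (intro tendsto_intros)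
    qed
  next
    show "(\<lambda>\<omega>. max 0 (min 1 (2 - real m * X a \<omega>))) \<in> borel_measurable M"
      using X_M[of a] \<open>a \<in> {0..}\<close> by (auto intro!: borel_measurable_max borel_measurable_min)
    show "(\<lambda>\<omega>. max 0 (min 1 (2 - real m * X (x n) \<omega>))) \<in> borel_measurable M" for n
      using X_M[of "x n"] x by (auto intro!: borel_measurable_max borel_measurable_min)
  qed auto
  then show "(near_zero m \<circ> x) \<longlonglongrightarrow> near_zero m a" by (simp add: comp_def)
qed

lemma near_zero_limit:
  assumes "0 \<le> t"
  shows "(\<lambda>m. near_zero m t) \<longlonglongrightarrow> zero_prob t"
proof -
  have [measurable]: "X t \<in> borel_measurable M" using assms by (rule X_M)
  have "(\<lambda>m. near_zero m t) \<longlonglongrightarrow> expectation (indicator {\<omega>\<in>space M. X t \<omega> = 0})"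
    unfolding near_zero_def
  proof (rule integral_dominated_convergence[where w = "\<lambda>_. 1"])
    show "AE \<omega> in M. (\<lambda>m. max 0 (min 1 (2 - real m * X t \<omega>))) \<longlonglongrightarrow> indicator {\<omega>\<in>space M. X t \<omega> = 0} \<omega>"
    proof (rule AE_I2)
      fix \<omega> assume w: "\<omega> \<in> space M"
      show "(\<lambda>m. max 0 (min 1 (2 - real m * X t \<omega>))) \<longlonglongrightarrow> indicator {\<omega>\<in>space M. X t \<omega> = 0} \<omega>"
      proof (cases "X t \<omega> = 0")
        case False
        then have pos: "0 < X t \<omega>" using X_nonneg[OF w assms] by simp
        obtain m0 :: nat where m0: "2 / X t \<omega> \<le> real m0" using real_arch_simple by auto
        have "max 0 (min 1 (2 - real m * X t \<omega>)) = 0" if "m0 \<le> m" for m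
        proof -
          have "2 / X t \<omega> \<le> real m" using m0 that by simp
          then have "2 \<le> real m * X t \<omega>" using pos by (simp add: field_simps)
          then show ?thesis by simp
        qed
        then have "\<forall>\<^sub>F m in sequentially. max 0 (min 1 (2 - real m * X t \<omega>)) = indicator {\<omega>\<in>space M. X t \<omega> = 0} \<omega>"
          using False by (auto simp: eventually_sequentially)
        then show ?thesis by (rule tendsto_eventually)
      qed (use w in simp)
    qed
  qed auto
  then show ?thesis by (simp add: zero_prob_def)
qed

text \<open>The integral of \<open>zero_prob (x - 1 / n)\<close> over \<open>x\<close> does not depend on \<open>n\<close> and tends to zero.\<close>

lemma zero_prob_integral:
  assumes T: "0 < T"
  shows "(\<lambda>m. LINT x:{0<..T}|lborel. near_zero m x) \<longlonglongrightarrow> 0"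
proof -
  define p where "p x = indicator {0<..T} x * zero_prob x" for x
  have nzm: "(\<lambda>x. indicator {0<..T} x * near_zero m x) \<in> borel_measurable lborel" for m
    using borel_measurable_continuous_on_indicator[of "{0<..T}" "near_zero m"] continuous_on_subset[OF near_zero_continuous, of "{0<..T}" m]
    by (auto simp: subset_eq)
  have lim: "(\<lambda>m. indicator {0<..T} x * near_zero m x) \<longlonglongrightarrow> p x" for x
    unfolding p_def by (cases "x \<in> {0<..T}") (auto intro!: near_zero_limit)
  \<comment> \<open>Measurability of \<open>zero_prob\<close> in time is inherited from the
    continuous functions \<open>near_zero m\<close>.\<close>
  have pm[measurable]: "p \<in> borel_measurable lborel"
    by (rule borel_measurable_LIMSEQ_real[OF lim nzm])
  have p_out: "p x = 0" if "x \<notin> {0<..T}" for x using that by (simp add: p_def)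
  have p01: "0 \<le> p x" "p x \<le> indicator {0<..T} x" for x
    by (auto simp: p_def zero_prob_def indicator_def)
  have "(\<lambda>n. integral\<^sup>L lborel (\<lambda>x. p (- (1 / real (Suc n)) + 1 * x))) \<longlonglongrightarrow> integral\<^sup>L lborel (\<lambda>_::real. 0::real)"
  proof (rule integral_dominated_convergence[where w = "indicator {0..T + 1}"])
    show "AE x in lborel. (\<lambda>n. p (- (1 / real (Suc n)) + 1 * x)) \<longlonglongrightarrow> 0"
    proof (rule AE_I2)
      fix x
      have l: "(\<lambda>n. x - 1 / real (Suc n)) \<longlonglongrightarrow> x - 0" by (intro tendsto_intros LIMSEQ_Suc lim_1_over_n)
      consider "x \<le> 0" | "T < x" | "0 < x" by linarith
      then show "(\<lambda>n. p (- (1 / real (Suc n)) + 1 * x)) \<longlonglongrightarrow> 0"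
      proof cases
        case 1
        have "p (- (1 / real (Suc n)) + 1 * x) = 0" for n
        proof -
          have "0 \<le> 1 / real (Suc n)" by simp
          then have "- (1 / real (Suc n)) + 1 * x \<notin> {0<..T}" using 1 by (simp only: greaterThanAtMost_iff) linarith
          then show ?thesis by (rule p_out)
        qed
        then show ?thesis by simp
      next
        case 2
        then have "\<forall>\<^sub>F n in sequentially. T < x - 1 / real (Suc n)" using l by (intro order_tendstoD(1)[OF l]) simp
        then have "\<forall>\<^sub>F n in sequentially. p (- (1 / real (Suc n)) + 1 * x) = 0"
          by eventually_elim (rule p_out, simp)
        then show ?thesis by (rule tendsto_eventually)
      next
        case 3
        show ?thesis
        proof (rule tendsto_sandwich[OF _ _ tendsto_const zero_prob_left_limit[OF 3]])
          have "p y \<le> zero_prob y" for y by (auto simp: p_def indicator_def zero_prob_def)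
          then have "p (- (1 / real (Suc n)) + 1 * x) \<le> zero_prob (x - 1 / real (Suc n))" for n
            by (metis add.commute mult_1 uminus_add_conv_diff)
          then show "\<forall>\<^sub>F n in sequentially. p (- (1 / real (Suc n)) + 1 * x) \<le> zero_prob (x - 1 / real (Suc n))" by (rule always_eventually[OF allI])
        qed (use p01 in auto)
      qed
    qed
    show "AE x in lborel. norm (p (- (1 / real (Suc n)) + 1 * x)) \<le> indicator {0..T + 1} x" for n
    proof (rule AE_I2)
      fix x
      define y where "y = - (1 / real (Suc n)) + 1 * x"
      have "1 / real (Suc n) \<le> 1" "0 \<le> 1 / real (Suc n)" by auto
      then have y: "y \<le> x" "x \<le> y + 1" unfolding y_def by linarith+
      have "norm (p y) \<le> indicator {0..T + 1} x"
      proof (cases "y \<in> {0<..T}")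
        case True
        then have "x \<in> {0..T + 1}" using y by auto
        then show ?thesis using p01[of y] True by simp
      qed (simp add: p_out)
      then show "norm (p (- (1 / real (Suc n)) + 1 * x)) \<le> indicator {0..T + 1} x"
        unfolding y_def .
    qed
    show "integrable lborel (indicat_real {0..T + 1})"
      by (intro integrable_real_indicator) (auto simp: emeasure_lborel_Icc_eq)
  qed auto
  moreover have "integral\<^sup>L lborel (\<lambda>x. p (- (1 / real (Suc n)) + 1 * x)) = integral\<^sup>L lborel p" for n
    using lborel_integral_real_affine[of 1 p "- (1 / real (Suc n))"] by simp
  ultimately have "(\<lambda>n::nat. integral\<^sup>L lborel p) \<longlonglongrightarrow> 0" by simp
  then have p0: "integral\<^sup>L lborel p = 0" by (simp add: LIMSEQ_const_iff)
  have "(\<lambda>m. integral\<^sup>L lborel (\<lambda>x. indicator {0<..T} x * near_zero m x)) \<longlonglongrightarrow> integral\<^sup>L lborel p"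
  proof (rule integral_dominated_convergence[where w = "indicator {0<..T}"])
    show "AE x in lborel. norm (indicator {0<..T} x * near_zero m x) \<le> indicator {0<..T} x" for m
      using near_zero_bounds by (intro AE_I2) (auto simp: indicator_def)
    show "integrable lborel (indicat_real {0<..T})" using T by (intro integrable_real_indicator) simp_all
  qed (use nzm lim in auto)
  then show ?thesis unfolding p0 set_lebesgue_integral_def by simp
qed

end

text \<open>By uniform continuity, on a fine grid the value at the left endpoint of a cell exceeds
  \<open>f\<close> on that cell by at most \<open>e / T\<close>.\<close>

lemma riemann_sum_le:
  fixes f :: "real \<Rightarrow> real"
  assumes T: "0 < T" and f: "continuous_on {0..T} f" and e: "0 < e"
  shows "\<forall>\<^sub>F N in sequentially. (T / real N) * (\<Sum>i<N. f (ugrid 0 T N i)) \<le> (LINT x:{0<..T}|lborel. f x) + e"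
proof -
  have "uniformly_continuous_on {0..T} f" using f by (intro compact_uniformly_continuous) auto
  then obtain d where d: "0 < d" "\<And>x y. x \<in> {0..T} \<Longrightarrow> y \<in> {0..T} \<Longrightarrow> dist y x < d \<Longrightarrow> dist (f y) (f x) < e / T"
    using e T unfolding uniformly_continuous_on_def by (metis divide_pos_pos)
  have "(\<lambda>N. T / real N) \<longlonglongrightarrow> 0" by (rule lim_const_over_n)
  then have "\<forall>\<^sub>F N in sequentially. T / real N < d" using d(1) by (rule order_tendstoD)
  then show ?thesis using eventually_gt_at_top[of 0]
  proof eventually_elim
    case (elim N)
    let ?u = "ugrid 0 T N"
    have u: "0 \<le> ?u i" "?u i \<le> ?u (Suc i)" for i using ugrid_ge[of 0 T N i] ugrid_Suc_le[of 0 T N i] T by auto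
    have uT: "?u i \<le> T" if "i \<le> N" for i using ugrid_le[of 0 T i N] T that by auto
    have fi: "set_integrable lborel {a<..b} f" if "0 \<le> a" "b \<le> T" for a b
    proof -
      have "set_integrable lborel {0..T} f" unfolding set_integrable_def
        by (rule borel_integrable_compact) (use f in auto)
      then show ?thesis by (rule set_integrable_subset) (use that in auto)
    qed
    have c: "set_integrable lborel {a<..b} (\<lambda>_. k)" for a b k :: real
      unfolding set_integrable_def by (cases "a \<le> b") (intro integrable_scaleR_left integrable_real_indicator; auto)+
    have "(T / real N) * (\<Sum>i<m. f (?u i)) \<le> (LINT x:{0<..?u m}|lborel. f x) + e / T * ?u m" if "m \<le> N" for m
      using that
    proof (induction m)
      case (Suc m)
      have "(T / real N) * f (?u m) = (LINT x:{?u m<..?u (Suc m)}|lborel. f (?u m))"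
        using u[of m] ugrid_Suc_diff[of 0 T N m] by (simp add: set_integral_const)
      also have "\<dots> \<le> (LINT x:{?u m<..?u (Suc m)}|lborel. f x + e / T)"
      proof (rule set_integral_mono[OF c set_integral_add(1)[OF fi c]])
        show "0 \<le> ?u m" "?u (Suc m) \<le> T" using u uT[of "Suc m"] Suc.prems by auto
        fix x assume x: "x \<in> {?u m<..?u (Suc m)}"
        have "dist (f (?u m)) (f x) < e / T"
          using x u[of m] uT[of m] uT[of "Suc m"] Suc.prems elim ugrid_Suc_diff[of 0 T N m]
          by (intro d(2)) (auto simp: dist_real_def)
        then show "f (?u m) \<le> f x + e / T" by (simp add: dist_real_def)
      qed
      also have "\<dots> = (LINT x:{?u m<..?u (Suc m)}|lborel. f x) + e / T * (?u (Suc m) - ?u m)"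
        using u[of m] uT[of "Suc m"] Suc.prems by (subst set_integral_add(2)[OF fi c]) (auto simp: set_integral_const)
      finally have *: "(T / real N) * f (?u m) \<le> \<dots>" .
      have "{0<..?u (Suc m)} = {0<..?u m} \<union> {?u m<..?u (Suc m)}" using u[of m] by auto
      then have "(LINT x:{0<..?u (Suc m)}|lborel. f x) = (LINT x:{0<..?u m}|lborel. f x) + (LINT x:{?u m<..?u (Suc m)}|lborel. f x)"
        using u[of m] uT[of m] uT[of "Suc m"] Suc.prems by (simp only:) (subst set_integral_Un, auto intro!: fi)
      then show ?case using * Suc by (simp add: algebra_simps)
    qed (simp add: set_lebesgue_integral_def)
    from this[of N] show ?case using elim T by simp
  qed
qed

context bessel
begin

text \<open>The cutoff index \<open>m\<close> is chosen first, from the time integral, and the grid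
  is refined afterwards, so \<open>\<epsilon> = 1 / m\<close> does not depend on
  \<open>N\<close>.\<close>

lemma occupation_near_zero:
  assumes T: "0 < T" and e: "0 < e"
  shows "\<exists>\<epsilon>>0. \<forall>\<^sub>F N in sequentially. (T / real N) * (\<Sum>i<N. prob {\<omega>\<in>space M. X (ugrid 0 T N i) \<omega> \<le> \<epsilon>}) \<le> e"
proof -
  have "\<forall>\<^sub>F m in sequentially. (LINT x:{0<..T}|lborel. near_zero m x) < e / 2"
    using zero_prob_integral[OF T] e by (intro order_tendstoD) auto
  then have "\<forall>\<^sub>F m in sequentially. (LINT x:{0<..T}|lborel. near_zero m x) < e / 2 \<and> 0 < m"
    using eventually_gt_at_top[of 0] by eventually_elim auto
  then obtain m where m: "(LINT x:{0<..T}|lborel. near_zero m x) < e / 2" "0 < m" by (auto simp: eventually_sequentially)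
  have "\<forall>\<^sub>F N in sequentially. (T / real N) * (\<Sum>i<N. near_zero m (ugrid 0 T N i)) \<le> (LINT x:{0<..T}|lborel. near_zero m x) + e / 2"
    using T e continuous_on_subset[OF near_zero_continuous] by (intro riemann_sum_le) auto
  then have "\<forall>\<^sub>F N in sequentially. (T / real N) * (\<Sum>i<N. prob {\<omega>\<in>space M. X (ugrid 0 T N i) \<omega> \<le> 1 / real m}) \<le> e"
  proof eventually_elim
    case (elim N)
    have "(T / real N) * (\<Sum>i<N. prob {\<omega>\<in>space M. X (ugrid 0 T N i) \<omega> \<le> 1 / real m}) \<le> (T / real N) * (\<Sum>i<N. near_zero m (ugrid 0 T N i))"
      using T m(2) ugrid_ge[of 0 T N] by (intro mult_left_mono sum_mono near_zero_ge) auto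
    then show ?case using elim m(1) by linarith
  qed
  then show ?thesis using m(2) by (intro exI[of _ "1 / real m"]) auto
qed

end

section \<open>The quadratic variation\<close>

context brownian
begin

text \<open>The centred squared increments are orthogonal, each being independent of the past, and
  with \<open>h = T / N\<close> each has variance
  \<open>3 * h\<^sup>2 - 2 * h\<^sup>2 + h\<^sup>2\<close>.\<close>

lemma brownian_square_sum:
  assumes T: "0 < T" and N: "0 < N"
  defines "\<zeta> \<equiv> \<lambda>N i \<omega>. (W (ugrid 0 T N (Suc i)) \<omega> - W (ugrid 0 T N i) \<omega>)\<^sup>2 - T / real N"
  shows "(\<lambda>\<omega>. \<Sum>i<n. \<zeta> N i \<omega>) \<in> borel_measurable (F (ugrid 0 T N n)) \<and>
    integrable M (\<lambda>\<omega>. \<Sum>i<n. \<zeta> N i \<omega>) \<and> integrable M (\<lambda>\<omega>. (\<Sum>i<n. \<zeta> N i \<omega>)\<^sup>2) \<and>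
    expectation (\<lambda>\<omega>. (\<Sum>i<n. \<zeta> N i \<omega>)\<^sup>2) = real n * (2 * (T / real N)\<^sup>2)"
proof (induction n)
  case (Suc n)
  let ?h = "T / real N" and ?s = "ugrid 0 T N n" and ?t = "ugrid 0 T N (Suc n)"
  let ?S = "\<lambda>\<omega>. \<Sum>i<n. \<zeta> N i \<omega>" and ?D = "\<lambda>\<omega>. W ?t \<omega> - W ?s \<omega>"
  have s: "0 \<le> ?s" using ugrid_ge[of 0 T N n] T by simp
  have d: "?t - ?s = ?h" using ugrid_Suc_diff[of 0 T N n] by simp
  have hp: "0 < ?h" using T N by simp
  have st: "?s < ?t" "?s \<le> ?t" using d hp by linarith+
  have t: "0 \<le> ?t" using s st by simp
  have Sm: "?S \<in> borel_measurable (F ?s)" and Si: "integrable M ?S" and S2i: "integrable M (\<lambda>\<omega>. (?S \<omega>)\<^sup>2)"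
    and S2: "expectation (\<lambda>\<omega>. (?S \<omega>)\<^sup>2) = real n * (2 * ?h\<^sup>2)" using Suc by auto
  note m1 = increment_square_mult_integrable[OF s st(2) Sm Si] increment_square_mult_expectation[OF s st(2) Sm Si]
  note i2 = increment_square_integrable[OF s st(1)] increment_square_expectation[OF s st(1)]
  note i4 = increment_fourth_integrable[OF s st(1)] increment_fourth_expectation[OF s st(1)]
  have z: "\<zeta> N n \<omega> = (?D \<omega>)\<^sup>2 - ?h" for \<omega> by (simp add: \<zeta>_def)
  have "(\<lambda>\<omega>. \<Sum>i<Suc n. \<zeta> N i \<omega>) \<in> borel_measurable (F ?t)"
  proof -
    note [measurable] = measurable_F_mono[OF s st(2) Sm] W_F_le[OF s st(2)] W_F[OF t]
    show ?thesis unfolding sum.lessThan_Suc z by measurable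
  qed
  moreover have "integrable M (\<lambda>\<omega>. \<Sum>i<Suc n. \<zeta> N i \<omega>)"
    unfolding sum.lessThan_Suc z by (intro Bochner_Integration.integrable_add Bochner_Integration.integrable_diff Si i2) simp
  moreover have e: "(\<Sum>i<Suc n. \<zeta> N i \<omega>)\<^sup>2 = (?S \<omega>)\<^sup>2 + 2 * (?S \<omega> * (?D \<omega>)\<^sup>2) - 2 * ?h * ?S \<omega> + (?D \<omega>)^4 - 2 * ?h * (?D \<omega>)\<^sup>2 + ?h\<^sup>2" for \<omega>
  proof -
    have "(a + (b - c))\<^sup>2 = a\<^sup>2 + 2 * (a * b) - 2 * c * a + b\<^sup>2 - 2 * c * b + c\<^sup>2" for a b c :: real
      by (simp add: power2_eq_square algebra_simps)
    moreover have "((?D \<omega>)\<^sup>2)\<^sup>2 = (?D \<omega>)^4" by (simp add: power_mult[symmetric])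
    ultimately show ?thesis unfolding sum.lessThan_Suc z by metis
  qed
  have "integrable M (\<lambda>\<omega>. (\<Sum>i<Suc n. \<zeta> N i \<omega>)\<^sup>2)" unfolding e
    by (intro Bochner_Integration.integrable_add Bochner_Integration.integrable_diff integrable_mult_right S2i m1(1) Si i4(1) i2(1)) simp
  moreover have "expectation (\<lambda>\<omega>. (\<Sum>i<Suc n. \<zeta> N i \<omega>)\<^sup>2) =
      expectation (\<lambda>\<omega>. (?S \<omega>)\<^sup>2) + 2 * expectation (\<lambda>\<omega>. ?S \<omega> * (?D \<omega>)\<^sup>2) - 2 * ?h * expectation ?S
      + expectation (\<lambda>\<omega>. (?D \<omega>)^4) - 2 * ?h * expectation (\<lambda>\<omega>. (?D \<omega>)\<^sup>2) + expectation (\<lambda>_. ?h\<^sup>2)"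
    unfolding e by (simp only: Bochner_Integration.integral_add Bochner_Integration.integral_diff Bochner_Integration.integrable_add
        Bochner_Integration.integrable_diff integrable_mult_right S2i m1(1) Si i4(1) i2(1) integrable_const integral_mult_right_zero)
  then have "expectation (\<lambda>\<omega>. (\<Sum>i<Suc n. \<zeta> N i \<omega>)\<^sup>2) = real (Suc n) * (2 * ?h\<^sup>2)"
  proof -
    assume *: "expectation (\<lambda>\<omega>. (\<Sum>i<Suc n. \<zeta> N i \<omega>)\<^sup>2) =
      expectation (\<lambda>\<omega>. (?S \<omega>)\<^sup>2) + 2 * expectation (\<lambda>\<omega>. ?S \<omega> * (?D \<omega>)\<^sup>2) - 2 * ?h * expectation ?S
      + expectation (\<lambda>\<omega>. (?D \<omega>)^4) - 2 * ?h * expectation (\<lambda>\<omega>. (?D \<omega>)\<^sup>2) + expectation (\<lambda>_. ?h\<^sup>2)"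
    define x where "x = ?h"
    have "expectation (\<lambda>_. x\<^sup>2) = x\<^sup>2" by (simp add: prob_space)
    then show ?thesis unfolding * S2 m1(2) i4(2) i2(2) d x_def[symmetric] of_nat_Suc
      by (simp add: algebra_simps power2_eq_square)
  qed
  ultimately show ?case by blast
qed simp

lemma brownian_quadratic_variation:
  assumes T: "0 < T" and e: "0 < e"
  shows "(\<lambda>N. prob {\<omega>\<in>space M. e \<le> \<bar>(\<Sum>i<N. (W (ugrid 0 T N (Suc i)) \<omega> - W (ugrid 0 T N i) \<omega>)\<^sup>2) - T\<bar>}) \<longlonglongrightarrow> 0"
    (is "(\<lambda>N. prob (?E N)) \<longlonglongrightarrow> 0")
proof -
  have le: "prob (?E N) \<le> 2 * T\<^sup>2 / e\<^sup>2 * (1 / real N)" if N: "0 < N" for N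
  proof -
    let ?S = "\<lambda>\<omega>. \<Sum>i<N. (W (ugrid 0 T N (Suc i)) \<omega> - W (ugrid 0 T N i) \<omega>)\<^sup>2 - T / real N"
    have B: "integrable M (\<lambda>\<omega>. (?S \<omega>)\<^sup>2)" "expectation (\<lambda>\<omega>. (?S \<omega>)\<^sup>2) = real N * (2 * (T / real N)\<^sup>2)"
      using brownian_square_sum[OF T N, of N] by auto
    have S: "?S \<omega> = (\<Sum>i<N. (W (ugrid 0 T N (Suc i)) \<omega> - W (ugrid 0 T N i) \<omega>)\<^sup>2) - T" for \<omega>
      using N by (simp add: sum_subtractf)
    have "?E N = {\<omega>\<in>space M. e\<^sup>2 \<le> (?S \<omega>)\<^sup>2}"
      unfolding S using e by (simp add: abs_le_square_iff[symmetric])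
    then have "prob (?E N) \<le> expectation (\<lambda>\<omega>. (?S \<omega>)\<^sup>2) / e\<^sup>2"
      using e by (simp only:) (intro integral_Markov_inequality_measure[of _ _ "{}"] B; simp)
    also have "\<dots> = 2 * T\<^sup>2 / e\<^sup>2 * (1 / real N)" unfolding B(2) using N by (simp add: power_divide power2_eq_square)
    finally show ?thesis .
  qed
  have "(\<lambda>N. 2 * T\<^sup>2 / e\<^sup>2 * (1 / real N)) \<longlonglongrightarrow> 2 * T\<^sup>2 / e\<^sup>2 * 0"
    by (intro tendsto_intros lim_1_over_n)
  then have lim: "(\<lambda>N. 2 * T\<^sup>2 / e\<^sup>2 * (1 / real N)) \<longlonglongrightarrow> 0" by simp
  have up: "\<forall>\<^sub>F N in sequentially. prob (?E N) \<le> 2 * T\<^sup>2 / e\<^sup>2 * (1 / real N)"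
    using eventually_gt_at_top[of 0] by eventually_elim (rule le)
  show ?thesis
    by (rule tendsto_sandwich[OF always_eventually[OF allI[OF measure_nonneg]] up tendsto_const lim])
qed

end

section \<open>Comparison of the squared increments of \<open>X\<close> and \<open>W\<close>\<close>

context bessel
begin

lemma nn_integral_bound_real:
  assumes [measurable]: "f \<in> borel_measurable M" and f: "\<And>\<omega>. \<omega> \<in> space M \<Longrightarrow> 0 \<le> f \<omega>"
    and le: "(\<integral>\<^sup>+\<omega>. ennreal (f \<omega>) \<partial>M) \<le> ennreal c" and c: "0 \<le> c"
  shows "integrable M f" "expectation f \<le> c"
proof -
  show i: "integrable M f"
    using f le by (intro integrableI_nonneg AE_I2) (auto intro: le_less_trans)
  have "ennreal (expectation f) = (\<integral>\<^sup>+\<omega>. ennreal (f \<omega>) \<partial>M)"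
    using i f by (intro nn_integral_eq_integral[symmetric] AE_I2) auto
  then have "ennreal (expectation f) \<le> ennreal c" using le by simp
  then show "expectation f \<le> c" using c by simp
qed

text \<open>For \<open>x > \<epsilon>\<close>, the identity
  \<open>2 * x * (y - x - w) = V + a - (y - x)\<^sup>2\<close> controls
  \<open>D = y - x - w\<close>; the factor is \<open>3\<close>, for the square of three terms, over
  \<open>(2 * \<epsilon>)\<^sup>2\<close>, and half of the fourth power of \<open>y - x\<close> is
  traded for \<open>\<eta>\<^sup>2\<close>. The difference of squares is
  \<open>2 * w * D + D\<^sup>2\<close>, split by Young's inequality with parameter
  \<open>\<kappa>\<close>. For \<open>x \<le> \<epsilon>\<close> the two squares are merely
  added.\<close>

lemma square_difference_bound:
  fixes x y w a \<epsilon> \<kappa> \<eta> :: real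
  assumes pos: "0 < \<epsilon>" "0 < \<kappa>" "0 \<le> x" "0 \<le> y" and osc: "\<bar>y - x\<bar> \<le> \<eta>"
  defines "V \<equiv> y\<^sup>2 - x\<^sup>2 - a - 2 * x * w"
  shows "\<bar>(y - x)\<^sup>2 - w\<^sup>2\<bar> \<le> of_bool (x \<le> \<epsilon>) * ((y - x)\<^sup>2 + w\<^sup>2) + \<kappa> * w\<^sup>2
    + (1 + 1 / \<kappa>) * (3 / (4 * \<epsilon>\<^sup>2)) * (V\<^sup>2 + a\<^sup>2 + \<eta>\<^sup>2 * (y - x)\<^sup>2)"
proof -
  have c: "0 \<le> (1 + 1 / \<kappa>) * (3 / (4 * \<epsilon>\<^sup>2)) * (V\<^sup>2 + a\<^sup>2 + \<eta>\<^sup>2 * (y - x)\<^sup>2)" using pos by simp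
  show ?thesis
  proof (cases "x \<le> \<epsilon>")
    case True
    have "\<bar>(y - x)\<^sup>2 - w\<^sup>2\<bar> \<le> (y - x)\<^sup>2 + w\<^sup>2" by (simp add: abs_le_iff)
    moreover have "0 \<le> \<kappa> * w\<^sup>2" using pos by simp
    ultimately show ?thesis using True c by simp
  next
    case False
    define D where "D = (y - x) - w"
    have x: "\<epsilon> < x" "0 < x" using False pos by auto
    have "2 * x * D = V + a + (- (y - x)\<^sup>2)" by (simp add: D_def V_def power2_eq_square algebra_simps)
    then have "(2 * x * D)\<^sup>2 = (V + a + (- (y - x)\<^sup>2))\<^sup>2" by simp
    also have "\<dots> \<le> 3 * (V\<^sup>2 + a\<^sup>2 + (- (y - x)\<^sup>2)\<^sup>2)"
    proof -
      have "(p + q + r)\<^sup>2 \<le> 3 * (p\<^sup>2 + q\<^sup>2 + r\<^sup>2)" for p q r :: real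
        using zero_le_power2[of "p - q"] zero_le_power2[of "p - r"] zero_le_power2[of "q - r"]
        by (simp add: power2_eq_square algebra_simps)
      then show ?thesis .
    qed
    also have "(- (y - x)\<^sup>2)\<^sup>2 \<le> \<eta>\<^sup>2 * (y - x)\<^sup>2"
      using mult_right_mono[OF abs_le_imp_square_le[OF osc], of "(y - x)\<^sup>2"] by (simp add: power2_eq_square)
    finally have "(2 * x * D)\<^sup>2 \<le> 3 * (V\<^sup>2 + a\<^sup>2 + \<eta>\<^sup>2 * (y - x)\<^sup>2)" by simp
    moreover have "4 * \<epsilon>\<^sup>2 * D\<^sup>2 \<le> (2 * x * D)\<^sup>2"
    proof -
      have "\<epsilon>\<^sup>2 \<le> x\<^sup>2" using x pos by (intro power_mono) auto
      then have "4 * \<epsilon>\<^sup>2 * D\<^sup>2 \<le> 4 * x\<^sup>2 * D\<^sup>2" by (intro mult_right_mono) auto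
      then show ?thesis by (simp add: power_mult_distrib)
    qed
    ultimately have "4 * \<epsilon>\<^sup>2 * D\<^sup>2 \<le> 3 * (V\<^sup>2 + a\<^sup>2 + \<eta>\<^sup>2 * (y - x)\<^sup>2)" by (rule order_trans[rotated])
    then have "D\<^sup>2 \<le> 3 / (4 * \<epsilon>\<^sup>2) * (V\<^sup>2 + a\<^sup>2 + \<eta>\<^sup>2 * (y - x)\<^sup>2)"
      using pos by (simp add: field_simps)
    then have "(1 + 1 / \<kappa>) * D\<^sup>2 \<le> (1 + 1 / \<kappa>) * (3 / (4 * \<epsilon>\<^sup>2) * (V\<^sup>2 + a\<^sup>2 + \<eta>\<^sup>2 * (y - x)\<^sup>2))"
      using pos by (intro mult_left_mono) auto
    moreover have "\<bar>(y - x)\<^sup>2 - w\<^sup>2\<bar> \<le> \<kappa> * w\<^sup>2 + (1 + 1 / \<kappa>) * D\<^sup>2"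
    proof -
      have "(y - x)\<^sup>2 - w\<^sup>2 = 2 * w * D + D\<^sup>2" by (simp add: D_def power2_eq_square algebra_simps)
      moreover have "\<bar>2 * w * D\<bar> \<le> \<kappa> * w\<^sup>2 + D\<^sup>2 / \<kappa>"
      proof -
        have "0 \<le> (\<kappa> * \<bar>w\<bar> - \<bar>D\<bar>)\<^sup>2 / \<kappa>" using pos by simp
        also have "\<dots> = \<kappa> * w\<^sup>2 + D\<^sup>2 / \<kappa> - 2 * \<bar>w\<bar> * \<bar>D\<bar>"
          using pos by (simp add: power2_eq_square field_simps)
        finally show ?thesis by (simp add: abs_mult)
      qed
      moreover have "\<bar>2 * w * D + D\<^sup>2\<bar> \<le> \<bar>2 * w * D\<bar> + D\<^sup>2" using abs_triangle_ineq[of "2 * w * D" "D\<^sup>2"] by simp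
      moreover have "(1 + 1 / \<kappa>) * D\<^sup>2 = D\<^sup>2 + D\<^sup>2 / \<kappa>" by (simp add: distrib_right)
      ultimately show ?thesis by linarith
    qed
    moreover have "of_bool (x \<le> \<epsilon>) * ((y - x)\<^sup>2 + w\<^sup>2) = 0" using False by simp
    ultimately show ?thesis unfolding mult.assoc[of "1 + 1 / \<kappa>"] by linarith
  qed
qed

text \<open>The differences of the squared increments are dominated by \<open>G\<close>, and
  Markov's inequality is applied to its sum. Its mean is made small in four parts of
  \<open>\<rho> / 5\<close> each: occupation near zero by \<open>\<epsilon>\<close>, the Young term
  by \<open>\<kappa>\<close>, the oscillation term by \<open>\<eta>\<close>, and the terms of order
  \<open>h\<^sup>2\<close> per cell by large \<open>N\<close>. The factor \<open>c\<close> grows as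
  \<open>\<epsilon>\<close> and \<open>\<kappa>\<close> shrink, so these are fixed before
  \<open>\<eta>\<close> and \<open>N\<close>.\<close>

theorem bessel_quadratic_variation:
  assumes T: "0 < T" and e: "0 < e"
  shows "(\<lambda>N. prob {\<omega>\<in>space M. e < \<bar>(\<Sum>i<N. (X (ugrid 0 T N (Suc i)) \<omega> - X (ugrid 0 T N i) \<omega>)\<^sup>2) - T\<bar>}) \<longlonglongrightarrow> 0"
    (is "(\<lambda>N. prob (?E N)) \<longlonglongrightarrow> 0")
proof (rule LIMSEQ_I)
  fix r :: real assume r: "0 < r"
  define K where "K = 1 + 32 * \<alpha> + 4 * \<alpha>\<^sup>2"
  have K: "0 < K" unfolding K_def using alpha by (intro add_pos_nonneg) auto
  \<comment> \<open>Markov's inequality at level \<open>e / 2\<close> turns a mean of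
    \<open>\<rho>\<close> into a probability of \<open>r / 3\<close>.\<close>
  define \<rho> where "\<rho> = r / 3 * (e / 2)"
  have \<rho>: "0 < \<rho>" using r e by (simp add: \<rho>_def)
  obtain \<epsilon> where \<epsilon>: "0 < \<epsilon>" and occ: "\<forall>\<^sub>F N in sequentially. (T / real N) * (\<Sum>i<N. prob {\<omega>\<in>space M. X (ugrid 0 T N i) \<omega> \<le> \<epsilon>}) \<le> \<rho> / (5 * (K + 1))"
    using occupation_near_zero[OF T, of "\<rho> / (5 * (K + 1))"] \<rho> K by auto
  define \<kappa> where "\<kappa> = \<rho> / (5 * T)"
  have \<kappa>: "0 < \<kappa>" using \<rho> T by (simp add: \<kappa>_def)
  define c where "c = (1 + 1 / \<kappa>) * (3 / (4 * \<epsilon>\<^sup>2))"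
  have c: "0 < c" unfolding c_def using \<kappa> \<epsilon> by (intro mult_pos_pos add_pos_pos) auto
  define \<eta> where "\<eta> = sqrt (\<rho> / (5 * (c * K * T)))"
  have \<eta>: "0 < \<eta>" "c * \<eta>\<^sup>2 * K * T = \<rho> / 5" using \<rho> c K T by (auto simp: \<eta>_def)
  have lim1: "\<forall>\<^sub>F N in sequentially. c * (8 * K + \<alpha>\<^sup>2) * T\<^sup>2 / real N < \<rho> / 5"
    using lim_const_over_n[of "c * (8 * K + \<alpha>\<^sup>2) * T\<^sup>2"] \<rho> by (intro order_tendstoD) auto
  have lim2: "\<forall>\<^sub>F N in sequentially. prob (space M - osc_event T (2 * T / real N) \<eta>) < r / 3"
    using osc_event_prob[OF \<eta>(1), of T "2 * T"] r by (intro order_tendstoD) auto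
  let ?B = "\<lambda>N. {\<omega>\<in>space M. e / 2 \<le> \<bar>(\<Sum>i<N. (W (ugrid 0 T N (Suc i)) \<omega> - W (ugrid 0 T N i) \<omega>)\<^sup>2) - T\<bar>}"
  have lim3: "\<forall>\<^sub>F N in sequentially. prob (?B N) < r / 3"
    using brownian_quadratic_variation[OF T, of "e / 2"] e r by (intro order_tendstoD) auto
  have "\<forall>\<^sub>F N in sequentially. prob (?E N) < r"
    using occ lim1 lim2 lim3 eventually_gt_at_top[of 0]
  proof eventually_elim
    case (elim N)
    define h where "h = T / real N"
    have h: "0 < h" using T elim by (simp add: h_def)
    define u where "u = ugrid 0 T N"
    have u: "0 \<le> u i" "u i < u (Suc i)" "u (Suc i) - u i = h" for i
      using ugrid_ge[of 0 T N i] T h ugrid_Suc_diff[of 0 T N i] unfolding u_def h_def by auto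
    have uT: "u i \<le> T" if "i \<le> N" for i unfolding u_def using T that by (intro ugrid_le) auto
    have [measurable]: "X (u i) \<in> borel_measurable M" "W (u i) \<in> borel_measurable M" for i using X_M W_M u by auto
    define dX dW V where "dX i \<omega> = X (u (Suc i)) \<omega> - X (u i) \<omega>" and "dW i \<omega> = W (u (Suc i)) \<omega> - W (u i) \<omega>"
      and "V i \<omega> = (X (u (Suc i)) \<omega>)\<^sup>2 - (X (u i) \<omega>)\<^sup>2 - \<alpha> * h - 2 * X (u i) \<omega> * dW i \<omega>" for i \<omega>
    have [measurable]: "dX i \<in> borel_measurable M" "dW i \<in> borel_measurable M" "V i \<in> borel_measurable M" for i
      unfolding dX_def dW_def V_def by measurable
    define I where "I i \<omega> = (of_bool (X (u i) \<omega> \<le> \<epsilon>) :: real)" for i \<omega>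
    have IF: "I i \<in> borel_measurable (F (u i))" for i
    proof -
      have [measurable]: "X (u i) \<in> borel_measurable (F (u i))" using X_F u by auto
      show ?thesis unfolding I_def by measurable
    qed
    have Im[measurable]: "I i \<in> borel_measurable M" for i by (rule measurable_F_M[OF u(1) IF])
    have I01: "0 \<le> I i \<omega>" "I i \<omega> \<le> 1" for i \<omega> by (auto simp: I_def)
    have Ii: "integrable M (I i)" for i using I01 by (intro integrable_const_bound[of _ 1] AE_I2) auto
    have IE: "expectation (I i) = prob {\<omega>\<in>space M. X (u i) \<omega> \<le> \<epsilon>}" for i
    proof -
      have "expectation (I i) = expectation (indicator {\<omega>\<in>space M. X (u i) \<omega> \<le> \<epsilon>})"
        by (intro Bochner_Integration.integral_cong) (auto simp: I_def)
      then show ?thesis by simp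
    qed
    have XI: "integrable M (\<lambda>\<omega>. I i \<omega> * (dX i \<omega>)\<^sup>2)" "expectation (\<lambda>\<omega>. I i \<omega> * (dX i \<omega>)\<^sup>2) \<le> K * h * expectation (I i)" for i
    proof -
      have 1: "(\<integral>\<^sup>+\<omega>. ennreal (I i \<omega> * (dX i \<omega>)\<^sup>2) \<partial>M) \<le> ennreal (K * h * expectation (I i))"
        using increment_moment[OF u(1) less_imp_le[OF u(2)] IF I01(1) I01(2)] unfolding K_def dX_def u(3) .
      have "0 \<le> K * h * expectation (I i)" using K h by (simp add: IE)
      from nn_integral_bound_real[OF _ _ 1 this] I01(1)
      show "integrable M (\<lambda>\<omega>. I i \<omega> * (dX i \<omega>)\<^sup>2)" "expectation (\<lambda>\<omega>. I i \<omega> * (dX i \<omega>)\<^sup>2) \<le> K * h * expectation (I i)" by auto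
    qed
    have X1: "integrable M (\<lambda>\<omega>. (dX i \<omega>)\<^sup>2)" "expectation (\<lambda>\<omega>. (dX i \<omega>)\<^sup>2) \<le> K * h" for i
    proof -
      have 1: "(\<integral>\<^sup>+\<omega>. ennreal ((dX i \<omega>)\<^sup>2) \<partial>M) \<le> ennreal (K * h)"
        using increment_moment[OF u(1)[of i] less_imp_le[OF u(2)[of i]], of "\<lambda>_. 1" 1] unfolding K_def dX_def u(3) by (simp add: prob_space)
      show "integrable M (\<lambda>\<omega>. (dX i \<omega>)\<^sup>2)" "expectation (\<lambda>\<omega>. (dX i \<omega>)\<^sup>2) \<le> K * h"
        using nn_integral_bound_real[OF _ _ 1] K h by auto
    qed
    \<comment> \<open>The case \<open>c = 1\<close>: what remains is the integral of
      \<open>2 * (X - X (u i))\<close> with respect to \<open>W\<close>, whose integrand is itself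
      of order \<open>sqrt h\<close> by \<open>increment_moment\<close>. The second moment is of
      order \<open>h\<^sup>2\<close> and so is negligible after summation over the cells.\<close>
    have V1: "integrable M (\<lambda>\<omega>. (V i \<omega>)\<^sup>2)" "expectation (\<lambda>\<omega>. (V i \<omega>)\<^sup>2) \<le> 8 * h * (K * h)" for i
    proof -
      have "(\<integral>\<^sup>+\<omega>. ennreal (1 * (X v \<omega> - 1 * X (u i) \<omega>)\<^sup>2) \<partial>M) \<le> ennreal (K * h)" if v: "u i \<le> v" "v \<le> u (Suc i)" for v
      proof -
        have "(\<integral>\<^sup>+\<omega>. ennreal (1 * (X v \<omega> - X (u i) \<omega>)\<^sup>2) \<partial>M) \<le> ennreal (K * (v - u i))"
          using increment_moment[OF u(1) v(1), of "\<lambda>_. 1" 1] unfolding K_def by (simp add: prob_space)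
        also have "\<dots> \<le> ennreal (K * h)" using v u(3)[of i] K by (intro ennreal_leI mult_left_mono) auto
        finally show ?thesis by simp
      qed
      then have "(\<integral>\<^sup>+\<omega>. ennreal (1 * ((X (u (Suc i)) \<omega>)\<^sup>2 - (X (u i) \<omega>)\<^sup>2 - \<alpha> * (u (Suc i) - u i) - 2 * 1 * X (u i) \<omega> * (W (u (Suc i)) \<omega> - W (u i) \<omega>))\<^sup>2) \<partial>M)
          \<le> ennreal (8 * (u (Suc i) - u i) * (K * h))"
        using K h by (intro square_increment_moment[OF u(1)[of i] u(2)[of i], of 1 "\<lambda>_. 1" 1]) auto
      then have 1: "(\<integral>\<^sup>+\<omega>. ennreal ((V i \<omega>)\<^sup>2) \<partial>M) \<le> ennreal (8 * h * (K * h))" unfolding u(3) V_def dW_def by simp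
      show "integrable M (\<lambda>\<omega>. (V i \<omega>)\<^sup>2)" "expectation (\<lambda>\<omega>. (V i \<omega>)\<^sup>2) \<le> 8 * h * (K * h)"
        using nn_integral_bound_real[OF _ _ 1] K h by auto
    qed
    have WI: "integrable M (\<lambda>\<omega>. I i \<omega> * (dW i \<omega>)\<^sup>2)" "expectation (\<lambda>\<omega>. I i \<omega> * (dW i \<omega>)\<^sup>2) = h * expectation (I i)" for i
      using increment_square_mult_integrable[OF u(1) less_imp_le[OF u(2)] IF Ii]
        increment_square_mult_expectation[OF u(1) less_imp_le[OF u(2)] IF Ii] unfolding dW_def u(3) by auto
    have W1: "integrable M (\<lambda>\<omega>. (dW i \<omega>)\<^sup>2)" "expectation (\<lambda>\<omega>. (dW i \<omega>)\<^sup>2) = h" for i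
      using increment_square_integrable[OF u(1) u(2)] increment_square_expectation[OF u(1) u(2)] unfolding dW_def u(3) by auto
    define G where "G i \<omega> = (I i \<omega> * (dX i \<omega>)\<^sup>2 + I i \<omega> * (dW i \<omega>)\<^sup>2) + \<kappa> * (dW i \<omega>)\<^sup>2 + c * (V i \<omega>)\<^sup>2 + c * (\<alpha> * h)\<^sup>2 + c * \<eta>\<^sup>2 * (dX i \<omega>)\<^sup>2" for i \<omega>
    have Gi: "integrable M (G i)" for i unfolding G_def
      by (intro Bochner_Integration.integrable_add integrable_mult_right XI WI X1 V1 W1) simp
    have G0: "0 \<le> G i \<omega>" for i \<omega> unfolding G_def using I01(1) \<kappa> c by (intro add_nonneg_nonneg mult_nonneg_nonneg) auto
    have GE: "expectation (G i) \<le> (K + 1) * h * expectation (I i) + \<kappa> * h + c * (8 * K + \<alpha>\<^sup>2) * h\<^sup>2 + c * \<eta>\<^sup>2 * K * h" for i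
    proof -
      have "expectation (G i) = (expectation (\<lambda>\<omega>. I i \<omega> * (dX i \<omega>)\<^sup>2) + expectation (\<lambda>\<omega>. I i \<omega> * (dW i \<omega>)\<^sup>2)) + \<kappa> * expectation (\<lambda>\<omega>. (dW i \<omega>)\<^sup>2)
        + c * expectation (\<lambda>\<omega>. (V i \<omega>)\<^sup>2) + expectation (\<lambda>\<omega>. c * (\<alpha> * h)\<^sup>2) + c * \<eta>\<^sup>2 * expectation (\<lambda>\<omega>. (dX i \<omega>)\<^sup>2)"
        unfolding G_def by (simp only: Bochner_Integration.integral_add Bochner_Integration.integrable_add integrable_mult_right XI(1) WI(1) X1(1) V1(1) W1(1) integrable_const integral_mult_right_zero)
      moreover have "c * expectation (\<lambda>\<omega>. (V i \<omega>)\<^sup>2) \<le> c * (8 * h * (K * h))" using V1(2) c by (intro mult_left_mono) auto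
      moreover have "c * \<eta>\<^sup>2 * expectation (\<lambda>\<omega>. (dX i \<omega>)\<^sup>2) \<le> c * \<eta>\<^sup>2 * (K * h)" using X1(2) c by (intro mult_left_mono) auto
      moreover have "expectation (\<lambda>\<omega>. c * (\<alpha> * h)\<^sup>2) = c * (\<alpha> * h)\<^sup>2" by (simp add: prob_space)
      moreover have "c * (8 * h * (K * h)) + c * (\<alpha> * h)\<^sup>2 = c * (8 * K + \<alpha>\<^sup>2) * h\<^sup>2" by (simp add: power2_eq_square algebra_simps)
      moreover have "K * h * expectation (I i) + h * expectation (I i) = (K + 1) * h * expectation (I i)" by (simp add: algebra_simps)
      moreover have "c * \<eta>\<^sup>2 * (K * h) = c * \<eta>\<^sup>2 * K * h" by simp
      ultimately show ?thesis using XI(2)[of i] unfolding WI(2)[of i] W1(2)[of i] by linarith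
    qed
    let ?G = "\<lambda>\<omega>. \<Sum>i<N. G i \<omega>"
    have sGi: "integrable M ?G" by (intro Bochner_Integration.integrable_sum Gi)
    have sGE: "expectation ?G \<le> 4 * (\<rho> / 5)"
    proof -
      have "expectation ?G = (\<Sum>i<N. expectation (G i))" by (rule Bochner_Integration.integral_sum) (rule Gi)
      also have "\<dots> \<le> (\<Sum>i<N. (K + 1) * h * expectation (I i) + \<kappa> * h + c * (8 * K + \<alpha>\<^sup>2) * h\<^sup>2 + c * \<eta>\<^sup>2 * K * h)"
        by (intro sum_mono GE)
      also have "\<dots> = (K + 1) * (h * (\<Sum>i<N. expectation (I i))) + \<kappa> * (N * h) + c * (8 * K + \<alpha>\<^sup>2) * (N * h) * h + c * \<eta>\<^sup>2 * K * (N * h)"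
        by (simp add: sum.distrib sum_distrib_left mult.assoc power2_eq_square)
      also have "N * h = T" using elim by (simp add: h_def)
      also have "\<kappa> * T = \<rho> / 5" using T by (simp add: \<kappa>_def)
      also have "c * \<eta>\<^sup>2 * K * T = \<rho> / 5" by (rule \<eta>)
      finally have A: "expectation ?G \<le> (K + 1) * (h * (\<Sum>i<N. expectation (I i))) + \<rho> / 5 + c * (8 * K + \<alpha>\<^sup>2) * T * h + \<rho> / 5" .
      have "(K + 1) * (h * (\<Sum>i<N. expectation (I i))) \<le> (K + 1) * (\<rho> / (5 * (K + 1)))"
        using elim(1) K unfolding IE h_def u_def by (intro mult_left_mono) auto
      also have "\<dots> = \<rho> / 5" using K by (simp add: divide_simps)
      finally have B: "(K + 1) * (h * (\<Sum>i<N. expectation (I i))) \<le> \<rho> / 5" .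
      have "c * (8 * K + \<alpha>\<^sup>2) * T * h = c * (8 * K + \<alpha>\<^sup>2) * T\<^sup>2 / real N" by (simp add: h_def power2_eq_square)
      then show ?thesis using A B elim(2) by linarith
    qed
    let ?C = "{\<omega>\<in>space M. e / 2 \<le> ?G \<omega>}" and ?O = "osc_event T (2 * T / real N) \<eta>"
    have [measurable]: "?G \<in> borel_measurable M" using sGi by auto
    have C: "?C \<in> events" by measurable
    have "prob ?C \<le> expectation ?G / (e / 2)"
      using sGi e G0 by (intro integral_Markov_inequality_measure[of _ _ "{}"]) (auto intro!: AE_I2 sum_nonneg)
    also have "\<dots> \<le> 4 * (\<rho> / 5) / (e / 2)" using sGE e by (intro divide_right_mono) auto
    also have "\<dots> = 4 / 5 * (r / 3)" using e by (simp add: \<rho>_def)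
    finally have pC: "prob ?C \<le> 4 / 5 * (r / 3)" .
    have Bm: "?B N \<in> events" unfolding u_def[symmetric] by measurable
    have sub: "?E N \<subseteq> ?C \<union> ((space M - ?O) \<union> ?B N)"
    proof
      fix \<omega> assume E: "\<omega> \<in> ?E N"
      then have w: "\<omega> \<in> space M" and gt: "e < \<bar>(\<Sum>i<N. (dX i \<omega>)\<^sup>2) - T\<bar>" by (auto simp: u_def dX_def)
      show "\<omega> \<in> ?C \<union> ((space M - ?O) \<union> ?B N)"
      proof (rule ccontr)
        assume "\<not> ?thesis"
        then have O: "\<omega> \<in> ?O" and nC: "?G \<omega> < e / 2" and nB: "\<bar>(\<Sum>i<N. (dW i \<omega>)\<^sup>2) - T\<bar> < e / 2"
          using w by (auto simp: u_def dW_def)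
        have "\<bar>(dX i \<omega>)\<^sup>2 - (dW i \<omega>)\<^sup>2\<bar> \<le> G i \<omega>" if i: "i < N" for i
        proof -
          have "h < 2 * T / real N" using T elim by (simp add: h_def divide_strict_right_mono)
          then have osc: "\<bar>X (u (Suc i)) \<omega> - X (u i) \<omega>\<bar> \<le> \<eta>"
            using u[of i] u[of "Suc i"] uT[of i] uT[of "Suc i"] i by (intro osc_eventD[OF O]) auto
          have "\<bar>(X (u (Suc i)) \<omega> - X (u i) \<omega>)\<^sup>2 - (dW i \<omega>)\<^sup>2\<bar> \<le> of_bool (X (u i) \<omega> \<le> \<epsilon>) * ((X (u (Suc i)) \<omega> - X (u i) \<omega>)\<^sup>2 + (dW i \<omega>)\<^sup>2) + \<kappa> * (dW i \<omega>)\<^sup>2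
            + (1 + 1 / \<kappa>) * (3 / (4 * \<epsilon>\<^sup>2)) * (((X (u (Suc i)) \<omega>)\<^sup>2 - (X (u i) \<omega>)\<^sup>2 - \<alpha> * h - 2 * X (u i) \<omega> * dW i \<omega>)\<^sup>2 + (\<alpha> * h)\<^sup>2 + \<eta>\<^sup>2 * (X (u (Suc i)) \<omega> - X (u i) \<omega>)\<^sup>2)"
            by (rule square_difference_bound[OF \<epsilon> \<kappa> X_nonneg[OF w u(1)] X_nonneg[OF w u(1)] osc])
          then show ?thesis unfolding G_def I_def c_def[symmetric] dX_def[symmetric] V_def[symmetric] by (simp add: distrib_left mult.assoc)
        qed
        then have "(\<Sum>i<N. \<bar>(dX i \<omega>)\<^sup>2 - (dW i \<omega>)\<^sup>2\<bar>) \<le> ?G \<omega>" by (intro sum_mono) auto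
        moreover have "\<bar>\<Sum>i<N. (dX i \<omega>)\<^sup>2 - (dW i \<omega>)\<^sup>2\<bar> \<le> (\<Sum>i<N. \<bar>(dX i \<omega>)\<^sup>2 - (dW i \<omega>)\<^sup>2\<bar>)" by (rule sum_abs)
        ultimately have "\<bar>(\<Sum>i<N. (dX i \<omega>)\<^sup>2) - (\<Sum>i<N. (dW i \<omega>)\<^sup>2)\<bar> < e / 2" using nC unfolding sum_subtractf by linarith
        then show False using nB gt by linarith
      qed
    qed
    have "prob (?E N) \<le> prob (?C \<union> ((space M - ?O) \<union> ?B N))"
      by (rule finite_measure_mono[OF sub]) (intro sets.Un C Bm sets.compl_sets osc_event_sets)
    also have "\<dots> \<le> prob ?C + prob ((space M - ?O) \<union> ?B N)"
      by (intro measure_Un_le sets.Un C Bm sets.compl_sets osc_event_sets)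
    also have "prob ((space M - ?O) \<union> ?B N) \<le> prob (space M - ?O) + prob (?B N)"
      by (intro measure_Un_le Bm sets.compl_sets osc_event_sets)
    finally show "prob (?E N) < r" using pC elim(3,4) r by linarith
  qed
  then show "\<exists>no. \<forall>n\<ge>no. norm (prob (?E n) - 0) < r" by (simp add: eventually_sequentially)
qed

end

section \<open>Integrating good-lambda inequalities against moderate functions\<close>

lemma upward_closed_borel:
  fixes S :: "ennreal set"
  assumes "\<And>x z. x \<in> S \<Longrightarrow> x \<le> z \<Longrightarrow> z \<in> S"
  shows "S \<in> sets borel"
proof -
  have "S = {Inf S..} \<or> S = {Inf S<..}"
  proof (cases "Inf S \<in> S")
    case True
    then have "S = {Inf S..}" using assms Inf_lower by (auto simp: subset_eq)
    then show ?thesis ..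
  next
    case False
    have "x \<in> S" if "Inf S < x" for x using that assms unfolding Inf_less_iff by (auto intro: less_imp_le)
    moreover have "Inf S < x" if "x \<in> S" for x using that False Inf_lower[OF that] by (metis le_less)
    ultimately have "S = {Inf S<..}" by auto
    then show ?thesis ..
  qed
  then show ?thesis by (metis atLeast_borel greaterThan_borel)
qed

lemma (in sigma_finite_measure) nn_integral_layer_cake:
  fixes f :: "'a \<Rightarrow> ennreal"
  assumes [measurable]: "f \<in> borel_measurable M"
  shows "(\<integral>\<^sup>+y. emeasure M {\<omega>\<in>space M. ennreal y < f \<omega>} * indicator {0<..} y \<partial>lborel) = (\<integral>\<^sup>+\<omega>. f \<omega> \<partial>M)"
proof -
  interpret pair_sigma_finite M lborel ..
  let ?g = "\<lambda>\<omega> (y::real). indicator {0<..} y * (if ennreal y < f \<omega> then 1 else 0) :: ennreal"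
  have [measurable]: "(\<lambda>(\<omega>, y). ?g \<omega> y) \<in> borel_measurable (M \<Otimes>\<^sub>M lborel)" by measurable
  have "(\<integral>\<^sup>+\<omega>. f \<omega> \<partial>M) = (\<integral>\<^sup>+\<omega>. (\<integral>\<^sup>+y. ?g \<omega> y \<partial>lborel) \<partial>M)"
  proof (rule nn_integral_cong)
    fix \<omega>
    have "(\<integral>\<^sup>+y. ?g \<omega> y \<partial>lborel) = (\<integral>\<^sup>+y. indicator ({0<..} \<inter> {y. ennreal y < f \<omega>}) y \<partial>lborel)"
      by (intro nn_integral_cong) (auto simp: indicator_def)
    also have "\<dots> = emeasure lborel ({0<..} \<inter> {y. ennreal y < f \<omega>})" by (intro nn_integral_indicator) measurable
    also have "\<dots> = f \<omega>"
    proof (cases "f \<omega>")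
      case (real r)
      have "{0<..} \<inter> {y. ennreal y < f \<omega>} = {0<..<r}" using real by (auto simp: ennreal_less_iff)
      then show ?thesis using real by simp
    next
      case top
      have eq: "{0<..} \<inter> {y. ennreal y < f \<omega>} = {0::real<..}" using top by auto
      have "ennreal (real n) \<le> emeasure lborel {0::real<..}" for n
        using emeasure_mono[of "{0<..<real n}" "{0<..}" lborel] by (auto simp: subset_eq)
      then have "\<not> emeasure lborel {0::real<..} < top"
        using ennreal_Ex_less_of_nat[of "emeasure lborel {0::real<..}"] by (metis ennreal_of_nat_eq_real_of_nat not_le)
      then have "emeasure lborel {0::real<..} = top" using less_top by blast
      then show ?thesis using top eq by simp
    qed
    finally show "f \<omega> = (\<integral>\<^sup>+y. ?g \<omega> y \<partial>lborel)" by simp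
  qed
  also have "\<dots> = (\<integral>\<^sup>+y. (\<integral>\<^sup>+\<omega>. ?g \<omega> y \<partial>M) \<partial>lborel)" by (rule Fubini'[symmetric]) measurable
  also have "\<dots> = (\<integral>\<^sup>+y. emeasure M {\<omega>\<in>space M. ennreal y < f \<omega>} * indicator {0<..} y \<partial>lborel)"
  proof (rule nn_integral_cong)
    fix y :: real
    have "(\<integral>\<^sup>+\<omega>. ?g \<omega> y \<partial>M) = (\<integral>\<^sup>+\<omega>. indicator {0<..} y * indicator {\<omega>\<in>space M. ennreal y < f \<omega>} \<omega> \<partial>M)"
      by (intro nn_integral_cong) (auto simp: indicator_def)
    also have "\<dots> = indicator {0<..} y * emeasure M {\<omega>\<in>space M. ennreal y < f \<omega>}"
      by (rule nn_integral_cmult_indicator) measurable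
    finally show "(\<integral>\<^sup>+\<omega>. ?g \<omega> y \<partial>M) = emeasure M {\<omega>\<in>space M. ennreal y < f \<omega>} * indicator {0<..} y"
      by (simp add: mult.commute)
  qed
  finally show ?thesis by simp
qed

section \<open>Moderate functions, extended to infinity\<close>

context
  fixes \<Phi> :: "real \<Rightarrow> real"
  assumes \<Phi>: "moderate \<Phi>"
begin

lemma moderate_nonneg: "0 \<le> t \<Longrightarrow> 0 \<le> \<Phi> t"
  using \<Phi> unfolding moderate_def by auto

lemma moderate_mono: "0 \<le> s \<Longrightarrow> s \<le> t \<Longrightarrow> \<Phi> s \<le> \<Phi> t"
  using \<Phi> unfolding moderate_def by (auto simp: mono_on_def)

lemma moderate_zero: "\<Phi> 0 = 0"
  using \<Phi> unfolding moderate_def by auto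

lemma moderate_pos: "0 < t \<Longrightarrow> 0 < \<Phi> t"
  using \<Phi> unfolding moderate_def by (metis less_eq_real_def less_irrefl)

lemma moderate_scale:
  assumes c: "0 \<le> c"
  obtains D where "1 \<le> D" "\<And>t. 0 \<le> t \<Longrightarrow> \<Phi> (c * t) \<le> D * \<Phi> t"
proof -
  obtain \<beta> B where \<beta>: "1 < \<beta>" and B: "\<And>t. 0 < t \<Longrightarrow> \<Phi> (\<beta> * t) / \<Phi> t \<le> B"
    using \<Phi> unfolding moderate_def bdd_above_def by (metis greaterThan_iff image_eqI)
  define B' where "B' = max 1 B"
  have step: "\<Phi> (\<beta> * t) \<le> B' * \<Phi> t" if "0 \<le> t" for t
  proof (cases "t = 0")
    case False
    then have "0 < t" using that by simp
    then have "\<Phi> (\<beta> * t) \<le> B * \<Phi> t" using B[of t] moderate_pos[of t] by (simp add: field_simps)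
    also have "\<dots> \<le> B' * \<Phi> t" using that moderate_nonneg by (intro mult_right_mono) (auto simp: B'_def)
    finally show ?thesis .
  qed (simp add: moderate_zero)
  have it: "\<Phi> (\<beta> ^ n * t) \<le> B' ^ n * \<Phi> t" if "0 \<le> t" for n t
  proof (induction n)
    case (Suc n)
    have "\<Phi> (\<beta> ^ Suc n * t) \<le> B' * \<Phi> (\<beta> ^ n * t)" using step[of "\<beta> ^ n * t"] that \<beta> by (simp add: mult.assoc)
    also have "\<dots> \<le> B' * (B' ^ n * \<Phi> t)" using Suc by (intro mult_left_mono) (auto simp: B'_def)
    finally show ?case by (simp add: mult.assoc)
  qed simp
  obtain n where n: "c < \<beta> ^ n" using real_arch_pow[OF \<beta>] by auto
  show thesis
  proof (rule that)
    show "1 \<le> B' ^ n" by (simp add: B'_def)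
    fix t :: real assume t: "0 \<le> t"
    have "\<Phi> (c * t) \<le> \<Phi> (\<beta> ^ n * t)" using t n c by (intro moderate_mono mult_right_mono) auto
    then show "\<Phi> (c * t) \<le> B' ^ n * \<Phi> t" using it[OF t, of n] by simp
  qed
qed

abbreviation (input) "\<Phi>ext \<equiv> extend_to_infinity \<Phi>"

lemma extend_real: "0 \<le> r \<Longrightarrow> \<Phi>ext (ennreal r) = ennreal (\<Phi> r)"
  by (simp add: extend_to_infinity_def)

text \<open>The value at infinity is a supremum, so a strict lower bound is always witnessed at a
  finite point. This lets the later arguments treat finite and infinite arguments alike.\<close>

lemma less_extend_iff: "y < \<Phi>ext x \<longleftrightarrow> (\<exists>r\<ge>0. ennreal r \<le> x \<and> y < ennreal (\<Phi> r))"
proof (cases x)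
  case (real r)
  show ?thesis unfolding real(2) extend_real[OF real(1)]
  proof
    assume "\<exists>q\<ge>0. ennreal q \<le> ennreal r \<and> y < ennreal (\<Phi> q)"
    then obtain q where "0 \<le> q" "q \<le> r" "y < ennreal (\<Phi> q)" using real(1) by auto
    then show "y < ennreal (\<Phi> r)" using moderate_mono by (meson ennreal_leI less_le_trans)
  qed (use real in auto)
next
  case top
  then show ?thesis by (auto simp: extend_to_infinity_def less_SUP_iff)
qed

lemma extend_mono: "x \<le> z \<Longrightarrow> \<Phi>ext x \<le> \<Phi>ext z"
  using less_extend_iff[of "\<Phi>ext z" x] less_extend_iff[of "\<Phi>ext z" z] by (metis less_irrefl not_le order_trans)

lemma extend_measurable [measurable]: "\<Phi>ext \<in> borel_measurable borel"
  by (rule borel_measurableI_greater)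
    (simp, rule upward_closed_borel, auto intro: less_le_trans[OF _ extend_mono])

lemma extend_scale:
  assumes c: "0 < c" and D: "1 \<le> D" "\<And>t. 0 \<le> t \<Longrightarrow> \<Phi> (c * t) \<le> D * \<Phi> t"
  shows "\<Phi>ext (ennreal c * x) \<le> ennreal D * \<Phi>ext x"
proof (cases x)
  case (real r)
  have "\<Phi>ext (ennreal c * x) = ennreal (\<Phi> (c * r))"
    unfolding real(2) using c real(1) by (simp add: ennreal_mult[symmetric] extend_real)
  also have "\<dots> \<le> ennreal (D * \<Phi> r)" using D(2)[OF real(1)] by (rule ennreal_leI)
  also have "\<dots> = ennreal D * \<Phi>ext x"
    unfolding real(2) extend_real[OF real(1)] using D moderate_nonneg[OF real(1)] by (intro ennreal_mult) auto
  finally show ?thesis .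
next
  case top
  have "ennreal c * x = x" using top c by (simp add: ennreal_mult_top)
  moreover have "1 * \<Phi>ext x \<le> ennreal D * \<Phi>ext x" using D(1) by (intro mult_right_mono) (auto simp: ennreal_leI)
  ultimately show ?thesis by simp
qed

text \<open>\<open>a\<close> is the generalised inverse of \<open>\<Phi>\<close> at
  \<open>y\<close>, positive by right continuity at zero, and \<open>\<kappa> = 3 / 2 * a\<close>.
  If \<open>\<Phi>\<close> exceeds \<open>y\<close> at \<open>x / 4\<close>, then
  \<open>x \<ge> 4 * a > 2 * \<kappa>\<close>; if \<open>x > \<kappa> > a\<close>, then
  \<open>\<Phi>\<close> exceeds \<open>y\<close> at \<open>x\<close>. The scale \<open>4\<close>
  instead of \<open>2\<close> leaves the gaps around \<open>a\<close> that make it irrelevant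
  whether \<open>\<Phi> a\<close> itself exceeds \<open>y\<close>.\<close>

lemma moderate_threshold:
  assumes y: "0 < y" and ex: "0 \<le> r0" "y < \<Phi> r0"
  obtains \<kappa> where "0 < \<kappa>" "\<And>x. ennreal y < \<Phi>ext (ennreal (1 / 4) * x) \<Longrightarrow> ennreal (2 * \<kappa>) < x"
    "\<And>x. ennreal \<kappa> < x \<Longrightarrow> ennreal y < \<Phi>ext x"
proof -
  define S where "S = {r. 0 \<le> r \<and> y < \<Phi> r}"
  define a where "a = Inf S"
  have S: "r0 \<in> S" "bdd_below S" using ex by (auto simp: S_def intro: bdd_belowI[of _ 0])
  have "continuous (at_right 0) \<Phi>" using \<Phi> by (auto simp: moderate_def cadlag_def)
  then have "(\<Phi> \<longlongrightarrow> 0) (at_right 0)" by (simp add: continuous_within moderate_zero)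
  then have "\<forall>\<^sub>F r in at_right 0. \<Phi> r < y" using y by (rule order_tendstoD)
  then obtain d where d: "0 < d" "\<And>r. 0 < r \<Longrightarrow> r < d \<Longrightarrow> \<Phi> r < y" unfolding eventually_at_right_field by auto
  have "d \<le> r" if "r \<in> S" for r
  proof (rule ccontr)
    assume "\<not> d \<le> r"
    then have "\<Phi> r \<le> y" using d(2)[of r] that moderate_zero y by (cases "r = 0") (auto simp: S_def)
    then show False using that by (simp add: S_def)
  qed
  then have "d \<le> a" unfolding a_def using S by (intro cInf_greatest) auto
  then have a: "0 < a" using d by simp
  show thesis
  proof (rule that)
    show "0 < 3 / 2 * a" using a by simp
    fix x
    show "ennreal (2 * (3 / 2 * a)) < x" if lt: "ennreal y < \<Phi>ext (ennreal (1 / 4) * x)"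
    proof -
      obtain r where r: "0 \<le> r" "ennreal r \<le> ennreal (1 / 4) * x" "y < \<Phi> r"
        using lt y unfolding less_extend_iff by (auto simp: ennreal_less_iff)
      then have "a \<le> r" unfolding a_def using S by (intro cInf_lower) (auto simp: S_def)
      have "ennreal (4 * r) = ennreal 4 * ennreal r" using r by (intro ennreal_mult) auto
      also have "\<dots> \<le> ennreal 4 * (ennreal (1 / 4) * x)" using r(2) by (rule mult_left_mono) simp
      also have "\<dots> = x" by (simp add: mult.assoc[symmetric] ennreal_mult[symmetric] del: ennreal_numeral)
      finally show ?thesis using \<open>a \<le> r\<close> a by (intro ennreal_less_mono[of _ "4 * r"]) auto
    qed
    show "ennreal y < \<Phi>ext x" if "ennreal (3 / 2 * a) < x"
    proof -
      have ne: "S \<noteq> {}" using S by auto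
      have "Inf S < 3 / 2 * a" using a by (simp add: a_def)
      then obtain r where r: "r \<in> S" "r < 3 / 2 * a" unfolding cInf_less_iff[OF ne S(2)] by blast
      then have "ennreal r \<le> x" using that by (meson ennreal_leI less_imp_le order_trans)
      then show ?thesis using r y unfolding less_extend_iff S_def by (auto simp: ennreal_less_iff)
    qed
  qed
qed

text \<open>Boundedness of \<open>U\<close> makes its integral finite, so that it can be absorbed into the left-hand side.\<close>

lemma good_lambda_moderate_bounded:
  assumes M: "prob_space M" and [measurable]: "U \<in> borel_measurable M" "V \<in> borel_measurable M"
    and \<delta>: "0 < \<delta>" and \<epsilon>: "0 \<le> \<epsilon>"
    and gl: "\<And>\<kappa>. 0 < \<kappa> \<Longrightarrow> measure M {\<omega>\<in>space M. ennreal (2 * \<kappa>) < U \<omega> \<and> V \<omega> \<le> ennreal (\<delta> * \<kappa>)} \<le> \<epsilon> * measure M {\<omega>\<in>space M. ennreal \<kappa> < U \<omega>}"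
    and D: "1 \<le> D" "\<And>t. 0 \<le> t \<Longrightarrow> \<Phi> (4 * t) \<le> D * \<Phi> t" "\<epsilon> * D \<le> 1 / 2"
    and D': "1 \<le> D'" "\<And>t. 0 \<le> t \<Longrightarrow> \<Phi> (1 / \<delta> * t) \<le> D' * \<Phi> t"
    and bdd: "\<And>\<omega>. \<omega> \<in> space M \<Longrightarrow> U \<omega> \<le> ennreal (real n)"
  shows "(\<integral>\<^sup>+\<omega>. \<Phi>ext (U \<omega>) \<partial>M) \<le> ennreal (2 * D * D') * (\<integral>\<^sup>+\<omega>. \<Phi>ext (V \<omega>) \<partial>M)"
proof -
  interpret prob_space M by (rule M)
  let ?U4 = "\<lambda>\<omega>. ennreal (1 / 4) * U \<omega>" and ?Vd = "\<lambda>\<omega>. ennreal (1 / \<delta>) * V \<omega>"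
  \<comment> \<open>The good-lambda inequality in terms of the levels \<open>y\<close> of
    \<open>\<Phi>\<close>: either \<open>V \<le> \<delta> * \<kappa>\<close> and it applies, or
    \<open>V / \<delta> > \<kappa>\<close> and \<open>\<Phi>\<close> of it exceeds \<open>y\<close>.
    Integration over \<open>y\<close> is the layer cake formula.\<close>
  have lev: "emeasure M {\<omega>\<in>space M. ennreal y < \<Phi>ext (?U4 \<omega>)} \<le> ennreal \<epsilon> * emeasure M {\<omega>\<in>space M. ennreal y < \<Phi>ext (U \<omega>)} + emeasure M {\<omega>\<in>space M. ennreal y < \<Phi>ext (?Vd \<omega>)}"
    if y: "0 < y" for y
  proof (cases "\<exists>r\<ge>0. y < \<Phi> r")
    case False
    then have "\<not> ennreal y < \<Phi>ext x" for x using y unfolding less_extend_iff by (auto simp: ennreal_less_iff)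
    then show ?thesis by simp
  next
    case True
    then obtain r0 where "0 \<le> r0" "y < \<Phi> r0" by auto
    from moderate_threshold[OF y this] obtain \<kappa> where \<kappa>: "0 < \<kappa>"
      "\<And>x. ennreal y < \<Phi>ext (ennreal (1 / 4) * x) \<Longrightarrow> ennreal (2 * \<kappa>) < x" "\<And>x. ennreal \<kappa> < x \<Longrightarrow> ennreal y < \<Phi>ext x" by blast
    let ?A = "{\<omega>\<in>space M. ennreal (2 * \<kappa>) < U \<omega> \<and> V \<omega> \<le> ennreal (\<delta> * \<kappa>)}" and ?B = "{\<omega>\<in>space M. ennreal y < \<Phi>ext (?Vd \<omega>)}"
    have Bm: "?B \<in> events" by measurable
    have V: "ennreal \<kappa> < ennreal (1 / \<delta>) * x" if "ennreal (\<delta> * \<kappa>) < x" for x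
    proof (cases x)
      case (real r)
      then have "\<delta> * \<kappa> < r" using that \<delta> \<kappa>(1) by (simp add: ennreal_less_iff)
      then have "\<kappa> < 1 / \<delta> * r" using \<delta> by (simp add: field_simps)
      then show ?thesis using real \<delta> \<kappa>(1) by (simp add: ennreal_mult[symmetric] ennreal_less_iff)
    next
      case top
      then show ?thesis using \<delta> by (simp add: ennreal_mult_top)
    qed
    have "{\<omega>\<in>space M. ennreal y < \<Phi>ext (?U4 \<omega>)} \<subseteq> ?A \<union> ?B"
    proof
      fix \<omega> assume h: "\<omega> \<in> {\<omega>\<in>space M. ennreal y < \<Phi>ext (?U4 \<omega>)}"
      show "\<omega> \<in> ?A \<union> ?B"
      proof (cases "V \<omega> \<le> ennreal (\<delta> * \<kappa>)")
        case False
        then have "ennreal y < \<Phi>ext (?Vd \<omega>)" by (intro \<kappa>(3) V) simp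
        then show ?thesis using h by auto
      qed (use h \<kappa>(2) in auto)
    qed
    then have "emeasure M {\<omega>\<in>space M. ennreal y < \<Phi>ext (?U4 \<omega>)} \<le> emeasure M (?A \<union> ?B)" by (rule emeasure_mono) measurable
    also have "\<dots> \<le> emeasure M ?A + emeasure M ?B" by (rule emeasure_subadditive) measurable
    also have "emeasure M ?A \<le> ennreal \<epsilon> * emeasure M {\<omega>\<in>space M. ennreal y < \<Phi>ext (U \<omega>)}"
    proof -
      have "emeasure M ?A \<le> ennreal (\<epsilon> * prob {\<omega>\<in>space M. ennreal \<kappa> < U \<omega>})"
        using gl[OF \<kappa>(1)] by (simp add: emeasure_eq_measure ennreal_leI)
      also have "\<dots> = ennreal \<epsilon> * emeasure M {\<omega>\<in>space M. ennreal \<kappa> < U \<omega>}"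
        using \<epsilon> by (simp add: emeasure_eq_measure ennreal_mult)
      also have "\<dots> \<le> ennreal \<epsilon> * emeasure M {\<omega>\<in>space M. ennreal y < \<Phi>ext (U \<omega>)}"
      proof (intro mult_left_mono emeasure_mono)
        show "{\<omega>\<in>space M. ennreal \<kappa> < U \<omega>} \<subseteq> {\<omega>\<in>space M. ennreal y < \<Phi>ext (U \<omega>)}" using \<kappa>(3) by auto
        show "{\<omega>\<in>space M. ennreal y < \<Phi>ext (U \<omega>)} \<in> events" by measurable
      qed simp
      finally show ?thesis .
    qed
    finally show ?thesis by (simp add: add_right_mono)
  qed
  define I K where "I = (\<integral>\<^sup>+\<omega>. \<Phi>ext (U \<omega>) \<partial>M)" and "K = (\<integral>\<^sup>+\<omega>. \<Phi>ext (V \<omega>) \<partial>M)"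
  have "(\<integral>\<^sup>+\<omega>. \<Phi>ext (?U4 \<omega>) \<partial>M) = (\<integral>\<^sup>+y. emeasure M {\<omega>\<in>space M. ennreal y < \<Phi>ext (?U4 \<omega>)} * indicator {0<..} y \<partial>lborel)"
    by (rule nn_integral_layer_cake[symmetric]) measurable
  also have "\<dots> \<le> (\<integral>\<^sup>+y. ennreal \<epsilon> * (emeasure M {\<omega>\<in>space M. ennreal y < \<Phi>ext (U \<omega>)} * indicator {0<..} y) + emeasure M {\<omega>\<in>space M. ennreal y < \<Phi>ext (?Vd \<omega>)} * indicator {0<..} y \<partial>lborel)"
    using lev by (intro nn_integral_mono) (auto simp: indicator_def)
  also have "\<dots> = ennreal \<epsilon> * (\<integral>\<^sup>+y. emeasure M {\<omega>\<in>space M. ennreal y < \<Phi>ext (U \<omega>)} * indicator {0<..} y \<partial>lborel) + (\<integral>\<^sup>+y. emeasure M {\<omega>\<in>space M. ennreal y < \<Phi>ext (?Vd \<omega>)} * indicator {0<..} y \<partial>lborel)"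
    by (subst nn_integral_add, measurable) (subst nn_integral_cmult, measurable)
  also have "\<dots> = ennreal \<epsilon> * I + (\<integral>\<^sup>+\<omega>. \<Phi>ext (?Vd \<omega>) \<partial>M)"
    unfolding I_def by (subst (1 2) nn_integral_layer_cake) measurable
  also have "(\<integral>\<^sup>+\<omega>. \<Phi>ext (?Vd \<omega>) \<partial>M) \<le> (\<integral>\<^sup>+\<omega>. ennreal D' * \<Phi>ext (V \<omega>) \<partial>M)"
    using \<delta> D' by (intro nn_integral_mono extend_scale) auto
  also have "\<dots> = ennreal D' * K" unfolding K_def by (rule nn_integral_cmult) measurable
  finally have J: "(\<integral>\<^sup>+\<omega>. \<Phi>ext (?U4 \<omega>) \<partial>M) \<le> ennreal \<epsilon> * I + ennreal D' * K" by (simp add: add_left_mono)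
  have "I \<le> (\<integral>\<^sup>+\<omega>. ennreal D * \<Phi>ext (?U4 \<omega>) \<partial>M)"
    unfolding I_def
  proof (rule nn_integral_mono)
    fix \<omega>
    have "U \<omega> = ennreal 4 * ?U4 \<omega>" by (simp add: mult.assoc[symmetric] ennreal_mult[symmetric] del: ennreal_numeral)
    then show "\<Phi>ext (U \<omega>) \<le> ennreal D * \<Phi>ext (?U4 \<omega>)" using extend_scale[of 4 D "?U4 \<omega>"] D by simp
  qed
  also have "\<dots> = ennreal D * (\<integral>\<^sup>+\<omega>. \<Phi>ext (?U4 \<omega>) \<partial>M)" by (rule nn_integral_cmult) measurable
  also have "\<dots> \<le> ennreal D * (ennreal \<epsilon> * I + ennreal D' * K)" using J by (rule mult_left_mono) simp
  finally have main: "I \<le> ennreal D * (ennreal \<epsilon> * I + ennreal D' * K)" .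
  \<comment> \<open>The finiteness of \<open>I\<close> allows the term
    \<open>\<epsilon> * D * I\<close>, at most half of \<open>I\<close>, to be subtracted.\<close>
  have "I \<le> (\<integral>\<^sup>+\<omega>. ennreal (\<Phi> (real n)) \<partial>M)"
    unfolding I_def using extend_mono[OF bdd] by (intro nn_integral_mono) (simp add: extend_real)
  also have "\<dots> < \<infinity>" by (simp add: emeasure_space_1)
  finally obtain i where i: "I = ennreal i" "0 \<le> i" by (cases I) auto
  have "I \<le> ennreal (2 * D * D') * K"
  proof (cases K)
    case (real k)
    have "ennreal i \<le> ennreal (D * (\<epsilon> * i + D' * k))"
      using main D D' \<epsilon> real i by (simp add: ennreal_mult ennreal_plus)
    then have "i \<le> D * (\<epsilon> * i + D' * k)" using D D' \<epsilon> real i by (simp add: ennreal_le_iff)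
    also have "\<dots> = (\<epsilon> * D) * i + D * D' * k" by (simp add: algebra_simps)
    also have "(\<epsilon> * D) * i \<le> 1 / 2 * i" using D(3) i(2) by (rule mult_right_mono)
    finally have "i \<le> 2 * D * D' * k" by simp
    then show ?thesis using i real D D' by (simp add: ennreal_mult[symmetric] ennreal_leI)
  next
    case top
    have "D \<noteq> 0" "D' \<noteq> 0" "0 < 2 * D * D'" using D(1) D'(1) by auto
    then show ?thesis using top by (simp add: ennreal_mult_top)
  qed
  then show ?thesis by (simp add: I_def K_def)
qed

text \<open>The truncation of \<open>U\<close> at \<open>n\<close> inherits the hypothesis with the
  same constants: for \<open>2 * \<kappa> < n\<close> neither event involving \<open>U\<close>
  changes, and otherwise the left event is empty. The bound is uniform in \<open>n\<close>, so
  monotone convergence applies.\<close>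

lemma good_lambda_moderate:
  assumes M: "prob_space M" and U[measurable]: "U \<in> borel_measurable M" and V[measurable]: "V \<in> borel_measurable M"
    and \<delta>: "0 < \<delta>" and \<epsilon>: "0 \<le> \<epsilon>"
    and gl: "\<And>\<kappa>. 0 < \<kappa> \<Longrightarrow> measure M {\<omega>\<in>space M. ennreal (2 * \<kappa>) < U \<omega> \<and> V \<omega> \<le> ennreal (\<delta> * \<kappa>)} \<le> \<epsilon> * measure M {\<omega>\<in>space M. ennreal \<kappa> < U \<omega>}"
    and D: "1 \<le> D" "\<And>t. 0 \<le> t \<Longrightarrow> \<Phi> (4 * t) \<le> D * \<Phi> t" "\<epsilon> * D \<le> 1 / 2"
    and D': "1 \<le> D'" "\<And>t. 0 \<le> t \<Longrightarrow> \<Phi> (1 / \<delta> * t) \<le> D' * \<Phi> t"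
  shows "(\<integral>\<^sup>+\<omega>. \<Phi>ext (U \<omega>) \<partial>M) \<le> ennreal (2 * D * D') * (\<integral>\<^sup>+\<omega>. \<Phi>ext (V \<omega>) \<partial>M)"
proof -
  define Uc where "Uc n \<omega> = min (U \<omega>) (ennreal (real n))" for n \<omega>
  have [measurable]: "Uc n \<in> borel_measurable M" for n unfolding Uc_def by measurable
  have bound: "(\<integral>\<^sup>+\<omega>. \<Phi>ext (Uc n \<omega>) \<partial>M) \<le> ennreal (2 * D * D') * (\<integral>\<^sup>+\<omega>. \<Phi>ext (V \<omega>) \<partial>M)" for n
  proof (rule good_lambda_moderate_bounded[where n = n, OF M _ V \<delta> \<epsilon> _ D D'])
    fix \<kappa> :: real assume \<kappa>: "0 < \<kappa>"
    show "measure M {\<omega>\<in>space M. ennreal (2 * \<kappa>) < Uc n \<omega> \<and> V \<omega> \<le> ennreal (\<delta> * \<kappa>)} \<le> \<epsilon> * measure M {\<omega>\<in>space M. ennreal \<kappa> < Uc n \<omega>}"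
    proof (cases "2 * \<kappa> < real n")
      case True
      then have "ennreal (2 * \<kappa>) < Uc n \<omega> \<longleftrightarrow> ennreal (2 * \<kappa>) < U \<omega>" "ennreal \<kappa> < Uc n \<omega> \<longleftrightarrow> ennreal \<kappa> < U \<omega>" for \<omega>
        using \<kappa> by (auto simp: Uc_def ennreal_lessI)
      then show ?thesis using gl[OF \<kappa>] by simp
    next
      case False
      then have "ennreal (real n) \<le> ennreal (2 * \<kappa>)" by (intro ennreal_leI) simp
      then have "\<not> ennreal (2 * \<kappa>) < Uc n \<omega>" for \<omega> by (auto simp: Uc_def not_less min_le_iff_disj)
      then show ?thesis using \<epsilon> by simp
    qed
  qed (auto simp: Uc_def)
  have "(\<integral>\<^sup>+\<omega>. \<Phi>ext (U \<omega>) \<partial>M) \<le> (\<integral>\<^sup>+\<omega>. (SUP n. \<Phi>ext (Uc n \<omega>)) \<partial>M)"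
  proof (rule nn_integral_mono)
    fix \<omega>
    show "\<Phi>ext (U \<omega>) \<le> (SUP n. \<Phi>ext (Uc n \<omega>))"
    proof (rule ccontr)
      assume "\<not> ?thesis"
      then obtain r where r: "0 \<le> r" "ennreal r \<le> U \<omega>" "(SUP n. \<Phi>ext (Uc n \<omega>)) < ennreal (\<Phi> r)"
        unfolding not_le less_extend_iff by auto
      obtain n :: nat where n: "r \<le> real n" using real_arch_simple by auto
      have "ennreal r \<le> Uc n \<omega>" using r(2) n by (simp add: Uc_def ennreal_leI)
      then have "\<Phi>ext (ennreal r) \<le> \<Phi>ext (Uc n \<omega>)" by (rule extend_mono)
      also have "\<dots> \<le> (SUP n. \<Phi>ext (Uc n \<omega>))" by (rule SUP_upper) simp
      finally show False using r by (simp add: extend_real)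
    qed
  qed
  also have "\<dots> = (SUP n. (\<integral>\<^sup>+\<omega>. \<Phi>ext (Uc n \<omega>) \<partial>M))"
  proof (rule nn_integral_monotone_convergence_SUP)
    show "incseq (\<lambda>n \<omega>. \<Phi>ext (Uc n \<omega>))"
      by (intro incseq_SucI le_funI extend_mono) (auto simp: Uc_def min_def intro: ennreal_leI order_trans)
  qed measurable
  also have "\<dots> \<le> ennreal (2 * D * D') * (\<integral>\<^sup>+\<omega>. \<Phi>ext (V \<omega>) \<partial>M)" by (rule SUP_least) (rule bound)
  finally show ?thesis .
qed

end

lemma moderate_powr:
  assumes p: "0 < p"
  shows "moderate (\<lambda>t. t powr p)"
proof -
  \<comment> \<open>At \<open>0\<close> only the limit from the right is taken; there
    \<open>p > 0\<close> and eventual nonnegativity of the base are required, hence the condition on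
    \<open>S\<close>.\<close>
  have lim: "((\<lambda>t. t powr p) \<longlongrightarrow> t powr p) (at t within S)" if "0 \<le> t" "t \<noteq> 0 \<or> S = {0<..}" for t S
  proof (rule tendsto_powr'[OF tendsto_ident_at tendsto_const])
    show "t \<noteq> 0 \<or> 0 < p \<and> (\<forall>\<^sub>F x in at t within S. 0 \<le> x)"
      using that p by (auto simp: eventually_at_filter)
  qed
  have "cadlag (\<lambda>t. t powr p)"
    unfolding cadlag_def
  proof (intro conjI allI impI)
    show "continuous (at_right t) (\<lambda>t. t powr p)" if "0 \<le> t" for t :: real
      unfolding continuous_within using that by (intro lim) auto
    show "\<exists>l. ((\<lambda>t. t powr p) \<longlongrightarrow> l) (at_left t)" if "0 < t" for t :: real
      using that lim[of t "{..<t}"] by auto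
  qed
  moreover have "mono_on {0..} (\<lambda>t::real. t powr p)"
    using p by (auto simp: mono_on_def intro: powr_mono2)
  moreover have "bdd_above ((\<lambda>t. (2 * t) powr p / t powr p) ` {0<..})"
    by (rule bdd_aboveI[of _ "2 powr p"]) (auto simp: powr_mult)
  ultimately show ?thesis unfolding moderate_def by (auto intro: exI[of _ 2])
qed

section \<open>The Burkholder-Davis-Gundy inequalities for a regularised Bessel process\<close>

context bessel
begin

definition max_at :: "('a \<Rightarrow> ennreal) \<Rightarrow> 'a \<Rightarrow> ennreal" where
  "max_at \<tau> = at_time (running_max X) \<tau>"

text \<open>The square root of \<open>[X]\<close> at \<open>\<tau>\<close>, with the closed form of
  \<open>[X]\<close> built in; \<open>quadratic_variation_eq\<close> justifies it.\<close>

definition root_at :: "('a \<Rightarrow> ennreal) \<Rightarrow> 'a \<Rightarrow> ennreal" where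
  "root_at \<tau> = at_time (\<lambda>t \<omega>. sqrt ((X 0 \<omega>)\<^sup>2 + t)) \<tau>"

lemma less_running_max_iff:
  assumes w: "\<omega> \<in> space M" and T: "0 \<le> T"
  shows "c < running_max X T \<omega> \<longleftrightarrow> (\<exists>t\<in>{0..T}. c < X t \<omega>)"
proof -
  have "continuous_on {0..T} (\<lambda>u. \<bar>X u \<omega>\<bar>)"
    by (intro continuous_intros continuous_on_subset[OF X_cont[OF w]]) auto
  then have "bdd_above ((\<lambda>u. \<bar>X u \<omega>\<bar>) ` {0..T})"
    by (intro bounded_imp_bdd_above compact_imp_bounded compact_continuous_image) auto
  then have "c < running_max X T \<omega> \<longleftrightarrow> (\<exists>t\<in>{0..T}. c < \<bar>X t \<omega>\<bar>)"
    unfolding running_max_def using T by (subst less_cSUP_iff) auto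
  also have "\<dots> \<longleftrightarrow> (\<exists>t\<in>{0..T}. c < X t \<omega>)" using X_nonneg[OF w] by (intro bex_cong) auto
  finally show ?thesis .
qed

text \<open>A strict inequality for a supremum is witnessed at a finite time, also when
  \<open>\<tau>\<close> is infinite. This gives the event used by the good-lambda
  inequalities.\<close>

lemma less_max_at_iff:
  assumes w: "\<omega> \<in> space M" and c: "0 \<le> c"
  shows "ennreal c < max_at \<tau> \<omega> \<longleftrightarrow> (\<exists>t\<ge>0. ennreal t \<le> \<tau> \<omega> \<and> c < X t \<omega>)"
proof (cases "\<tau> \<omega>")
  case (real T)
  have "ennreal c < max_at \<tau> \<omega> \<longleftrightarrow> c < running_max X T \<omega>"
    using real c by (simp add: max_at_def at_time_def ennreal_less_iff)
  then show ?thesis unfolding less_running_max_iff[OF w real(1)] using real by auto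
next
  case top
  have "ennreal c < max_at \<tau> \<omega> \<longleftrightarrow> (\<exists>T\<in>{0..}. ennreal c < ennreal (running_max X T \<omega>))"
    using top by (simp add: max_at_def at_time_def less_SUP_iff)
  also have "\<dots> \<longleftrightarrow> (\<exists>T\<in>{0..}. \<exists>t\<in>{0..T}. c < X t \<omega>)"
    using c less_running_max_iff[OF w] by (intro bex_cong) (auto simp: ennreal_less_iff)
  also have "\<dots> \<longleftrightarrow> (\<exists>t\<ge>0. ennreal t \<le> \<tau> \<omega> \<and> c < X t \<omega>)"
    unfolding top by (metis atLeastAtMost_iff atLeast_iff order_refl top_greatest)
  finally show ?thesis .
qed

lemma root_at_eq: "root_at \<tau> \<omega> = (if \<tau> \<omega> = \<infinity> then \<infinity> else ennreal (sqrt ((X 0 \<omega>)\<^sup>2 + enn2real (\<tau> \<omega>))))"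
proof -
  have "(SUP t\<in>{0..}. ennreal (sqrt ((X 0 \<omega>)\<^sup>2 + t))) = top"
  proof (rule ccontr)
    assume "(SUP t\<in>{0..}. ennreal (sqrt ((X 0 \<omega>)\<^sup>2 + t))) \<noteq> top"
    then have "(SUP t\<in>{0..}. ennreal (sqrt ((X 0 \<omega>)\<^sup>2 + t))) < top" using less_top by blast
    then obtain n where n: "(SUP t\<in>{0..}. ennreal (sqrt ((X 0 \<omega>)\<^sup>2 + t))) < of_nat n"
      using ennreal_Ex_less_of_nat by blast
    have "ennreal (real n) \<le> ennreal (sqrt ((X 0 \<omega>)\<^sup>2 + (real n)\<^sup>2))"
      by (intro ennreal_leI real_le_rsqrt) simp
    also have "\<dots> \<le> (SUP t\<in>{0..}. ennreal (sqrt ((X 0 \<omega>)\<^sup>2 + t)))" by (rule SUP_upper) simp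
    finally show False using n by (simp add: ennreal_of_nat_eq_real_of_nat)
  qed
  then show ?thesis by (simp add: root_at_def at_time_def)
qed

lemma max_at_measurable:
  assumes \<tau>: "ext_stopping_time F \<tau>"
  shows "max_at \<tau> \<in> borel_measurable M"
proof (rule borel_measurableI_greater)
  fix y :: ennreal
  show "{\<omega>\<in>space M. y < max_at \<tau> \<omega>} \<in> events"
  proof (cases y)
    case (real c)
    have "{\<omega>\<in>space M. y < max_at \<tau> \<omega>} = {\<omega>\<in>space M. \<exists>t\<ge>0. ennreal t \<le> \<tau> \<omega> \<and> c < X t \<omega>}"
      unfolding real(2) using less_max_at_iff[OF _ real(1)] by blast
    then show ?thesis using exceed_event_sets[OF \<tau>, of c] by (simp only:)
  qed simp
qed

lemma root_at_measurable:
  assumes \<tau>: "ext_stopping_time F \<tau>"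
  shows "root_at \<tau> \<in> borel_measurable M"
proof -
  have [measurable]: "\<tau> \<in> borel_measurable M" "X 0 \<in> borel_measurable M" using stopping_time_measurable[OF \<tau>] X_M by auto
  have "root_at \<tau> = (\<lambda>\<omega>. if \<tau> \<omega> = \<infinity> then \<infinity> else ennreal (sqrt ((X 0 \<omega>)\<^sup>2 + enn2real (\<tau> \<omega>))))"
    by (rule ext) (rule root_at_eq)
  then show ?thesis by (simp only:) measurable
qed

lemma root_at_leD:
  assumes w: "\<omega> \<in> space M" and v: "0 \<le> v" and le: "root_at \<tau> \<omega> \<le> ennreal v"
  shows "\<tau> \<omega> \<le> ennreal (v\<^sup>2) \<and> X 0 \<omega> \<le> v"
proof -
  have fin: "\<tau> \<omega> \<noteq> \<infinity>" using le by (auto simp: root_at_eq top_unique)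
  then obtain T where T: "\<tau> \<omega> = ennreal T" "0 \<le> T" by (cases "\<tau> \<omega>") auto
  have "sqrt ((X 0 \<omega>)\<^sup>2 + T) \<le> v" using le v fin T by (simp add: root_at_eq)
  then have le2: "(X 0 \<omega>)\<^sup>2 + T \<le> v\<^sup>2" using T by (simp add: sqrt_le_D)
  then have "T \<le> v\<^sup>2" using zero_le_power2[of "X 0 \<omega>"] by linarith
  moreover have "(X 0 \<omega>)\<^sup>2 \<le> v\<^sup>2" using le2 T by linarith
  then have "X 0 \<omega> \<le> v" using v by (rule power2_le_imp_le)
  ultimately show ?thesis unfolding T(1) by (auto intro: ennreal_leI)
qed

lemma less_root_at:
  assumes v: "0 \<le> v" and lt: "ennreal (v\<^sup>2) < \<tau> \<omega>"
  shows "ennreal v < root_at \<tau> \<omega>"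
proof (cases "\<tau> \<omega>")
  case (real T)
  have "v\<^sup>2 < T" using lt real by (simp add: ennreal_less_iff)
  then have "v\<^sup>2 < (X 0 \<omega>)\<^sup>2 + T" using zero_le_power2[of "X 0 \<omega>"] by linarith
  then have "v < sqrt ((X 0 \<omega>)\<^sup>2 + T)" by (rule real_less_rsqrt)
  then show ?thesis using real v by (simp add: root_at_eq ennreal_less_iff)
next
  case top
  then show ?thesis by (simp add: root_at_eq)
qed

lemma max_root_good_lambda:
  assumes \<tau>: "ext_stopping_time F \<tau>" and \<kappa>: "0 < \<kappa>" and \<delta>: "0 < \<delta>" "\<alpha> * \<delta>\<^sup>2 \<le> 1 / 4"
  shows "prob {\<omega>\<in>space M. ennreal (2 * \<kappa>) < max_at \<tau> \<omega> \<and> root_at \<tau> \<omega> \<le> ennreal (\<delta> * \<kappa>)}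
    \<le> 36 * \<delta>\<^sup>2 * prob {\<omega>\<in>space M. ennreal \<kappa> < max_at \<tau> \<omega>}"
proof -
  let ?E = "{\<omega>\<in>space M. (\<exists>t\<ge>0. ennreal t \<le> \<tau> \<omega> \<and> 2 * \<kappa> < X t \<omega>) \<and> \<tau> \<omega> \<le> ennreal (\<delta>\<^sup>2 * \<kappa>\<^sup>2) \<and> X 0 \<omega> \<le> \<delta> * \<kappa>}"
  have [measurable]: "\<tau> \<in> borel_measurable M" "X 0 \<in> borel_measurable M" using stopping_time_measurable[OF \<tau>] X_M by auto
  have "{\<omega>\<in>space M. ennreal (2 * \<kappa>) < max_at \<tau> \<omega> \<and> root_at \<tau> \<omega> \<le> ennreal (\<delta> * \<kappa>)} \<subseteq> ?E"
  proof safe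
    fix \<omega> assume w: "\<omega> \<in> space M" and U: "ennreal (2 * \<kappa>) < max_at \<tau> \<omega>" and V: "root_at \<tau> \<omega> \<le> ennreal (\<delta> * \<kappa>)"
    show "\<exists>t\<ge>0. ennreal t \<le> \<tau> \<omega> \<and> 2 * \<kappa> < X t \<omega>" using U less_max_at_iff[OF w, of "2 * \<kappa>" \<tau>] \<kappa> by auto
    have "0 \<le> \<delta> * \<kappa>" using \<delta> \<kappa> by simp
    from root_at_leD[OF w this V] show "\<tau> \<omega> \<le> ennreal (\<delta>\<^sup>2 * \<kappa>\<^sup>2)" "X 0 \<omega> \<le> \<delta> * \<kappa>"
      by (simp_all add: power_mult_distrib)
  qed
  moreover have "?E \<in> events"
  proof -
    have "{\<omega>\<in>space M. \<tau> \<omega> \<le> ennreal (\<delta>\<^sup>2 * \<kappa>\<^sup>2) \<and> X 0 \<omega> \<le> \<delta> * \<kappa>} \<in> events" by measurable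
    from sets.Int[OF exceed_event_sets[OF \<tau>, of "2 * \<kappa>"] this] show ?thesis
      by (rule back_subst[of "\<lambda>A. A \<in> events"]) auto
  qed
  ultimately have "prob {\<omega>\<in>space M. ennreal (2 * \<kappa>) < max_at \<tau> \<omega> \<and> root_at \<tau> \<omega> \<le> ennreal (\<delta> * \<kappa>)} \<le> prob ?E"
    by (rule finite_measure_mono)
  also have "\<dots> \<le> 36 * \<delta>\<^sup>2 * prob {\<omega>\<in>space M. \<exists>t\<ge>0. ennreal t \<le> \<tau> \<omega> \<and> \<kappa> < X t \<omega>}"
    by (rule max_good_lambda[OF \<tau> \<kappa> \<delta>])
  also have "{\<omega>\<in>space M. \<exists>t\<ge>0. ennreal t \<le> \<tau> \<omega> \<and> \<kappa> < X t \<omega>} = {\<omega>\<in>space M. ennreal \<kappa> < max_at \<tau> \<omega>}"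
    using less_max_at_iff[of _ \<kappa> \<tau>] \<kappa> by (intro Collect_cong) (auto simp del: ennreal_less_iff)
  finally show ?thesis .
qed

lemma root_max_good_lambda:
  assumes \<tau>: "ext_stopping_time F \<tau>" and \<kappa>: "0 < \<kappa>" and \<delta>: "0 < \<delta>" "\<delta>\<^sup>2 \<le> 1 / 2"
  shows "prob {\<omega>\<in>space M. ennreal (2 * \<kappa>) < root_at \<tau> \<omega> \<and> max_at \<tau> \<omega> \<le> ennreal (\<delta> * \<kappa>)}
    \<le> 8 * \<delta>\<^sup>2 * prob {\<omega>\<in>space M. ennreal \<kappa> < root_at \<tau> \<omega>}"
proof -
  let ?E = "{\<omega>\<in>space M. ennreal (3 * \<kappa>\<^sup>2) \<le> \<tau> \<omega> \<and> (\<forall>t\<ge>0. ennreal t \<le> \<tau> \<omega> \<longrightarrow> X t \<omega> \<le> \<delta> * \<kappa>)}"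
  note [measurable] = stopping_time_measurable[OF \<tau>] root_at_measurable[OF \<tau>]
  have dk: "0 \<le> \<delta> * \<kappa>" using \<delta> \<kappa> by simp
  have "{\<omega>\<in>space M. ennreal (2 * \<kappa>) < root_at \<tau> \<omega> \<and> max_at \<tau> \<omega> \<le> ennreal (\<delta> * \<kappa>)} \<subseteq> ?E"
  proof
    fix \<omega> assume "\<omega> \<in> {\<omega>\<in>space M. ennreal (2 * \<kappa>) < root_at \<tau> \<omega> \<and> max_at \<tau> \<omega> \<le> ennreal (\<delta> * \<kappa>)}"
    then have w: "\<omega> \<in> space M" and V: "ennreal (2 * \<kappa>) < root_at \<tau> \<omega>" and U: "\<not> ennreal (\<delta> * \<kappa>) < max_at \<tau> \<omega>" by auto
    have le: "X t \<omega> \<le> \<delta> * \<kappa>" if "0 \<le> t" "ennreal t \<le> \<tau> \<omega>" for t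
      using U that unfolding less_max_at_iff[OF w dk] by (meson not_le)
    \<comment> \<open>From \<open>4 * \<kappa>\<^sup>2 < (X 0)\<^sup>2 + \<tau>\<close>, where the
      initial value, being below the maximum, accounts for at most
      \<open>\<kappa>\<^sup>2 / 2\<close>. This is where the long interval
      \<open>[\<kappa>\<^sup>2, 3 * \<kappa>\<^sup>2]\<close> comes from.\<close>
    have "ennreal (3 * \<kappa>\<^sup>2) \<le> \<tau> \<omega>"
    proof (cases "\<tau> \<omega>")
      case (real T)
      have "2 * \<kappa> < sqrt ((X 0 \<omega>)\<^sup>2 + T)" using V real \<kappa> by (simp add: root_at_eq ennreal_less_iff)
      then have "(2 * \<kappa>)\<^sup>2 < (sqrt ((X 0 \<omega>)\<^sup>2 + T))\<^sup>2" using \<kappa> by (intro power_strict_mono) auto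
      then have "4 * \<kappa>\<^sup>2 < (X 0 \<omega>)\<^sup>2 + T" using real by (simp add: power_mult_distrib)
      moreover have "(X 0 \<omega>)\<^sup>2 \<le> (\<delta> * \<kappa>)\<^sup>2" using le[of 0] X_nonneg[OF w, of 0] by (intro power_mono) auto
      moreover have "(\<delta> * \<kappa>)\<^sup>2 \<le> 1 / 2 * \<kappa>\<^sup>2" unfolding power_mult_distrib using \<delta> by (intro mult_right_mono) auto
      ultimately have "3 * \<kappa>\<^sup>2 \<le> T" using zero_le_power2[of \<kappa>] by linarith
      then show ?thesis unfolding real(2) by (rule ennreal_leI)
    qed simp
    then show "\<omega> \<in> ?E" using w le by blast
  qed
  moreover have "?E \<in> events"
  proof -
    have "{\<omega>\<in>space M. ennreal (3 * \<kappa>\<^sup>2) \<le> \<tau> \<omega>} \<in> events" by measurable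
    from sets.Diff[OF this exceed_event_sets[OF \<tau>, of "\<delta> * \<kappa>"]] show ?thesis
      by (rule back_subst[of "\<lambda>A. A \<in> events"]) (auto simp: not_le not_less)
  qed
  ultimately have "prob {\<omega>\<in>space M. ennreal (2 * \<kappa>) < root_at \<tau> \<omega> \<and> max_at \<tau> \<omega> \<le> ennreal (\<delta> * \<kappa>)} \<le> prob ?E"
    by (rule finite_measure_mono)
  also have "\<dots> \<le> 8 * \<delta>\<^sup>2 * prob {\<omega>\<in>space M. ennreal \<kappa> < root_at \<tau> \<omega>}"
    using less_root_at[of \<kappa> \<tau>] \<kappa> by (intro time_good_lambda[OF \<tau> \<kappa> \<delta>]) auto
  finally show ?thesis .
qed

lemma small_delta:
  assumes "0 < (c::real)" "0 < b"
  obtains \<delta> where "0 < \<delta>" "c * \<delta>\<^sup>2 \<le> b"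
  using assms by (intro that[of "sqrt (b / c)"]) auto

theorem bdg_regular:
  assumes \<Phi>: "moderate \<Phi>"
  shows "\<exists>c C :: real. 0 < c \<and> 0 < C \<and> (\<forall>\<tau>. ext_stopping_time F \<tau> \<longrightarrow>
    ennreal c * (\<integral>\<^sup>+\<omega>. extend_to_infinity \<Phi> (root_at \<tau> \<omega>) \<partial>M) \<le> (\<integral>\<^sup>+\<omega>. extend_to_infinity \<Phi> (max_at \<tau> \<omega>) \<partial>M) \<and>
    (\<integral>\<^sup>+\<omega>. extend_to_infinity \<Phi> (max_at \<tau> \<omega>) \<partial>M) \<le> ennreal C * (\<integral>\<^sup>+\<omega>. extend_to_infinity \<Phi> (root_at \<tau> \<omega>) \<partial>M))"
proof -
  obtain D where D: "1 \<le> D" "\<And>t. 0 \<le> t \<Longrightarrow> \<Phi> (4 * t) \<le> D * \<Phi> t" using moderate_scale[OF \<Phi>, of 4] by auto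
  \<comment> \<open>The coefficients of all four smallness conditions on \<open>\<delta>\<close> are
    added up; the terms are nonnegative, so one bound on the sum implies each of them.\<close>
  have "0 < 36 * D + 8 * D + 4 * \<alpha> + 2" using D alpha by simp
  then obtain \<delta> where \<delta>: "0 < \<delta>" "(36 * D + 8 * D + 4 * \<alpha> + 2) * \<delta>\<^sup>2 \<le> 1 / 2" using small_delta[of _ "1 / 2"] by auto
  have p: "0 \<le> D * \<delta>\<^sup>2" "0 \<le> \<alpha> * \<delta>\<^sup>2" "0 \<le> \<delta>\<^sup>2" using D alpha by auto
  have "36 * (D * \<delta>\<^sup>2) + 8 * (D * \<delta>\<^sup>2) + 4 * (\<alpha> * \<delta>\<^sup>2) + 2 * \<delta>\<^sup>2 \<le> 1 / 2" using \<delta>(2) by (simp add: algebra_simps)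
  then have d: "36 * \<delta>\<^sup>2 * D \<le> 1 / 2" "8 * \<delta>\<^sup>2 * D \<le> 1 / 2" "\<alpha> * \<delta>\<^sup>2 \<le> 1 / 4" "\<delta>\<^sup>2 \<le> 1 / 2"
    using p unfolding mult.assoc mult.commute[of "\<delta>\<^sup>2" D] by linarith+
  obtain D' where D': "1 \<le> D'" "\<And>t. 0 \<le> t \<Longrightarrow> \<Phi> (1 / \<delta> * t) \<le> D' * \<Phi> t"
    using moderate_scale[OF \<Phi>, of "1 / \<delta>"] \<delta> by auto
  define C where "C = 2 * D * D'"
  have C: "0 < C" using D D' by (simp add: C_def)
  have 1: "(\<integral>\<^sup>+\<omega>. extend_to_infinity \<Phi> (max_at \<tau> \<omega>) \<partial>M) \<le> ennreal C * (\<integral>\<^sup>+\<omega>. extend_to_infinity \<Phi> (root_at \<tau> \<omega>) \<partial>M)"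
    if \<tau>: "ext_stopping_time F \<tau>" for \<tau>
    unfolding C_def
    by (rule good_lambda_moderate[OF \<Phi> prob_space_axioms max_at_measurable[OF \<tau>] root_at_measurable[OF \<tau>] \<delta>(1) _
          max_root_good_lambda[OF \<tau> _ \<delta>(1) d(3)] D d(1) D']) auto
  have 2: "(\<integral>\<^sup>+\<omega>. extend_to_infinity \<Phi> (root_at \<tau> \<omega>) \<partial>M) \<le> ennreal C * (\<integral>\<^sup>+\<omega>. extend_to_infinity \<Phi> (max_at \<tau> \<omega>) \<partial>M)"
    if \<tau>: "ext_stopping_time F \<tau>" for \<tau>
    unfolding C_def
    by (rule good_lambda_moderate[OF \<Phi> prob_space_axioms root_at_measurable[OF \<tau>] max_at_measurable[OF \<tau>] \<delta>(1) _
          root_max_good_lambda[OF \<tau> _ \<delta>(1) d(4)] D d(2) D']) auto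
  have 3: "ennreal (1 / C) * (\<integral>\<^sup>+\<omega>. extend_to_infinity \<Phi> (root_at \<tau> \<omega>) \<partial>M) \<le> (\<integral>\<^sup>+\<omega>. extend_to_infinity \<Phi> (max_at \<tau> \<omega>) \<partial>M)"
    if \<tau>: "ext_stopping_time F \<tau>" for \<tau>
  proof -
    have "ennreal (1 / C) * (\<integral>\<^sup>+\<omega>. extend_to_infinity \<Phi> (root_at \<tau> \<omega>) \<partial>M) \<le> ennreal (1 / C) * (ennreal C * (\<integral>\<^sup>+\<omega>. extend_to_infinity \<Phi> (max_at \<tau> \<omega>) \<partial>M))"
      using 2[OF \<tau>] by (rule mult_left_mono) simp
    also have "\<dots> = (\<integral>\<^sup>+\<omega>. extend_to_infinity \<Phi> (max_at \<tau> \<omega>) \<partial>M)"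
      using C by (simp add: mult.assoc[symmetric] ennreal_mult[symmetric])
    finally show ?thesis .
  qed
  show ?thesis using 1 3 C by (intro exI[of _ "1 / C"] exI[of _ C]) auto
qed

text \<open>Uniform partitions identify \<open>Q t\<close> almost surely for each fixed
  \<open>t > 0\<close>, as limits in probability are unique. Countably many rational times share one
  null set, and right continuity extends the identity to all times at once.\<close>

lemma quadratic_variation_eq:
  assumes Q: "quadratic_variation M F Y Q" and Y: "AE \<omega> in M. \<forall>t\<ge>0. Y t \<omega> = X t \<omega>"
  shows "AE \<omega> in M. \<forall>t\<ge>0. Q t \<omega> = (X 0 \<omega>)\<^sup>2 + t"
proof -
  have Q0: "AE \<omega> in M. Q 0 \<omega> = (Y 0 \<omega>)\<^sup>2 \<and> mono_on {0..} (\<lambda>t. Q t \<omega>) \<and> (\<forall>t\<ge>0. continuous (at_right t) (\<lambda>t. Q t \<omega>))"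
    and Ql: "\<And>t N \<pi>. 0 \<le> t \<Longrightarrow> refining_partitions t N \<pi> \<Longrightarrow>
      tendsto_in_prob M (\<lambda>n \<omega>. (Y 0 \<omega>)\<^sup>2 + (\<Sum>i<N n. (Y (\<pi> n (Suc i)) \<omega> - Y (\<pi> n i) \<omega>)\<^sup>2)) (Q t)"
    using Q unfolding quadratic_variation_def by blast+
  have at: "AE \<omega> in M. Q t \<omega> = (X 0 \<omega>)\<^sup>2 + t" if t: "0 < t" for t
  proof -
    \<comment> \<open>\<open>Suc n\<close> because the grid with \<open>0\<close> cells does not end
      at \<open>t\<close>.\<close>
    let ?u = "\<lambda>n. ugrid 0 t (Suc n)"
    have "refining_partitions t Suc ?u"
      unfolding refining_partitions_def
    proof (intro conjI allI impI)
      fix \<delta> :: real assume \<delta>: "0 < \<delta>"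
      have "(\<lambda>n. t / real (Suc n)) \<longlonglongrightarrow> 0" using LIMSEQ_Suc[OF lim_const_over_n[of t]] .
      then have "\<forall>\<^sub>F n in sequentially. t / real (Suc n) < \<delta>" using \<delta> by (rule order_tendstoD)
      then show "\<forall>\<^sub>F n in sequentially. \<forall>i<Suc n. ?u n (Suc i) - ?u n i < \<delta>"
        by eventually_elim (simp only: ugrid_Suc_diff diff_zero simp_thms)
    qed (use t in \<open>auto intro: ugrid_Suc_le\<close>)
    from Ql[OF less_imp_le[OF t] this] have tp: "tendsto_in_prob M (\<lambda>n \<omega>. (Y 0 \<omega>)\<^sup>2 + (\<Sum>i<Suc n. (Y (?u n (Suc i)) \<omega> - Y (?u n i) \<omega>)\<^sup>2)) (Q t)" .
    let ?S = "\<lambda>n \<omega>. \<Sum>i<Suc n. (X (?u n (Suc i)) \<omega> - X (?u n i) \<omega>)\<^sup>2"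
    let ?SY = "\<lambda>n \<omega>. (Y 0 \<omega>)\<^sup>2 + (\<Sum>i<Suc n. (Y (?u n (Suc i)) \<omega> - Y (?u n i) \<omega>)\<^sup>2)"
    have Qm[measurable]: "Q t \<in> borel_measurable M" and SYm: "\<And>n. ?SY n \<in> borel_measurable M"
      and lim1: "\<And>e. 0 < e \<Longrightarrow> (\<lambda>n. prob {\<omega>\<in>space M. e < \<bar>?SY n \<omega> - Q t \<omega>\<bar>}) \<longlonglongrightarrow> 0"
      using tp unfolding tendsto_in_prob_def by blast+
    have u: "0 \<le> ?u n i" for n i using ugrid_ge[of 0 t "Suc n" i] t by simp
    have Sm: "?S n \<in> borel_measurable M" for n
      using X_M[OF u] by (intro borel_measurable_sum borel_measurable_power borel_measurable_diff) auto
    have lim2: "(\<lambda>n. prob {\<omega>\<in>space M. e < \<bar>?S n \<omega> - t\<bar>}) \<longlonglongrightarrow> 0" if "0 < e" for e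
      using LIMSEQ_Suc[OF bessel_quadratic_variation[OF t that]] .
    have [measurable]: "X 0 \<in> borel_measurable M" by (rule X_M) simp
    have null: "prob {\<omega>\<in>space M. 2 * e < \<bar>Q t \<omega> - ((X 0 \<omega>)\<^sup>2 + t)\<bar>} = 0" (is "prob ?P = 0") if e: "0 < e" for e
    proof -
      have "prob ?P \<le> prob {\<omega>\<in>space M. e < \<bar>?SY n \<omega> - Q t \<omega>\<bar>} + prob {\<omega>\<in>space M. e < \<bar>?S n \<omega> - t\<bar>}" for n
      proof -
        have A: "{\<omega>\<in>space M. e < \<bar>?SY n \<omega> - Q t \<omega>\<bar>} \<in> events" "{\<omega>\<in>space M. e < \<bar>?S n \<omega> - t\<bar>} \<in> events"
          using SYm[of n] Sm[of n] Qm by measurable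
        have "AE \<omega> in M. \<omega> \<in> ?P \<longrightarrow> \<omega> \<in> {\<omega>\<in>space M. e < \<bar>?SY n \<omega> - Q t \<omega>\<bar>} \<union> {\<omega>\<in>space M. e < \<bar>?S n \<omega> - t\<bar>}"
          using Y
        proof eventually_elim
          case (elim \<omega>)
          have "?SY n \<omega> = (X 0 \<omega>)\<^sup>2 + ?S n \<omega>"
          proof -
            have "Y (?u n i) \<omega> = X (?u n i) \<omega>" for i using elim u by blast
            moreover have "Y 0 \<omega> = X 0 \<omega>" using elim by blast
            ultimately show ?thesis by (simp only:)
          qed
          then show ?case by (simp only: mem_Collect_eq Un_iff) (smt (verit))
        qed
        then have "prob ?P \<le> prob ({\<omega>\<in>space M. e < \<bar>?SY n \<omega> - Q t \<omega>\<bar>} \<union> {\<omega>\<in>space M. e < \<bar>?S n \<omega> - t\<bar>})"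
          by (rule finite_measure_mono_AE) (rule sets.Un[OF A])
        also have "\<dots> \<le> prob {\<omega>\<in>space M. e < \<bar>?SY n \<omega> - Q t \<omega>\<bar>} + prob {\<omega>\<in>space M. e < \<bar>?S n \<omega> - t\<bar>}"
          by (rule measure_Un_le[OF A])
        finally show ?thesis .
      qed
      moreover have "(\<lambda>n. prob {\<omega>\<in>space M. e < \<bar>?SY n \<omega> - Q t \<omega>\<bar>} + prob {\<omega>\<in>space M. e < \<bar>?S n \<omega> - t\<bar>}) \<longlonglongrightarrow> 0 + 0"
        by (rule tendsto_add[OF lim1[OF e] lim2[OF e]])
      ultimately have "prob ?P \<le> 0 + 0" by (intro LIMSEQ_le_const) blast+
      then show ?thesis by (simp add: measure_le_0_iff)
    qed
    have "AE \<omega> in M. \<forall>m. \<not> 2 * (1 / real (Suc m)) < \<bar>Q t \<omega> - ((X 0 \<omega>)\<^sup>2 + t)\<bar>"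
      unfolding AE_all_countable
    proof
      fix m
      have "{\<omega>\<in>space M. 2 * (1 / real (Suc m)) < \<bar>Q t \<omega> - ((X 0 \<omega>)\<^sup>2 + t)\<bar>} \<in> null_sets M"
        using null[of "1 / real (Suc m)"] by (intro null_setsI) (simp add: emeasure_eq_measure, measurable)
      then show "AE \<omega> in M. \<not> 2 * (1 / real (Suc m)) < \<bar>Q t \<omega> - ((X 0 \<omega>)\<^sup>2 + t)\<bar>"
        unfolding AE_iff_null_sets not_not .
    qed
    then show ?thesis
    proof eventually_elim
      case (elim \<omega>)
      have "(\<lambda>m. 2 * (1 / real (Suc m))) \<longlonglongrightarrow> 2 * 0" by (intro tendsto_intros LIMSEQ_Suc lim_1_over_n)
      then have "\<bar>Q t \<omega> - ((X 0 \<omega>)\<^sup>2 + t)\<bar> \<le> 2 * 0"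
        by (rule LIMSEQ_le_const) (use elim in \<open>auto simp only: not_less intro: exI[of _ 0]\<close>)
      then show ?case by simp
    qed
  qed
  \<comment> \<open>Positive rationals suffice: every \<open>t \<ge> 0\<close>, including
    \<open>0\<close>, is approached from the right.\<close>
  have "AE \<omega> in M. \<forall>q\<in>{q::real. q \<in> \<rat> \<and> 0 < q}. Q q \<omega> = (X 0 \<omega>)\<^sup>2 + q"
    by (rule AE_ball_countable[THEN iffD2]) (use at in \<open>auto intro: countable_subset[OF _ countable_rat]\<close>)
  with Q0 show ?thesis
  proof eventually_elim
    case (elim \<omega>)
    show ?case
    proof (intro allI impI)
      fix t :: real assume t: "0 \<le> t"
      have "\<exists>q. q \<in> \<rat> \<and> t < q \<and> q < t + 1 / real (Suc n)" for n
        using Rats_dense_in_real[of t "t + 1 / real (Suc n)"] by auto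
      then obtain q where q: "\<And>n. q n \<in> \<rat>" "\<And>n. t < q n" "\<And>n. q n < t + 1 / real (Suc n)" by metis
      have "(\<lambda>n. t + 1 / real (Suc n)) \<longlonglongrightarrow> t + 0" by (intro tendsto_intros LIMSEQ_Suc lim_1_over_n)
      then have ql: "q \<longlonglongrightarrow> t"
        using q by (intro tendsto_sandwich[of "\<lambda>_. t" q _ "\<lambda>n. t + 1 / real (Suc n)"]) (auto intro!: always_eventually less_imp_le)
      have "continuous (at_right t) (\<lambda>t. Q t \<omega>)" using elim t by blast
      then have "((\<lambda>t. Q t \<omega>) \<longlongrightarrow> Q t \<omega>) (at_right t)" by (simp add: continuous_within)
      moreover have "filterlim q (at_right t) sequentially"
        unfolding filterlim_at using ql q(2) by (auto intro!: always_eventually simp: less_imp_neq[THEN not_sym])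
      ultimately have "(\<lambda>n. Q (q n) \<omega>) \<longlonglongrightarrow> Q t \<omega>" by (rule filterlim_compose)
      moreover have "Q (q n) \<omega> = (X 0 \<omega>)\<^sup>2 + q n" for n
      proof -
        have "0 < q n" using q(2)[of n] t by simp
        then show ?thesis using elim q(1)[of n] by blast
      qed
      ultimately have "(\<lambda>n. (X 0 \<omega>)\<^sup>2 + q n) \<longlonglongrightarrow> Q t \<omega>" by simp
      moreover have "(\<lambda>n. (X 0 \<omega>)\<^sup>2 + q n) \<longlonglongrightarrow> (X 0 \<omega>)\<^sup>2 + t" by (intro tendsto_intros ql)
      ultimately show "Q t \<omega> = (X 0 \<omega>)\<^sup>2 + t" by (rule LIMSEQ_unique)
    qed
  qed
qed

end

lemma at_time_cong:
  assumes "\<And>t. 0 \<le> t \<Longrightarrow> A t \<omega> = B t \<omega>"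
  shows "at_time A \<tau> \<omega> = at_time B \<tau> \<omega>"
  unfolding at_time_def using assms by (auto intro!: SUP_cong)

text \<open>Both expectations see \<open>Y\<close> and \<open>Q\<close> only up to a null set, and
  the filtration, hence the class of stopping times, stays the same.\<close>

lemma (in bessel) bdg_transfer:
  assumes Y: "AE \<omega> in M. \<forall>t\<ge>0. Y t \<omega> = X t \<omega>" and Q: "AE \<omega> in M. \<forall>t\<ge>0. Q t \<omega> = (X 0 \<omega>)\<^sup>2 + t"
    and \<Phi>: "moderate \<Phi>"
  shows "bdg_inequalities M F Y Q \<Phi>"
proof -
  have 1: "(\<integral>\<^sup>+\<omega>. extend_to_infinity \<Phi> (at_time (running_max Y) \<tau> \<omega>) \<partial>M) = (\<integral>\<^sup>+\<omega>. extend_to_infinity \<Phi> (max_at \<tau> \<omega>) \<partial>M)" for \<tau>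
  proof (rule nn_integral_cong_AE)
    show "AE \<omega> in M. extend_to_infinity \<Phi> (at_time (running_max Y) \<tau> \<omega>) = extend_to_infinity \<Phi> (max_at \<tau> \<omega>)"
      using Y
    proof eventually_elim
      case (elim \<omega>)
      have "running_max Y t \<omega> = running_max X t \<omega>" for t unfolding running_max_def using elim by (intro SUP_cong) auto
      then show ?case unfolding max_at_def using at_time_cong[of "running_max Y" \<omega> "running_max X" \<tau>] by simp
    qed
  qed
  have 2: "(\<integral>\<^sup>+\<omega>. extend_to_infinity \<Phi> (at_time (\<lambda>t \<omega>. sqrt (Q t \<omega>)) \<tau> \<omega>) \<partial>M) = (\<integral>\<^sup>+\<omega>. extend_to_infinity \<Phi> (root_at \<tau> \<omega>) \<partial>M)" for \<tau>
  proof (rule nn_integral_cong_AE)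
    show "AE \<omega> in M. extend_to_infinity \<Phi> (at_time (\<lambda>t \<omega>. sqrt (Q t \<omega>)) \<tau> \<omega>) = extend_to_infinity \<Phi> (root_at \<tau> \<omega>)"
      using Q
    proof eventually_elim
      case (elim \<omega>)
      then show ?case unfolding root_at_def
        using at_time_cong[of "\<lambda>t \<omega>. sqrt (Q t \<omega>)" \<omega> "\<lambda>t \<omega>. sqrt ((X 0 \<omega>)\<^sup>2 + t)" \<tau>] by simp
    qed
  qed
  show ?thesis unfolding bdg_inequalities_def 1 2 by (rule bdg_regular[OF \<Phi>])
qed

section \<open>Regularising a Bessel process on a null set\<close>

text \<open>By completeness of \<open>M\<close>. Measurability is part of
  \<open>tendsto_in_prob\<close>, so it must survive changes on null sets.\<close>

lemma (in filtered_prob_space) measurable_AE_cong: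
  fixes f g :: "'a \<Rightarrow> real"
  assumes f: "f \<in> borel_measurable M" and ae: "AE \<omega> in M. f \<omega> = g \<omega>"
  shows "g \<in> borel_measurable M"
proof (rule measurableI)
  fix A :: "real set" assume A: "A \<in> sets borel"
  show "g -` A \<inter> space M \<in> events"
  proof (rule in_sets_AE)
    show "f -` A \<inter> space M \<in> events" using f A by (rule measurable_sets)
    show "AE x in M. (x \<in> f -` A \<inter> space M) = (x \<in> g -` A \<inter> space M)" using ae by eventually_elim auto
  qed auto
qed auto

lemma (in filtered_prob_space) tendsto_in_prob_AE_cong:
  assumes t: "tendsto_in_prob M Y L" and Y: "\<And>n. AE \<omega> in M. Y n \<omega> = Y' n \<omega>"
  shows "tendsto_in_prob M Y' L"
proof -
  have Ym: "Y n \<in> borel_measurable M" for n using t by (simp add: tendsto_in_prob_def)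
  have Lm[measurable]: "L \<in> borel_measurable M" using t by (simp add: tendsto_in_prob_def)
  have Ym': "Y' n \<in> borel_measurable M" for n by (rule measurable_AE_cong[OF Ym Y])
  have "prob {\<omega>\<in>space M. \<epsilon> < \<bar>Y n \<omega> - L \<omega>\<bar>} = prob {\<omega>\<in>space M. \<epsilon> < \<bar>Y' n \<omega> - L \<omega>\<bar>}" for n \<epsilon>
  proof (rule finite_measure_eq_AE)
    show "AE x in M. (x \<in> {\<omega> \<in> space M. \<epsilon> < \<bar>Y n \<omega> - L \<omega>\<bar>}) = (x \<in> {\<omega> \<in> space M. \<epsilon> < \<bar>Y' n \<omega> - L \<omega>\<bar>})"
      using Y[of n] by eventually_elim auto
  qed (use Ym[of n] Ym'[of n] in measurable)
  then show ?thesis using t Ym' unfolding tendsto_in_prob_def by simp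
qed

text \<open>\<open>X\<close> agrees with \<open>sqrt Z\<close> only almost surely, so the regular
  version is built from \<open>Z\<close>, set to zero on the null set of bad paths. Null sets belong
  to every \<open>F t\<close>, which keeps it adapted, and the integrand
  \<open>2 * sqrt \<bar>Z\<bar>\<close> becomes \<open>2 * X'\<close>, so that
  \<open>riemann_approx\<close> applies.\<close>

lemma (in filtered_prob_space) bessel_regularisation:
  assumes \<alpha>: "1 \<le> \<alpha>" and X: "bessel_process M F \<alpha> x0 X"
  shows "\<exists>W X'. bessel M F W X' \<alpha> \<and> (AE \<omega> in M. \<forall>t\<ge>0. X t \<omega> = X' t \<omega>)"
proof -
  obtain W Z where W: "brownian_motion M F W" and Z: "squared_bessel M F W \<alpha> (\<lambda>\<omega>. (x0 \<omega>)\<^sup>2) Z"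
    and XZ: "AE \<omega> in M. \<forall>t\<ge>0. 0 \<le> X t \<omega> \<and> X t \<omega> = sqrt (Z t \<omega>)"
    using X unfolding bessel_process_def by auto
  obtain J where ZF: "adapted F Z" and Zc: "continuous_paths M Z"
    and ito: "ito_integral M F W (\<lambda>s \<omega>. 2 * sqrt \<bar>Z s \<omega>\<bar>) J"
    and ZJ: "AE \<omega> in M. \<forall>t\<ge>0. Z t \<omega> = (x0 \<omega>)\<^sup>2 + \<alpha> * t + J t \<omega>"
    using Z unfolding squared_bessel_def by auto
  obtain k a \<xi> where sp: "\<And>n. simple_process F (k n) (a n) (\<xi> n)"
    and l2: "\<And>t. 0 \<le> t \<Longrightarrow> tendsto_in_prob M (\<lambda>n \<omega>. LINT s:{0..t}|lborel. (simple_value (k n) (a n) (\<xi> n) s \<omega> - 2 * sqrt \<bar>Z s \<omega>\<bar>)\<^sup>2) (\<lambda>\<omega>. 0)"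
    and J: "\<And>t. 0 \<le> t \<Longrightarrow> tendsto_in_prob M (\<lambda>n. simple_integral (k n) (a n) (\<xi> n) W t) (J t)"
    using ito unfolding ito_integral_def by blast
  \<comment> \<open>Nonnegativity of \<open>Z\<close> is obtained from that of \<open>X\<close>,
    since the real square root preserves sign.\<close>
  define good where "good \<omega> \<longleftrightarrow> continuous_on {0..} (\<lambda>t. Z t \<omega>) \<and> (\<forall>t\<ge>0. 0 \<le> X t \<omega> \<and> X t \<omega> = sqrt (Z t \<omega>)) \<and>
    (\<forall>t\<ge>0. Z t \<omega> = (x0 \<omega>)\<^sup>2 + \<alpha> * t + J t \<omega>)" for \<omega>
  have AEgood: "AE \<omega> in M. good \<omega>"
    using Zc[unfolded continuous_paths_def] XZ ZJ unfolding good_def by eventually_elim blast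
  define N0 where "N0 = {\<omega>\<in>space M. \<not> good \<omega>}"
  have N0: "N0 \<in> null_sets M" using AEgood unfolding AE_iff_null_sets N0_def .
  define X' where "X' t \<omega> = (if \<omega> \<in> N0 then 0 else sqrt (Z t \<omega>))" for t \<omega>
  have XX': "AE \<omega> in M. \<forall>t\<ge>0. X t \<omega> = X' t \<omega>"
    using AEgood AE_space
  proof eventually_elim
    case (elim \<omega>)
    then have "\<omega> \<notin> N0" by (simp add: N0_def)
    then show ?case using elim(1) by (simp add: X'_def good_def)
  qed
  have X'F: "X' t \<in> borel_measurable (F t)" if t: "0 \<le> t" for t
  proof -
    have [measurable]: "Z t \<in> borel_measurable (F t)" using ZF t by (simp add: adapted_def)
    have [measurable]: "N0 \<in> sets (F t)" by (rule null_set_F[OF N0 t])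
    show ?thesis unfolding X'_def by measurable
  qed
  have goodZ: "0 \<le> Z t \<omega>" if "good \<omega>" "0 \<le> t" for t \<omega>
    using that by (metis good_def real_sqrt_ge_0_iff)
  have X'c: "continuous_on {0..} (\<lambda>t. X' t \<omega>)" if "\<omega> \<in> space M" for \<omega>
  proof (cases "\<omega> \<in> N0")
    case False
    then have "continuous_on {0..} (\<lambda>t. sqrt (Z t \<omega>))"
      using that by (intro continuous_intros) (auto simp: N0_def good_def)
    then show ?thesis using False by (simp add: X'_def)
  qed (simp add: X'_def)
  have X'0: "0 \<le> X' t \<omega>" if "\<omega> \<in> space M" "0 \<le> t" for t \<omega>
    using goodZ[of \<omega> t] that by (auto simp: X'_def N0_def)
  interpret brownian_adapted M F W X'
    by unfold_locales (use W X'F X'c in auto)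
  have l2': "tendsto_in_prob M (\<lambda>n \<omega>. LINT s:{0..t}|lborel. (simple_value (k n) (a n) (\<xi> n) s \<omega> - 2 * X' s \<omega>)\<^sup>2) (\<lambda>\<omega>. 0)" if t: "0 \<le> t" for t
  proof (rule tendsto_in_prob_AE_cong[OF l2[OF t]])
    fix n
    show "AE \<omega> in M. (LINT s:{0..t}|lborel. (simple_value (k n) (a n) (\<xi> n) s \<omega> - 2 * sqrt \<bar>Z s \<omega>\<bar>)\<^sup>2) =
        (LINT s:{0..t}|lborel. (simple_value (k n) (a n) (\<xi> n) s \<omega> - 2 * X' s \<omega>)\<^sup>2)"
      using AEgood AE_space
    proof eventually_elim
      case (elim \<omega>)
      then have "sqrt \<bar>Z s \<omega>\<bar> = X' s \<omega>" if "s \<in> {0..t}" for s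
        using goodZ[of \<omega> s] that by (simp add: X'_def N0_def)
      then show ?case by (intro set_lebesgue_integral_cong) auto
    qed
  qed
  have "bessel M F W X' \<alpha>"
  proof unfold_locales
    show "1 \<le> \<alpha>" by (rule \<alpha>)
    show "0 \<le> X' t \<omega>" if "\<omega> \<in> space M" "0 \<le> t" for \<omega> t using X'0 that .
    fix s T \<epsilon> :: real assume sT: "0 \<le> s" "s < T" and \<epsilon>: "0 < \<epsilon>"
    let ?R = "\<lambda>N. step_sum (ugrid s T N) (\<lambda>i \<omega>. 2 * X' (ugrid s T N i) \<omega>)"
    let ?A = "\<lambda>N. {\<omega>\<in>space M. \<exists>i\<le>N. \<bar>J (ugrid s T N i) \<omega> - J s \<omega> - ?R N i \<omega>\<bar> > \<epsilon>}"
    let ?B = "\<lambda>N. {\<omega>\<in>space M. \<exists>i\<le>N. \<bar>(X' (ugrid s T N i) \<omega>)\<^sup>2 - (X' s \<omega>)\<^sup>2 - \<alpha> * (ugrid s T N i - s) - ?R N i \<omega>\<bar> > \<epsilon>}"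
    have u: "0 \<le> ugrid s T N i" for N i using ugrid_ge[of s T N i] sT by auto
    have Jm: "J t \<in> borel_measurable M" if "0 \<le> t" for t using J[OF that] by (simp add: tendsto_in_prob_def)
    have Rm: "?R N i \<in> borel_measurable M" for N i
      unfolding step_sum_def using X_M[OF u] W_M[OF u]
      by (intro borel_measurable_sum borel_measurable_times borel_measurable_diff) auto
    have Am: "?A N \<in> events" for N
    proof -
      have "{\<omega>\<in>space M. \<exists>i\<in>{..N}. \<bar>J (ugrid s T N i) \<omega> - J s \<omega> - ?R N i \<omega>\<bar> > \<epsilon>} \<in> events"
      proof (intro sets.sets_Collect_finite_Ex)
        fix i
        note [measurable] = Jm[OF u[of N i]] Jm[OF sT(1)] Rm[of N i]
        show "{\<omega>\<in>space M. \<bar>J (ugrid s T N i) \<omega> - J s \<omega> - ?R N i \<omega>\<bar> > \<epsilon>} \<in> events" by measurable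
      qed auto
      then show ?thesis by (simp only: Bex_def atMost_iff)
    qed
    \<comment> \<open>On good paths the integral equation turns the increment of the square minus
      the drift into that of \<open>J\<close>, so the two events agree there; measurability is at
      hand for \<open>?A N\<close>.\<close>
    have le: "prob (?B N) \<le> prob (?A N)" for N
    proof (rule finite_measure_mono_AE[OF _ Am])
      show "AE \<omega> in M. \<omega> \<in> ?B N \<longrightarrow> \<omega> \<in> ?A N"
        using AEgood AE_space
      proof eventually_elim
        case (elim \<omega>)
        have sq: "(X' t \<omega>)\<^sup>2 = (x0 \<omega>)\<^sup>2 + \<alpha> * t + J t \<omega>" if "0 \<le> t" for t
        proof -
          have "(X' t \<omega>)\<^sup>2 = Z t \<omega>" using goodZ[OF elim(1) that] elim by (simp add: X'_def N0_def)
          then show ?thesis using elim(1) that by (simp add: good_def)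
        qed
        have eq: "(X' (ugrid s T N i) \<omega>)\<^sup>2 - (X' s \<omega>)\<^sup>2 - \<alpha> * (ugrid s T N i - s) - ?R N i \<omega> = J (ugrid s T N i) \<omega> - J s \<omega> - ?R N i \<omega>" for i
          unfolding sq[OF u] sq[OF sT(1)] by (simp add: algebra_simps)
        show ?case unfolding mem_Collect_eq eq by blast
      qed
    qed
    show "(\<lambda>N. prob (?B N)) \<longlonglongrightarrow> 0"
      by (rule tendsto_sandwich[OF always_eventually[OF allI[OF measure_nonneg]] always_eventually[OF allI[OF le]]
            tendsto_const riemann_approx[OF sp l2' J sT \<epsilon>]])
  qed
  then show ?thesis using XX' by blast
qed

theorem theorem7:
  fixes M :: "'a measure" and F :: "real \<Rightarrow> 'a measure"
    and \<alpha> :: real and x\<^sub>0 :: "'a \<Rightarrow> real" and X Q :: "real \<Rightarrow> 'a \<Rightarrow> real"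
  assumes "filtered_prob_space M F"
    and "1 \<le> \<alpha>"
    and "x\<^sub>0 \<in> borel_measurable (F 0)" and "\<And>\<omega>. \<omega> \<in> space M \<Longrightarrow> 0 \<le> x\<^sub>0 \<omega>"
    and "bessel_process M F \<alpha> x\<^sub>0 X"
    and "quadratic_variation M F X Q"
  shows "(\<forall>p>0. bdg_inequalities M F X Q (\<lambda>t. t powr p)) \<and>
    (\<forall>\<Phi>. moderate \<Phi> \<longrightarrow> bdg_inequalities M F X Q \<Phi>)"
proof -
  interpret filtered_prob_space M F by (rule assms(1))
  obtain W X' where B: "bessel M F W X' \<alpha>" and XX': "AE \<omega> in M. \<forall>t\<ge>0. X t \<omega> = X' t \<omega>"
    using bessel_regularisation[OF assms(2,5)] by blast
  interpret bessel M F W X' \<alpha> by (rule B)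
  have "bdg_inequalities M F X Q \<Phi>" if "moderate \<Phi>" for \<Phi>
    by (rule bdg_transfer[OF XX' quadratic_variation_eq[OF assms(6) XX'] that])
  then show ?thesis using moderate_powr by blast
qed

end
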